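(* Let $X$ be a finite dimensional CAT(0) cubed complex and let $W$ be a connected subcomplex of $X$. Then $W$ is convex in $X$ if and only if, for every vertex $v$ of $W$, the geometric link $\mathrm{Lk}(v,W)$ is a full subcomplex of $\mathrm{Lk}(v,X)$.
   Context: A cubed complex is a space $X$ obtained as a quotient $p:\hat X\to X$ of a disjoint union of Euclidean unit cubes $\hat X=\bigsqcup_{\lambda\in\Lambda}(I^{n_\lambda}\times\{\lambda\})$, $I=[0,1]$, by gluing faces through isometries; precisely, $p$ is injective on the interior of each face of each cube, and whenever $p(x_1)=p(x_2)$ with $x_1,x_2$ in cubes $\lambda_1,\lambda_2$, there is an isometry $h$ from the smallest face containing $x_1$ onto the smallest face containing $x_2$ with $p(y)=p(h(y))$ for all $y$ in the former. (The map $p$ need not be injective on a closed cube.) $X$ carries the length metric $d_X$ induced from the Euclidean metrics of the cubes: the distance between two points is the infimum of the lengths of paths that are finite concatenations of straight segments, each contained in (the image of) one cube. Its dimension is $\max n_\lambda$. A subcomplex is a union of closed cells (images of faces of cubes). A geodesic space is CAT(0) if every geodesic triangle is at least as thin as its comparison triangle in the Euclidean plane; such a space is uniquely geodesic. $X$ is a CAT(0) cubed complex if $(X,d_X)$ is a CAT(0) space. A subset $W$ of a uniquely geodesic space $X$ is convex if for any distinct $a,b\in W$ the unique geodesic segment $[a,b]$ in $X$ is contained in $W$. For a vertex $v$ of $X$, the geometric link $\mathrm{Lk}(v,X)$ is the all-right spherical complex obtained by gluing, over all $v_\lambda\in p^{-1}(v)$ that are vertices of cubes $I^{n_\lambda}\times\{\lambda\}$,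 the spaces of directions of the cubes at $v_\lambda$ (each is a spherical simplex in $S^{n_\lambda-1}$ all of whose edges have length $\pi/2$), along the gluings induced by $p$. For a CAT(0) cubed complex $X$ it is a simplicial complex. For a vertex $v$ of a subcomplex $W$, $\mathrm{Lk}(v,W)$ is regarded as a subcomplex of $\mathrm{Lk}(v,X)$. A subcomplex $K$ of a simplicial complex $L$ is full if every simplex of $L$ all of whose vertices are in $K$ is contained in $K$. *)

theory Defs
  imports "HOL-Analysis.Analysis"
begin

section \<open>CAT(0) spaces and convexity\<close>

definition geodesic_segment ::
    "'a set \<Rightarrow> ('a \<Rightarrow> 'a \<Rightarrow> real) \<Rightarrow> 'a \<Rightarrow> 'a \<Rightarrow> 'a set \<Rightarrow> bool" where
  "geodesic_segment M d a b S \<longleftrightarrow>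
     (\<exists>g :: real \<Rightarrow> 'a.
        g 0 = a \<and> g (d a b) = b \<and> S = g ` {0..d a b} \<and> S \<subseteq> M \<and>
        (\<forall>s\<in>{0..d a b}. \<forall>t\<in>{0..d a b}. d (g s) (g t) = \<bar>s - t\<bar>))"

definition geodesic_space :: "'a set \<Rightarrow> ('a \<Rightarrow> 'a \<Rightarrow> real) \<Rightarrow> bool" where
  "geodesic_space M d \<longleftrightarrow>
     Metric_space M d \<and> (\<forall>a\<in>M. \<forall>b\<in>M. \<exists>S. geodesic_segment M d a b S)"

text \<open>In a geodesic triangle with vertices \<open>a\<close>, \<open>b\<close>, \<open>c\<close>, the points compared lie on two sides
  with a common vertex, called \<open>a\<close> here; the other pairs of distinct sides arise by renaming
  the vertices, and for two points on one side there is nothing to compare.\<close>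

definition CAT0_space :: "'a set \<Rightarrow> ('a \<Rightarrow> 'a \<Rightarrow> real) \<Rightarrow> bool" where
  "CAT0_space M d \<longleftrightarrow>
     geodesic_space M d \<and>
     (\<forall>a\<in>M. \<forall>b\<in>M. \<forall>c\<in>M. \<forall>S_ab S_ac S_bc. \<forall>(a'::real^2) (b'::real^2) (c'::real^2).
        geodesic_segment M d a b S_ab \<and> geodesic_segment M d a c S_ac \<and>
        geodesic_segment M d b c S_bc \<and>
        dist a' b' = d a b \<and> dist a' c' = d a c \<and> dist b' c' = d b c \<longrightarrow>
        (\<forall>x\<in>S_ab. \<forall>y\<in>S_ac. \<forall>x'\<in>closed_segment a' b'. \<forall>y'\<in>closed_segment a' c'.
           dist a' x' = d a x \<and> dist a' y' = d a y \<longrightarrow> d x y \<le> dist x' y'))"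

text \<open>For uniquely geodesic spaces, where \<open>S\<close> is the only segment from \<open>a\<close> to \<open>b\<close>.\<close>

definition geodesically_convex ::
    "'a set \<Rightarrow> ('a \<Rightarrow> 'a \<Rightarrow> real) \<Rightarrow> 'a set \<Rightarrow> bool" where
  "geodesically_convex M d W \<longleftrightarrow>
     W \<subseteq> M \<and>
     (\<forall>a\<in>W. \<forall>b\<in>W. a \<noteq> b \<longrightarrow> (\<forall>S. geodesic_segment M d a b S \<longrightarrow> S \<subseteq> W))"


section \<open>Unit cubes and their faces\<close>

text \<open>As for \<^const>\<open>Euclidean_space\<close>, points of Euclidean \<open>n\<close>-space are functions on the naturals
  that vanish from index \<open>n\<close> on.\<close>

type_synonym point = "nat \<Rightarrow> real"

definition unit_cube :: "nat \<Rightarrow> point set" where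
  "unit_cube n = {x. (\<forall>i<n. 0 \<le> x i \<and> x i \<le> 1) \<and> (\<forall>i\<ge>n. x i = 0)}"

definition euclid_dist :: "nat \<Rightarrow> point \<Rightarrow> point \<Rightarrow> real" where
  "euclid_dist n x y = L2_set (\<lambda>i. x i - y i) {..<n}"

definition is_face :: "nat \<Rightarrow> point set \<Rightarrow> bool" where
  "is_face n F \<longleftrightarrow>
     (\<exists>A e. A \<subseteq> {..<n} \<and> (\<forall>i\<in>A. e i = 0 \<or> e i = 1) \<and>
        F = {x \<in> unit_cube n. \<forall>i\<in>A. x i = e i})"

definition face_interior :: "nat \<Rightarrow> point set \<Rightarrow> point set" where
  "face_interior n F = F - \<Union>{G. is_face n G \<and> G \<subset> F}"

definition smallest_face :: "nat \<Rightarrow> point \<Rightarrow> point set" where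
  "smallest_face n x = \<Inter>{F. is_face n F \<and> x \<in> F}"

definition face_isometry ::
    "nat \<Rightarrow> point set \<Rightarrow> nat \<Rightarrow> point set \<Rightarrow> (point \<Rightarrow> point) \<Rightarrow> bool" where
  "face_isometry n F n' F' h \<longleftrightarrow>
     bij_betw h F F' \<and> (\<forall>x\<in>F. \<forall>y\<in>F. euclid_dist n' (h x) (h y) = euclid_dist n x y)"


section \<open>Cubed complexes\<close>

text \<open>The cube with index \<open>l\<close> is \<open>unit_cube (cdim X l)\<close>, and \<open>quot X l\<close> is the restriction of the
  quotient map \<open>p\<close> to it.\<close>

record ('l, 'a) cubing =
  cubes :: "'l set"
  cdim :: "'l \<Rightarrow> nat"
  quot :: "'l \<Rightarrow> point \<Rightarrow> 'a"

definition space_of :: "('l, 'a) cubing \<Rightarrow> 'a set" where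
  "space_of X = (\<Union>l\<in>cubes X. quot X l ` unit_cube (cdim X l))"

definition gluing ::
    "('l, 'a) cubing \<Rightarrow> 'l \<Rightarrow> point set \<Rightarrow> 'l \<Rightarrow> point set \<Rightarrow> (point \<Rightarrow> point) \<Rightarrow> bool" where
  "gluing X l F l' F' h \<longleftrightarrow>
     face_isometry (cdim X l) F (cdim X l') F' h \<and> (\<forall>y\<in>F. quot X l y = quot X l' (h y))"

definition cubed_complex :: "('l, 'a) cubing \<Rightarrow> bool" where
  "cubed_complex X \<longleftrightarrow>
     (\<forall>l\<in>cubes X. \<forall>F. is_face (cdim X l) F \<longrightarrow>
        inj_on (quot X l) (face_interior (cdim X l) F)) \<and>
     (\<forall>l\<in>cubes X. \<forall>l'\<in>cubes X. \<forall>x\<in>unit_cube (cdim X l). \<forall>x'\<in>unit_cube (cdim X l').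
        quot X l x = quot X l' x' \<longrightarrow>
        (\<exists>h. gluing X l (smallest_face (cdim X l) x) l' (smallest_face (cdim X l') x') h))"

definition finite_dimensional :: "('l, 'a) cubing \<Rightarrow> bool" where
  "finite_dimensional X \<longleftrightarrow> bdd_above (cdim X ` cubes X)"

text \<open>A path from \<open>a\<close> to \<open>b\<close> is a list of segments, each given by a cube and its two end points
  in that cube.\<close>

fun segment_path ::
    "('l, 'a) cubing \<Rightarrow> 'a \<Rightarrow> ('l \<times> point \<times> point) list \<Rightarrow> 'a \<Rightarrow> bool" where
  "segment_path X a [] b \<longleftrightarrow> a = b"
| "segment_path X a ((l, x, y) # s) b \<longleftrightarrow>
     l \<in> cubes X \<and> x \<in> unit_cube (cdim X l) \<and> y \<in> unit_cube (cdim X l) \<and>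
     quot X l x = a \<and> segment_path X (quot X l y) s b"

definition path_len :: "('l, 'a) cubing \<Rightarrow> ('l \<times> point \<times> point) list \<Rightarrow> real" where
  "path_len X s = (\<Sum>(l, x, y)\<leftarrow>s. euclid_dist (cdim X l) x y)"

text \<open>The distance is infinite between points that no path joins. The real-valued \<open>cdist\<close> is
  meaningful only where \<open>ext_cdist\<close> is finite, which is part of \<open>CAT0_cubed_complex\<close>.\<close>

definition ext_cdist :: "('l, 'a) cubing \<Rightarrow> 'a \<Rightarrow> 'a \<Rightarrow> ennreal" where
  "ext_cdist X a b = (INF s\<in>{s. segment_path X a s b}. ennreal (path_len X s))"

definition cdist :: "('l, 'a) cubing \<Rightarrow> 'a \<Rightarrow> 'a \<Rightarrow> real" where
  "cdist X a b = enn2real (ext_cdist X a b)"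

definition CAT0_cubed_complex :: "('l, 'a) cubing \<Rightarrow> bool" where
  "CAT0_cubed_complex X \<longleftrightarrow>
     cubed_complex X \<and>
     (\<forall>a\<in>space_of X. \<forall>b\<in>space_of X. ext_cdist X a b < \<infinity>) \<and>
     CAT0_space (space_of X) (cdist X)"

definition ctopology :: "('l, 'a) cubing \<Rightarrow> 'a topology" where
  "ctopology X = Metric_space.mtopology (space_of X) (cdist X)"

definition closed_cells :: "('l, 'a) cubing \<Rightarrow> 'a set set" where
  "closed_cells X = {quot X l ` F |l F. l \<in> cubes X \<and> is_face (cdim X l) F}"

definition subcomplex :: "('l, 'a) cubing \<Rightarrow> 'a set \<Rightarrow> bool" where
  "subcomplex X W \<longleftrightarrow> (\<exists>C. C \<subseteq> closed_cells X \<and> W = \<Union>C)"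

definition vertices :: "('l, 'a) cubing \<Rightarrow> 'a set" where
  "vertices X = {quot X l x |l x. l \<in> cubes X \<and> is_face (cdim X l) {x}}"


section \<open>Geometric links\<close>

text \<open>The unit vectors at the vertex \<open>x\<close> of the face \<open>F\<close> that point into \<open>F\<close>; since \<open>F\<close> is convex,
  one \<open>t > 0\<close> suffices. If \<open>F\<close> has dimension \<open>k\<close>, they form an all-right spherical
  \<open>(k - 1)\<close>-simplex.\<close>

definition directions :: "nat \<Rightarrow> point set \<Rightarrow> point \<Rightarrow> point set" where
  "directions n F x =
     {u. (\<forall>i\<ge>n. u i = 0) \<and> L2_set u {..<n} = 1 \<and> (\<exists>t>0. (\<lambda>i. x i + t * u i) \<in> F)}"

text \<open>A gluing \<open>h\<close> of faces that maps the vertex \<open>x\<close> to \<open>x'\<close> identifies the direction \<open>u\<close> at \<open>x\<close>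
  with its image \<open>u'\<close> under the derivative of \<open>h\<close>. As \<open>h\<close> is affine, \<open>u'\<close> can be read off from
  \<open>h (x + t u) = x' + t u'\<close> for a single \<open>t > 0\<close>.\<close>

definition glued_directions ::
    "('l, 'a) cubing \<Rightarrow> 'l \<times> point \<times> point \<Rightarrow> 'l \<times> point \<times> point \<Rightarrow> bool" where
  "glued_directions X = (\<lambda>(l, x, u) (l', x', u').
     l \<in> cubes X \<and> l' \<in> cubes X \<and>
     is_face (cdim X l) {x} \<and> is_face (cdim X l') {x'} \<and>
     (\<exists>F F' h. is_face (cdim X l) F \<and> is_face (cdim X l') F' \<and> gluing X l F l' F' h \<and>
        x \<in> F \<and> h x = x' \<and> u \<in> directions (cdim X l) F x \<and> u' \<in> directions (cdim X l') F' x' \<and>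
        (\<exists>t>0. (\<lambda>i. x i + t * u i) \<in> F \<and> h (\<lambda>i. x i + t * u i) = (\<lambda>i. x' i + t * u' i))))"

definition link_point ::
    "('l, 'a) cubing \<Rightarrow> 'l \<times> point \<times> point \<Rightarrow> ('l \<times> point \<times> point) set" where
  "link_point X q = {q'. equivclp (glued_directions X) q q'}"

text \<open>\<open>Lk X v W\<close> is the link at \<open>v\<close> of a subcomplex \<open>W\<close> of \<open>X\<close>, realised inside that of \<open>X\<close>. It is
  given by its nonempty closed simplices, which are sets of points of the link of \<open>X\<close>: one for
  each face \<open>F\<close> of a cube with image in \<open>W\<close> and each vertex \<open>x\<close> of \<open>F\<close> over \<open>v\<close>. The link of \<open>X\<close>
  itself is the case \<open>W = space_of X\<close>.\<close>

definition Lk :: "('l, 'a) cubing \<Rightarrow> 'a \<Rightarrow> 'a set \<Rightarrow> ('l \<times> point \<times> point) set set set" where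
  "Lk X v W =
     {link_point X ` {(l, x, u) |u. u \<in> directions (cdim X l) F x} |l x F.
        l \<in> cubes X \<and> is_face (cdim X l) {x} \<and> quot X l x = v \<and>
        is_face (cdim X l) F \<and> x \<in> F \<and> F \<noteq> {x} \<and> quot X l ` F \<subseteq> W}"

text \<open>For complexes given by their nonempty closed simplices as point sets; \<open>q\<close> is a vertex of a
  complex iff \<open>{q}\<close> is one of its simplices.\<close>

definition full_subcomplex :: "'b set set \<Rightarrow> 'b set set \<Rightarrow> bool" where
  "full_subcomplex K L \<longleftrightarrow>
     K \<subseteq> L \<and> (\<forall>\<sigma>\<in>L. (\<forall>q\<in>\<sigma>. {q} \<in> L \<longrightarrow> {q} \<in> K) \<longrightarrow> \<sigma> \<in> K)"

end

theory Submission
  imports Defs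
begin

text \<open>The theorem rests on three facts about a CAT(0) cubed complex \<open>X\<close>.

\<^item> Every cube embeds isometrically (\<open>cube_isometric\<close>). A short path that starts inside a cube
  stays among cubes that contain a copy of that cube as a face, so the cube map is an isometry near
  interior points (\<open>path_in_star\<close>, \<open>cdist_interior_near\<close>); hence straight segments are local
  geodesics, and in a CAT(0) space local geodesics are geodesics.
\<^item> The carrier of a point, the smallest closed cell containing it, can only grow near the point
  (\<open>carrier_near\<close>). So a point \<open>a\<close> and any point close enough to \<open>a\<close> lie in a common cube, and
  subcomplexes are closed.
\<^item> CAT(0) comparison is needed only in the form of Stewart's inequality (\<open>stewart\<close>).

If \<open>W\<close> is convex and the edges at the vertex \<open>x\<close> of a face \<open>F\<close> lie in \<open>W\<close>, then joining points of
these edges by straight segments, which are geodesics of \<open>X\<close>, produces an interior point of \<open>F\<close> in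
\<open>W\<close>, and a subcomplex that contains an interior point of a cell contains the cell
(\<open>convex_contains_face\<close>). So links in \<open>W\<close> are full.

If the links are full, \<open>W\<close> is locally convex (\<open>full_links_imp_locally_convex\<close>). Take a short geodesic
with ends in \<open>W\<close>; it runs in the open star of a vertex \<open>v\<close> of \<open>W\<close>. For a neighbour \<open>u\<close> of \<open>v\<close>
let the height of a point be its coordinate along the edge from \<open>v\<close> to \<open>u\<close>, and zero on cells that
do not contain this edge. Along the geodesic the height is continuous, and it is midpoint convex
wherever it is positive: there the geodesic runs locally in cubes that contain its current carrier,
and comparison with the foot of the current point on the face of height zero gives the
inequality. A height that vanishes at both ends therefore vanishes throughout. If the edge is not in
\<open>W\<close>, the height does vanish at both ends; so the geodesic only meets cells all of whose edges at
\<open>v\<close> are in \<open>W\<close>, and by fullness these cells are in \<open>W\<close>.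

Finally a closed, connected, locally convex subset \<open>W\<close> of a CAT(0) space is convex
(\<open>locally_convex_imp_convex\<close>): the points of \<open>W\<close> that are joined to a given point by a geodesic in
\<open>W\<close> form an open and closed subset of \<open>W\<close>. Openness is the same maximum argument, applied to the
distance to \<open>W\<close> along a geodesic that stays close to one contained in \<open>W\<close>.\<close>

section \<open>CAT(0) spaces\<close>

locale CAT0 = Metric_space M d for M :: "'a set" and d :: "'a \<Rightarrow> 'a \<Rightarrow> real" +
  assumes CAT0: "CAT0_space M d"
begin

text \<open>The point at parameter \<open>t\<close> of the geodesic from \<open>a\<close> to \<open>b\<close>, described by distances alone:
  points so described need not be tied to a chosen geodesic.\<close>

definition between :: "real \<Rightarrow> 'a \<Rightarrow> 'a \<Rightarrow> 'a \<Rightarrow> bool" where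
  "between t a b m \<longleftrightarrow> m \<in> M \<and> d a m = t * d a b \<and> d m b = (1 - t) * d a b"

lemma segment_exists:
  assumes "a \<in> M" "b \<in> M"
  obtains S where "geodesic_segment M d a b S"
  using CAT0 assms unfolding CAT0_space_def geodesic_space_def by blast

text \<open>The triangle inequality leaves no room for the concatenation of geodesics from \<open>a\<close> to \<open>m\<close> and
  from \<open>m\<close> to \<open>b\<close> not to be a geodesic. This places every metrically intermediate point on a side
  of a triangle, where the CAT(0) inequality applies to it.\<close>

lemma segment_through:
  assumes ab: "a \<in> M" "b \<in> M" and t: "0 \<le> t" "t \<le> 1" and m: "between t a b m"
  shows "\<exists>S. geodesic_segment M d a b S \<and> m \<in> S"
proof -
  have mM: "m \<in> M" and am: "d a m = t * d a b" and mb: "d m b = (1 - t) * d a b"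
    using m by (auto simp: between_def)
  define L1 where "L1 = d a m"
  define L where "L = d a b"
  have L12: "d m b = L - L1" by (simp add: L1_def L_def am mb algebra_simps)
  obtain S1 where "geodesic_segment M d a m S1" using segment_exists ab mM by blast
  then obtain g1 where g1: "g1 0 = a" "g1 L1 = m" "g1 ` {0..L1} \<subseteq> M"
      "\<And>s t. s \<in> {0..L1} \<Longrightarrow> t \<in> {0..L1} \<Longrightarrow> d (g1 s) (g1 t) = \<bar>s - t\<bar>"
    unfolding geodesic_segment_def L1_def by auto
  obtain S2 where "geodesic_segment M d m b S2" using segment_exists ab mM by blast
  then obtain g2 where g2: "g2 0 = m" "g2 (L - L1) = b" "g2 ` {0..L - L1} \<subseteq> M"
      "\<And>s t. s \<in> {0..L - L1} \<Longrightarrow> t \<in> {0..L - L1} \<Longrightarrow> d (g2 s) (g2 t) = \<bar>s - t\<bar>"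
    unfolding geodesic_segment_def L12 by auto
  define g where "g s = (if s \<le> L1 then g1 s else g2 (s - L1))" for s
  have L: "0 \<le> L1" "L1 \<le> L" using nonneg[of m b] L12 nonneg[of a m] L1_def by linarith+
  have gM: "g s \<in> M" if "s \<in> {0..L}" for s
  proof (cases "s \<le> L1")
    case True then have "s \<in> {0..L1}" using that by simp
    then show ?thesis using g1(3) True by (auto simp: g_def)
  next
    case False then have "s - L1 \<in> {0..L - L1}" using that by simp
    then show ?thesis using g2(3) False by (auto simp: g_def)
  qed
  have g0: "g 0 = a" using L g1 by (simp add: g_def)
  have gL: "g L = b"
  proof (cases "L = L1")
    case True then have "d m b = 0" using L12 by simp
    then have "m = b" using mM ab by simp
    then show ?thesis using True g1 by (simp add: g_def)
  next
    case False then show ?thesis using L g2 by (simp add: g_def)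
  qed
  have gm: "g L1 = m" using g1 by (simp add: g_def)
  have dist_le: "d (g s) (g t) \<le> t - s" "s \<le> L1 \<and> L1 < t \<or> d (g s) (g t) = t - s"
    if st: "0 \<le> s" "s \<le> t" "t \<le> L" for s t
  proof -
    consider "t \<le> L1" | "L1 < s" | "s \<le> L1" "L1 < t" by linarith
    then have "d (g s) (g t) \<le> t - s \<and> (s \<le> L1 \<and> L1 < t \<or> d (g s) (g t) = t - s)"
    proof cases
      case 1 then show ?thesis using st g1(4)[of s t] by (simp add: g_def)
    next
      case 2 then show ?thesis using st g2(4)[of "s - L1" "t - L1"] by (simp add: g_def)
    next
      case 3
      have "d (g s) m = L1 - s" using 3 st g1(2) g1(4)[of s L1] L by (simp add: g_def)
      moreover have "d m (g t) = t - L1" using 3 st g2(1) g2(4)[of 0 "t - L1"] L by (simp add: g_def)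
      ultimately show ?thesis using 3 triangle[of "g s" m "g t"] gM[of s] gM[of t] mM st by auto
    qed
    then show "d (g s) (g t) \<le> t - s" "s \<le> L1 \<and> L1 < t \<or> d (g s) (g t) = t - s" by auto
  qed
  have eq: "d (g s) (g t) = t - s" if st: "0 \<le> s" "s \<le> t" "t \<le> L" for s t
  proof -
    have "L \<le> d a (g s) + d (g s) (g t) + d (g t) b"
      using triangle[of a "g s" b] triangle[of "g s" "g t" b] gM[of s] gM[of t] ab st L
      unfolding L_def by auto
    moreover have "d a (g s) \<le> s" using dist_le(1)[of 0 s] st g0 by simp
    moreover have "d (g t) b \<le> L - t" using dist_le(1)[of t L] st gL by simp
    ultimately show ?thesis using dist_le(1)[OF st] by linarith
  qed
  have "geodesic_segment M d a b (g ` {0..L})"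
    unfolding geodesic_segment_def L_def[symmetric]
  proof (intro exI[of _ g] conjI ballI)
    fix s t assume "s \<in> {0..L}" "t \<in> {0..L}"
    then show "d (g s) (g t) = \<bar>s - t\<bar>"
      using eq[of s t] eq[of t s] commute[of "g s" "g t"] by (cases "s \<le> t") auto
  qed (use g0 gL gM in auto)
  moreover have "m \<in> g ` {0..L}" using gm L by force
  ultimately show ?thesis by blast
qed

text \<open>The law of cosines gives the first coordinate of the third vertex when the first vertex is the
  origin and the second lies on the first axis.\<close>

lemma plane_triangle_exists:
  fixes A B C :: real
  assumes "0 \<le> A" "0 \<le> B" "0 \<le> C" "A \<le> B + C" "B \<le> A + C" "C \<le> A + B"
  shows "\<exists>a b c :: real^2. dist a b = A \<and> dist a c = B \<and> dist b c = C"
proof (cases "A = 0")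
  case True
  then have "B = C" using assms by simp
  show ?thesis
    using True \<open>B = C\<close> assms
    by (intro exI[of _ 0] exI[of _ "vector [B, 0]"])
       (auto simp: dist_vec_def L2_set_def UNIV_2 vector_2)
next
  case False
  then have A: "A > 0" using assms by simp
  define x where "x = (A\<^sup>2 + B\<^sup>2 - C\<^sup>2) / (2 * A)"
  have xA: "2 * A * x = A\<^sup>2 + B\<^sup>2 - C\<^sup>2" using A by (simp add: x_def)
  have "(A - B)\<^sup>2 \<le> C\<^sup>2" using assms by (intro power2_le_iff_abs_le[THEN iffD2]) auto
  then have "A\<^sup>2 + B\<^sup>2 - C\<^sup>2 \<le> 2 * A * B" by (simp add: power2_eq_square algebra_simps)
  then have 1: "x \<le> B" using A mult_le_cancel_left_pos[of "2 * A" x B] xA by simp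
  have "C\<^sup>2 \<le> (A + B)\<^sup>2" using assms by (intro power_mono) auto
  then have "2 * A * (-B) \<le> A\<^sup>2 + B\<^sup>2 - C\<^sup>2" by (simp add: power2_eq_square algebra_simps)
  then have 2: "-B \<le> x" using A mult_le_cancel_left_pos[of "2 * A" "-B" x] xA by simp
  have x2: "x\<^sup>2 \<le> B\<^sup>2" using 1 2 assms by (intro power2_le_iff_abs_le[THEN iffD2]) auto
  define y where "y = sqrt (B\<^sup>2 - x\<^sup>2)"
  have y: "x\<^sup>2 + y\<^sup>2 = B\<^sup>2" using x2 by (simp add: y_def)
  have "(A - x)\<^sup>2 + y\<^sup>2 = A\<^sup>2 - 2 * A * x + B\<^sup>2" using y by (simp add: power2_eq_square algebra_simps)
  then have z: "(A - x)\<^sup>2 + y\<^sup>2 = C\<^sup>2" using xA by simp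
  show ?thesis
    using y z assms
    by (intro exI[of _ 0] exI[of _ "vector [A, 0]"] exI[of _ "vector [x, y]"])
       (auto simp: dist_vec_def L2_set_def UNIV_2 vector_2 dist_real_def)
qed

text \<open>The only place where the CAT(0) condition is used: the right-hand side is the squared distance
  between the corresponding points of the comparison triangle, by Stewart's theorem in the plane.
  All further comparison statements are algebraic consequences.\<close>

lemma stewart:
  assumes M: "a \<in> M" "b \<in> M" "u \<in> M" and t: "0 \<le> t" "t \<le> 1" and m: "between t a b m"
  shows "(d m u)\<^sup>2 \<le> (1 - t) * (d a u)\<^sup>2 + t * (d b u)\<^sup>2 - t * (1 - t) * (d a b)\<^sup>2"
proof -
  obtain S where S: "geodesic_segment M d a b S" "m \<in> S" using segment_through[OF M(1,2) t m] by blast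
  obtain S1 where S1: "geodesic_segment M d a u S1" using segment_exists M by blast
  obtain S2 where S2: "geodesic_segment M d b u S2" using segment_exists M by blast
  have "u \<in> S1" using S1 unfolding geodesic_segment_def
    by (metis atLeastAtMost_iff image_eqI nonneg order_refl)
  obtain a' b' u' :: "real^2" where P: "dist a' b' = d a b" "dist a' u' = d a u" "dist b' u' = d b u"
    using plane_triangle_exists[of "d a b" "d a u" "d b u"] triangle[OF M(1,3,2)] triangle[OF M(1,2,3)]
      triangle[OF M(2,1,3)] commute[of b a] commute[of u b] by auto
  define m' where "m' = (1 - t) *\<^sub>R a' + t *\<^sub>R b'"
  have m': "m' \<in> closed_segment a' b'" using t by (auto simp: m'_def closed_segment_def)
  have e: "a' - m' = t *\<^sub>R (a' - b')" by (simp add: m'_def algebra_simps)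
  have "dist a' m' = t * d a b" unfolding dist_norm e using t P by (simp add: dist_norm)
  then have dm: "dist a' m' = d a m" using m by (simp add: between_def)
  have "d m u \<le> dist m' u'"
    using CAT0[unfolded CAT0_space_def, THEN conjunct2, rule_format, OF M, of S S1 S2 a' b' u' m u m' u']
      S S1 S2 P \<open>u \<in> S1\<close> m' dm by simp
  then have "(d m u)\<^sup>2 \<le> (dist m' u')\<^sup>2" by (simp add: power_mono)
  also have "(dist m' u')\<^sup>2 = (1 - t) * (dist a' u')\<^sup>2 + t * (dist b' u')\<^sup>2 - t * (1 - t) * (dist a' b')\<^sup>2"
    unfolding dist_norm m'_def power2_norm_eq_inner
    by (simp add: inner_commute algebra_simps)
  finally show ?thesis using P by simp
qed

lemma between_ends [simp]: "a \<in> M \<Longrightarrow> b \<in> M \<Longrightarrow> between 0 a b a" "a \<in> M \<Longrightarrow> b \<in> M \<Longrightarrow> between 1 a b b"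
  by (auto simp: between_def)

lemma between_in: "between t a b m \<Longrightarrow> m \<in> M"
  by (simp add: between_def)

lemma between_unique:
  assumes "a \<in> M" "b \<in> M" "0 \<le> t" "t \<le> 1" "between t a b m" "between t a b m'"
  shows "m = m'"
proof -
  have "(d m m')\<^sup>2 \<le> (1 - t) * (t * d a b)\<^sup>2 + t * ((1 - t) * d a b)\<^sup>2 - t * (1 - t) * (d a b)\<^sup>2"
    using stewart[OF assms(1,2) between_in[OF assms(6)] assms(3,4,5)] assms(6) commute
    by (simp add: between_def)
  also have "\<dots> = 0" by (simp add: power2_eq_square algebra_simps)
  finally show ?thesis using assms(5,6) by (simp add: between_in)
qed

text \<open>The choice is immaterial by uniqueness of intermediate points.\<close>

definition geod :: "'a \<Rightarrow> 'a \<Rightarrow> real \<Rightarrow> 'a" where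
  "geod a b t = (SOME m. between t a b m)"

lemma segment_param:
  assumes S: "geodesic_segment M d a b S" and "a \<in> M" "b \<in> M"
  shows "S = geod a b ` {0..1}"
    and "\<And>s t. 0 \<le> s \<Longrightarrow> s \<le> t \<Longrightarrow> t \<le> 1 \<Longrightarrow> d (geod a b s) (geod a b t) = (t - s) * d a b"
    and "\<And>t. 0 \<le> t \<Longrightarrow> t \<le> 1 \<Longrightarrow> between t a b (geod a b t)"
proof -
  define L where "L = d a b"
  obtain g where g: "g 0 = a" "g L = b" "S = g ` {0..L}" "S \<subseteq> M"
      "\<And>s t. s \<in> {0..L} \<Longrightarrow> t \<in> {0..L} \<Longrightarrow> d (g s) (g t) = \<bar>s - t\<bar>"
    using S unfolding geodesic_segment_def L_def by auto
  have L: "0 \<le> L" by (simp add: L_def)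
  have tL: "t * L \<in> {0..L}" if "0 \<le> t" "t \<le> 1" for t
    using that L by (simp add: mult_left_le_one_le)
  have "between t a b (g (t * L))" if "0 \<le> t" "t \<le> 1" for t
    using g(1,2,4) g(3) g(5)[of 0 "t * L"] g(5)[of "t * L" L] tL[OF that] L
    unfolding between_def L_def[symmetric] by (auto simp: algebra_simps)
  then have b: "between t a b (geod a b t)" and "between t a b (g (t * L))" if "0 \<le> t" "t \<le> 1" for t
    using that unfolding geod_def by (metis someI_ex)+
  then show "between t a b (geod a b t)" if "0 \<le> t" "t \<le> 1" for t using that by blast
  have pg: "geod a b t = g (t * L)" if "0 \<le> t" "t \<le> 1" for t
    using between_unique assms that b \<open>\<And>t. \<lbrakk>0 \<le> t; t \<le> 1\<rbrakk> \<Longrightarrow> between t a b (g (t * L))\<close> by blast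
  show "d (geod a b s) (geod a b t) = (t - s) * d a b" if "0 \<le> s" "s \<le> t" "t \<le> 1" for s t
  proof -
    have "s * L \<le> t * L" using that L by (simp add: mult_right_mono)
    then show ?thesis
      using that pg[of s] pg[of t] tL[of s] tL[of t] g(5)[of "s * L" "t * L"]
      by (simp add: L_def[symmetric] algebra_simps)
  qed
  have "{0..L} = (\<lambda>t. t * L) ` {0..1}"
  proof (cases "L = 0")
    case False
    then have "s = (s / L) * L \<and> s / L \<in> {0..1}" if "s \<in> {0..L}" for s using that L by auto
    then have "{0..L} \<subseteq> (\<lambda>t. t * L) ` {0..1}" by blast
    moreover have "(\<lambda>t. t * L) ` {0..1} \<subseteq> {0..L}" using tL by (intro image_subsetI) simp
    ultimately show ?thesis by (rule equalityI)
  qed (auto simp: image_constant_conv)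
  then have "S = (\<lambda>t. g (t * L)) ` {0..1}" using g(3) by (simp add: image_image)
  also have "\<dots> = geod a b ` {0..1}" using pg by (intro image_cong) auto
  finally show "S = geod a b ` {0..1}" .
qed

lemma
  assumes "a \<in> M" "b \<in> M"
  shows geod_between: "0 \<le> t \<Longrightarrow> t \<le> 1 \<Longrightarrow> between t a b (geod a b t)"
    and geod_dist: "0 \<le> s \<Longrightarrow> s \<le> t \<Longrightarrow> t \<le> 1 \<Longrightarrow> d (geod a b s) (geod a b t) = (t - s) * d a b"
  proof -
  obtain S where S: "geodesic_segment M d a b S" by (rule segment_exists[OF assms])
  show "0 \<le> t \<Longrightarrow> t \<le> 1 \<Longrightarrow> between t a b (geod a b t)"
    and "0 \<le> s \<Longrightarrow> s \<le> t \<Longrightarrow> t \<le> 1 \<Longrightarrow> d (geod a b s) (geod a b t) = (t - s) * d a b"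
    using segment_param(2,3)[OF S assms] by auto
qed

lemma geod_eq:
  assumes "a \<in> M" "b \<in> M" "0 \<le> t" "t \<le> 1" "between t a b m"
  shows "geod a b t = m"
  using between_unique geod_between assms by blast

lemma geod_in: "a \<in> M \<Longrightarrow> b \<in> M \<Longrightarrow> 0 \<le> t \<Longrightarrow> t \<le> 1 \<Longrightarrow> geod a b t \<in> M"
  using geod_between between_in by blast

lemma geodesically_convex_iff:
  "geodesically_convex M d W \<longleftrightarrow> W \<subseteq> M \<and> (\<forall>a\<in>W. \<forall>b\<in>W. \<forall>t\<in>{0..1}. geod a b t \<in> W)"
proof
  assume *: "geodesically_convex M d W"
  then have WM: "W \<subseteq> M" by (simp add: geodesically_convex_def)
  have "geod a b t \<in> W" if abt: "a \<in> W" "b \<in> W" "t \<in> {0..1}" for a b t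
  proof (cases "a = b")
    case True
    then have "geod a b t = a" using that WM by (intro geod_eq) (auto simp: between_def)
    then show ?thesis using that by simp
  next
    case False
    obtain S where S: "geodesic_segment M d a b S" using segment_exists[of a b] abt WM by auto
    then have "S \<subseteq> W" using * that False by (auto simp: geodesically_convex_def)
    moreover have "S = geod a b ` {0..1}" using segment_param(1)[OF S] abt WM by auto
    ultimately show ?thesis using abt by auto
  qed
  then show "W \<subseteq> M \<and> (\<forall>a\<in>W. \<forall>b\<in>W. \<forall>t\<in>{0..1}. geod a b t \<in> W)" using WM by blast
next
  assume *: "W \<subseteq> M \<and> (\<forall>a\<in>W. \<forall>b\<in>W. \<forall>t\<in>{0..1}. geod a b t \<in> W)"
  then show "geodesically_convex M d W"
    unfolding geodesically_convex_def
  proof (intro conjI ballI impI allI)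
    fix a b S assume ab: "a \<in> W" "b \<in> W" and S: "geodesic_segment M d a b S"
    have "S = geod a b ` {0..1}" using segment_param(1)[OF S] ab * by auto
    then show "S \<subseteq> W" using * ab by auto
  qed simp
qed

text \<open>Stewart's inequality for the triangle \<open>a b c\<close>, first with respect to the side \<open>a b\<close> and then to
  the side \<open>a c\<close>; the two errors add up to the square of the right-hand side.\<close>

lemma fan_contraction:
  assumes M: "a \<in> M" "b \<in> M" "c \<in> M" and t: "0 \<le> t" "t \<le> 1"
  shows "d (geod a b t) (geod a c t) \<le> t * d b c"
proof -
  let ?m = "geod a b t" and ?n = "geod a c t"
  have m: "between t a b ?m" and n: "between t a c ?n" using M t geod_between by auto
  have an: "d a ?n = t * d a c" using n by (simp add: between_def)
  have "(d ?m ?n)\<^sup>2 \<le> (1 - t) * (d a ?n)\<^sup>2 + t * (d b ?n)\<^sup>2 - t * (1 - t) * (d a b)\<^sup>2"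
    using stewart[OF M(1,2) between_in[OF n] t m] .
  moreover have "t * (d b ?n)\<^sup>2 \<le> t * ((1 - t) * (d a b)\<^sup>2 + t * (d b c)\<^sup>2 - t * (1 - t) * (d a c)\<^sup>2)"
    using stewart[OF M(1,3,2) t n] t unfolding commute[of ?n b] commute[of c b]
    by (intro mult_left_mono) auto
  moreover have "(1 - t) * (t * d a c)\<^sup>2 + t * ((1 - t) * (d a b)\<^sup>2 + t * (d b c)\<^sup>2 - t * (1 - t) * (d a c)\<^sup>2)
      - t * (1 - t) * (d a b)\<^sup>2 = (t * d b c)\<^sup>2"
    by (simp add: power2_eq_square algebra_simps)
  ultimately have "(d ?m ?n)\<^sup>2 \<le> (t * d b c)\<^sup>2"
    unfolding an by linarith
  then show ?thesis by (rule power2_le_imp_le) (use t in simp)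
qed

text \<open>Pass through the midpoint of the diagonal from \<open>p\<close> to \<open>q'\<close>.\<close>

lemma midpoint_contraction:
  assumes M: "p \<in> M" "q \<in> M" "p' \<in> M" "q' \<in> M"
  shows "d (geod p q (1/2)) (geod p' q' (1/2)) \<le> (d p p' + d q q') / 2"
proof -
  have sym: "geod a b (1/2) = geod b a (1/2)" if "a \<in> M" "b \<in> M" for a b
  proof (rule geod_eq[OF that])
    show "between (1/2) a b (geod b a (1/2))"
      using geod_between[OF that(2,1), of "1/2"] commute unfolding between_def by simp
  qed auto
  have "d (geod p q (1/2)) (geod p' q' (1/2)) \<le> d (geod p q (1/2)) (geod p q' (1/2)) + d (geod p q' (1/2)) (geod p' q' (1/2))"
    using M by (intro triangle geod_in) auto
  also have "d (geod p q (1/2)) (geod p q' (1/2)) \<le> 1/2 * d q q'" using M by (intro fan_contraction) auto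
  also have "d (geod p q' (1/2)) (geod p' q' (1/2)) \<le> 1/2 * d p p'"
    unfolding sym[OF M(1,4)] sym[OF M(3,4)] using M by (intro fan_contraction) auto
  finally show ?thesis by simp
qed

text \<open>Advance in steps of length \<open>h\<close> with \<open>2 h < \<delta>\<close>. If \<open>y\<close> is the midpoint of the local geodesic
  from \<open>x\<close> to \<open>z\<close> and the distances of \<open>x\<close> and \<open>y\<close> from the start are \<open>r\<close> and \<open>r + h\<close>, Stewart's
  inequality for \<open>y\<close> bounds the distance of \<open>z\<close> from the start below by \<open>r + 2 h\<close>.\<close>

lemma local_geodesic_is_geodesic:
  fixes c :: "real \<Rightarrow> 'a"
  assumes cM: "\<And>s. 0 \<le> s \<Longrightarrow> s \<le> L \<Longrightarrow> c s \<in> M" and "0 < \<delta>" and L: "0 \<le> L"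
    and loc: "\<And>s t. 0 \<le> s \<Longrightarrow> s \<le> t \<Longrightarrow> t \<le> L \<Longrightarrow> t - s < \<delta> \<Longrightarrow> d (c s) (c t) = t - s"
  shows "d (c 0) (c L) = L"
proof (cases "L = 0")
  case True then show ?thesis using cM[of 0] by simp
next
  case False
  then have L: "0 < L" using L by simp
  obtain N :: nat where N: "0 < N" "2 * L / \<delta> < real N"
  proof -
    obtain N :: nat where "2 * L / \<delta> < real N" using reals_Archimedean2 by blast
    then have "2 * L / \<delta> < real (Suc N)" by simp
    then show thesis using that[of "Suc N"] by blast
  qed
  define h where "h = L / real N"
  have h: "0 < h" "2 * h < \<delta>" "real N * h = L"
    using N L \<open>0 < \<delta>\<close> by (auto simp: h_def field_simps)
  have kh: "real k * h \<le> L" if "k \<le> N" for k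
    using mult_right_mono[of "real k" "real N" h] that h by simp
  have "(Suc k \<le> N \<longrightarrow> d (c 0) (c (real (Suc k) * h)) = real (Suc k) * h) \<and> (k \<le> N \<longrightarrow> d (c 0) (c (real k * h)) = real k * h)" for k
  proof (induction k)
    case 0
    show ?case using kh[of 1] h cM[of 0] L loc[of 0 h] by auto
  next
    case (Suc k)
    have "d (c 0) (c (real (Suc (Suc k)) * h)) = real (Suc (Suc k)) * h" if k: "Suc (Suc k) \<le> N"
    proof -
      let ?r = "real k * h"
      let ?x = "c ?r" and ?y = "c (?r + h)" and ?z = "c (?r + 2 * h)"
      have "real (Suc (Suc k)) * h = ?r + 2 * h" by (simp add: algebra_simps)
      then have r: "0 \<le> ?r" "?r + 2 * h \<le> L" using kh[OF k] h(1) by auto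
      have r0: "0 \<le> ?r + h" "?r + h \<le> L" "0 \<le> ?r + 2 * h" "?r \<le> L" using r h(1) by linarith+
      have M: "?x \<in> M" "?y \<in> M" "?z \<in> M" "c 0 \<in> M"
        using cM[OF r(1) r0(4)] cM[OF r0(1,2)] cM[OF r0(3) r(2)] cM[of 0] L by auto
      have xy: "d ?x ?y = h" and yz: "d ?y ?z = h" and xz: "d ?x ?z = 2 * h"
        using loc[OF r(1), of "?r + h"] loc[OF r(1), of "?r + 2 * h"] loc[OF r0(1), of "?r + 2 * h"]
          r r0 h(1,2) by auto
      have "between (1/2) ?x ?z ?y" unfolding between_def xy yz xz using M by simp
      from stewart[OF M(1,3,4) _ _ this]
      have *: "(d ?y (c 0))\<^sup>2 \<le> (d ?x (c 0))\<^sup>2 / 2 + (d ?z (c 0))\<^sup>2 / 2 - (2 * h)\<^sup>2 / 4"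
        unfolding xz by simp
      have "real (Suc k) * h = ?r + h" by (simp add: algebra_simps)
      then have y0: "d ?y (c 0) = ?r + h" and x0: "d ?x (c 0) = ?r"
        using Suc k commute[of "c 0"] by auto
      have "(?r + 2 * h)\<^sup>2 \<le> (d ?z (c 0))\<^sup>2"
        using * unfolding y0 x0 by (simp add: power2_eq_square algebra_simps)
      then have 1: "?r + 2 * h \<le> d ?z (c 0)" by (rule power2_le_imp_le) simp
      have "d (c 0) ?z \<le> d (c 0) ?x + d ?x ?z" using M by (intro triangle)
      then have "d (c 0) ?z \<le> ?r + 2 * h"
        using x0 xz commute[of "c 0" ?x] by simp
      then show ?thesis using 1 commute[of "c 0" ?z] \<open>real (Suc (Suc k)) * h = ?r + 2 * h\<close> by simp
    qed
    then show ?case using Suc by blast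
  qed
  from this[of N] show ?thesis using h by simp
qed

end

section \<open>Locally convex sets in CAT(0) spaces\<close>

text \<open>At the smallest point where a positive maximum is attained, the value to the left is strictly
  smaller and the value to the right is not larger, which contradicts midpoint convexity.\<close>

lemma midpoint_convex_vanishes:
  fixes f :: "real \<Rightarrow> real"
  assumes cont: "continuous_on {0..1} f" and ends: "f 0 = 0" "f 1 = 0"
    and conv: "\<And>s. 0 < s \<Longrightarrow> s < 1 \<Longrightarrow> 0 < f s \<Longrightarrow>
      \<exists>h>0. h \<le> s \<and> s + h \<le> 1 \<and> f s \<le> (f (s - h) + f (s + h)) / 2"
    and s: "0 \<le> s" "s \<le> 1"
  shows "f s \<le> 0"
proof -
  obtain m where m: "m \<in> {0..1}" "\<And>x. x \<in> {0..1} \<Longrightarrow> f x \<le> f m"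
    using continuous_attains_sup[OF _ _ cont] by (metis atLeastAtMost_iff compact_Icc empty_iff le_numeral_extra(3) zero_le_one)
  let ?S = "{x \<in> {0..1}. f x = f m}"
  have "closed ?S" by (rule continuous_closed_preimage_constant[OF cont]) simp
  moreover have "bounded ?S" by (rule bounded_subset[of "{0..1}"]) auto
  ultimately have "compact ?S" by (simp add: compact_eq_bounded_closed)
  moreover have "?S \<noteq> {}" using m(1) by auto
  ultimately obtain u where u: "u \<in> ?S" "\<And>x. x \<in> ?S \<Longrightarrow> u \<le> x"
    using compact_attains_inf[of ?S] by auto
  have "f m \<le> 0"
  proof (rule ccontr)
    assume "\<not> f m \<le> 0"
    then have fu: "0 < f u" using u(1) by simp
    then have "u \<noteq> 0" "u \<noteq> 1" using ends by auto
    then have "0 < u" "u < 1" using u(1) by auto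
    then obtain h where h: "h > 0" "h \<le> u" "u + h \<le> 1" "f u \<le> (f (u - h) + f (u + h)) / 2"
      using conv fu by blast
    have "u - h \<notin> ?S" using u(2)[of "u - h"] h(1) by auto
    then have "f (u - h) < f m" using m(2)[of "u - h"] h u(1) by auto
    moreover have "f (u + h) \<le> f m" using m(2)[of "u + h"] h u(1) by auto
    ultimately show False using h(4) u(1) by auto
  qed
  then show ?thesis using m(2)[of s] s by auto
qed

text \<open>The sets where \<open>P\<close> holds and where it fails are both open in \<open>W\<close>.\<close>

lemma (in Metric_space) connectedin_induct:
  assumes conn: "connectedin mtopology W" and a: "a \<in> W" "P a"
    and loc: "\<And>w. w \<in> W \<Longrightarrow> \<exists>r>0. \<forall>w'\<in>W. d w w' < r \<longrightarrow> P w' = P w"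
    and w: "w \<in> W"
  shows "P w"
proof (rule ccontr)
  assume nP: "\<not> P w"
  have WM: "W \<subseteq> M" using connectedin_subset_topspace[OF conn] by simp
  obtain r where r: "\<And>w. w \<in> W \<Longrightarrow> 0 < r w" "\<And>w w'. w \<in> W \<Longrightarrow> w' \<in> W \<Longrightarrow> d w w' < r w \<Longrightarrow> P w' = P w"
    using loc by metis
  let ?U = "\<lambda>Q. \<Union>w\<in>{w \<in> W. Q w}. mball w (r w)"
  have op: "openin mtopology (?U Q)" for Q by (rule openin_Union) auto
  have mem: "x \<in> ?U Q \<Longrightarrow> x \<in> W \<Longrightarrow> \<exists>w\<in>W. Q w \<and> P x = P w" for x Q
    using r(2) by (auto simp: mball_def)
  have inU: "x \<in> ?U Q" if "x \<in> W" "Q x" for x Q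
    using that r(1)[of x] WM by (intro UN_I[of x]) auto
  show False
  proof (rule connectedinD[OF conn op[of P] op[of "\<lambda>w. \<not> P w"]])
    show "W \<subseteq> ?U P \<union> ?U (\<lambda>w. \<not> P w)" using inU[of _ P] inU[of _ "\<lambda>w. \<not> P w"] by blast
    show "?U P \<inter> ?U (\<lambda>w. \<not> P w) \<inter> W = {}" using mem[of _ P] mem[of _ "\<lambda>w. \<not> P w"] by blast
    show "?U P \<inter> W \<noteq> {}" using inU[of a P] a by blast
    show "?U (\<lambda>w. \<not> P w) \<inter> W \<noteq> {}" using inU[of w "\<lambda>w. \<not> P w"] w nP by blast
  qed
qed

lemma divide_cancel: "x \<noteq> 0 \<Longrightarrow> c / x * x = (c::real)"
  by simp

context CAT0
begin

definition dist_to_set :: "'a set \<Rightarrow> 'a \<Rightarrow> real" where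
  "dist_to_set W x = (INF w\<in>W. d x w)"

lemma dist_to_set_le: "w \<in> W \<Longrightarrow> dist_to_set W x \<le> d x w"
  unfolding dist_to_set_def by (rule cINF_lower) (auto intro!: bdd_belowI[of _ 0])

lemma dist_to_set_less:
  assumes "W \<noteq> {}" "dist_to_set W x < r"
  obtains w where "w \<in> W" "d x w < r"
proof -
  have "bdd_below (d x ` W)" by (auto intro!: bdd_belowI[of _ 0])
  then show thesis using assms that cINF_less_iff[of W "d x" r] unfolding dist_to_set_def by blast
qed

lemma dist_to_set_nonneg: "W \<noteq> {} \<Longrightarrow> 0 \<le> dist_to_set W x"
  unfolding dist_to_set_def by (rule cINF_greatest) auto

lemma dist_to_set_lipschitz:
  assumes "W \<noteq> {}" "W \<subseteq> M" "x \<in> M" "y \<in> M"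
  shows "\<bar>dist_to_set W x - dist_to_set W y\<bar> \<le> d x y"
proof -
  have *: "dist_to_set W u \<le> d u v + dist_to_set W v" if "u \<in> M" "v \<in> M" for u v
  proof -
    have "dist_to_set W u - d u v \<le> dist_to_set W v"
      unfolding dist_to_set_def[of W v]
    proof (rule cINF_greatest[OF assms(1)])
      fix w assume w: "w \<in> W"
      then have "d u w \<le> d u v + d v w" using triangle that assms(2) by blast
      then show "dist_to_set W u - d u v \<le> d v w" using dist_to_set_le[OF w, of u] by linarith
    qed
    then show ?thesis by linarith
  qed
  show ?thesis using *[OF assms(3,4)] *[OF assms(4,3)] commute[of x y] by linarith
qed

definition convex_near :: "'a set \<Rightarrow> 'a \<Rightarrow> real \<Rightarrow> bool" where
  "convex_near W z \<epsilon> \<longleftrightarrow> (\<forall>p\<in>W. \<forall>q\<in>W. d z p < \<epsilon> \<longrightarrow> d z q < \<epsilon> \<longrightarrow> geod p q (1/2) \<in> W)"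

text \<open>A Lebesgue number for the geodesic from \<open>a\<close> to \<open>w\<close>, obtained by bisection.\<close>

lemma convex_near_uniform:
  assumes WM: "W \<subseteq> M" and loc: "\<And>z. z \<in> W \<Longrightarrow> \<exists>\<epsilon>>0. convex_near W z \<epsilon>"
    and M: "a \<in> M" "w \<in> M" and in_W: "\<And>t. 0 \<le> t \<Longrightarrow> t \<le> 1 \<Longrightarrow> geod a w t \<in> W"
  obtains \<epsilon> where "0 < \<epsilon>" "\<And>t. 0 \<le> t \<Longrightarrow> t \<le> 1 \<Longrightarrow> convex_near W (geod a w t) \<epsilon>"
proof -
  define Q where "Q s t \<longleftrightarrow> (\<exists>\<epsilon>>0. \<forall>\<tau>\<in>{s..t} \<inter> {0..1}. convex_near W (geod a w \<tau>) \<epsilon>)" for s t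
  have mono: "convex_near W z \<epsilon>'" if "convex_near W z \<epsilon>" "\<epsilon>' \<le> \<epsilon>" for z \<epsilon> \<epsilon>'
    using that by (force simp: convex_near_def)
  have "Q 0 1"
  proof (rule Bolzano[of 0 1 Q])
    fix r s t assume "Q r s" "Q s t" "r \<le> s" "s \<le> t"
    then obtain e1 e2 where e: "e1 > 0" "\<forall>\<tau>\<in>{r..s} \<inter> {0..1}. convex_near W (geod a w \<tau>) e1"
      "e2 > 0" "\<forall>\<tau>\<in>{s..t} \<inter> {0..1}. convex_near W (geod a w \<tau>) e2" by (auto simp: Q_def)
    have "convex_near W (geod a w \<tau>) (min e1 e2)" if \<tau>: "\<tau> \<in> {r..t} \<inter> {0..1}" for \<tau>
    proof (cases "\<tau> \<le> s")
      case True
      then have "convex_near W (geod a w \<tau>) e1" using e(2) \<tau> by auto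
      then show ?thesis by (rule mono) simp
    next
      case False
      then have "convex_near W (geod a w \<tau>) e2" using e(4) \<tau> by auto
      then show ?thesis by (rule mono) simp
    qed
    then show "Q r t" unfolding Q_def using e(1,3) by (intro exI[of _ "min e1 e2"]) auto
  next
    fix x :: real assume x: "0 \<le> x" "x \<le> 1"
    obtain \<epsilon> where \<epsilon>: "\<epsilon> > 0" "convex_near W (geod a w x) \<epsilon>" using loc in_W x by blast
    have D: "0 < 1 + d a w" using nonneg[of a w] by linarith
    define \<delta> where "\<delta> = \<epsilon> / 2 / (1 + d a w)"
    have \<delta>: "0 < \<delta>" using \<epsilon> D by (simp add: \<delta>_def)
    have "Q s t" if st: "s \<le> x" "x \<le> t" "t - s < \<delta>" for s t
      unfolding Q_def
    proof (intro exI[of _ "\<epsilon>/2"] conjI ballI)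
      fix \<tau> assume \<tau>: "\<tau> \<in> {s..t} \<inter> {0..1}"
      have "d (geod a w x) (geod a w \<tau>) = \<bar>x - \<tau>\<bar> * d a w"
        using geod_dist[OF M, of x \<tau>] geod_dist[OF M, of \<tau> x] x \<tau> commute[of "geod a w x" "geod a w \<tau>"]
        by (cases "x \<le> \<tau>") auto
      also have "\<dots> \<le> \<delta> * (1 + d a w)" using \<tau> st \<delta> by (intro mult_mono) auto
      also have "\<dots> = \<epsilon> / 2" using D unfolding \<delta>_def using D by (intro divide_cancel) simp
      finally have near: "d (geod a w x) (geod a w \<tau>) \<le> \<epsilon> / 2" .
      have "d (geod a w x) p < \<epsilon>" if "p \<in> W" "d (geod a w \<tau>) p < \<epsilon> / 2" for p
        using that near triangle[of "geod a w x" "geod a w \<tau>" p] in_W[of x] in_W[of \<tau>] x \<tau> WM by fastforce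
      then show "convex_near W (geod a w \<tau>) (\<epsilon> / 2)" using \<epsilon>(2) by (simp add: convex_near_def)
    qed (use \<epsilon> in simp)
    then show "\<exists>\<delta>>0. \<forall>s t. s \<le> x \<and> x \<le> t \<and> t - s < \<delta> \<longrightarrow> Q s t" using \<delta> by blast
  qed simp
  then show thesis using that by (auto simp: Q_def)
qed

text \<open>Let \<open>f s\<close> be the distance to \<open>W\<close> from the point at parameter \<open>s\<close> of the geodesic from \<open>a\<close> to
  \<open>w'\<close>. It vanishes at both ends, since these are in \<open>W\<close>. The geodesic stays close to the one from
  \<open>a\<close> to \<open>w\<close>, so points of \<open>W\<close> that almost realise \<open>f (s - h)\<close> and \<open>f (s + h)\<close> have their
  midpoint in \<open>W\<close>; this makes \<open>f\<close> midpoint convex.\<close>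

lemma geodesic_into_locally_convex:
  assumes WM: "W \<subseteq> M" and closed: "\<And>x. x \<in> M \<Longrightarrow> dist_to_set W x = 0 \<Longrightarrow> x \<in> W"
    and aw: "a \<in> M" "w \<in> M" "a \<in> W" and \<epsilon>: "0 < \<epsilon>"
    and in_W: "\<And>t. 0 \<le> t \<Longrightarrow> t \<le> 1 \<Longrightarrow> geod a w t \<in> W"
    and conv: "\<And>t. 0 \<le> t \<Longrightarrow> t \<le> 1 \<Longrightarrow> convex_near W (geod a w t) \<epsilon>"
    and w': "w' \<in> W" "d w w' < \<epsilon> / 8" and t: "0 \<le> t" "t \<le> 1"
  shows "geod a w' t \<in> W"
proof -
  have w'M: "w' \<in> M" using w' WM by blast
  have ne: "W \<noteq> {}" using aw by blast
  define x where "x s = geod a w' s" for s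
  define L where "L = d a w'"
  have L: "0 \<le> L" by (simp add: L_def)
  have xM: "x s \<in> M" if "0 \<le> s" "s \<le> 1" for s unfolding x_def using geod_in aw w'M that by blast
  have xd: "d (x s) (x u) = \<bar>s - u\<bar> * L" if "0 \<le> s" "s \<le> 1" "0 \<le> u" "u \<le> 1" for s u
    using geod_dist[OF aw(1) w'M, of s u] geod_dist[OF aw(1) w'M, of u s] that commute[of "x s" "x u"]
    unfolding x_def L_def by (cases "s \<le> u") auto
  define f where "f s = dist_to_set W (x s)" for s
  have W0: "dist_to_set W p = 0" if "p \<in> W" for p
    using dist_to_set_le[OF that, of p] dist_to_set_nonneg[OF ne, of p] that WM by (metis antisym subsetD zero)
  have "f t \<le> 0"
  proof (rule midpoint_convex_vanishes[OF _ _ _ _ t])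
    show "f 0 = 0" using W0[OF aw(3)] aw w'M geod_eq[of a w' 0 a] by (simp add: f_def x_def)
    show "f 1 = 0" using W0[OF w'(1)] aw w'M geod_eq[of a w' 1 w'] by (simp add: f_def x_def)
    show "continuous_on {0..1} f"
      unfolding continuous_on_iff
    proof (intro ballI allI impI)
      fix s e :: real assume s: "s \<in> {0..1}" and e: "0 < e"
      have "dist (f u) (f s) < e" if u: "u \<in> {0..1}" "dist u s < e / (1 + L)" for u
      proof -
        have "dist (f u) (f s) \<le> \<bar>u - s\<bar> * L"
          using dist_to_set_lipschitz[OF ne WM xM xM, of u s] xd[of u s] s u by (simp add: f_def dist_real_def)
        also have "\<dots> \<le> \<bar>u - s\<bar> * (1 + L)" using L by (intro mult_left_mono) auto
        also have "\<dots> < e" using u(2) L by (simp add: dist_real_def pos_less_divide_eq)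
        finally show ?thesis .
      qed
      then show "\<exists>\<delta>>0. \<forall>u\<in>{0..1}. dist u s < \<delta> \<longrightarrow> dist (f u) (f s) < e"
        using e L by (intro exI[of _ "e / (1 + L)"]) auto
    qed
    fix s :: real assume s: "0 < s" "s < 1"
    \<comment> \<open>The \<open>1\<close> in the denominator covers the constant geodesic, of length \<open>L = 0\<close>.\<close>
    define h where "h = min (min s (1 - s)) (\<epsilon> / 16 / (1 + L))"
    have h: "0 < h" "h \<le> s" "s + h \<le> 1" "h \<le> \<epsilon> / 16 / (1 + L)" using s \<epsilon> L by (auto simp: h_def)
    have "h * (1 + L) \<le> \<epsilon> / 16 / (1 + L) * (1 + L)" using h(4) L by (intro mult_right_mono) auto
    also have "\<dots> = \<epsilon> / 16" using L by (intro divide_cancel) simp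
    finally have "h * (1 + L) \<le> \<epsilon> / 16" .
    moreover have "h * L \<le> h * (1 + L)" using h(1) by (simp add: algebra_simps)
    ultimately have hL: "h * L < \<epsilon> / 8" using \<epsilon> by linarith
    let ?z = "geod a w s" and ?p = "x (s - h)" and ?q = "x (s + h)"
    have M: "?z \<in> M" "?p \<in> M" "?q \<in> M" "x s \<in> M" using xM geod_in[OF aw(1,2)] h s by auto
    have zW: "?z \<in> W" using in_W s by simp
    have "d ?z (x s) \<le> s * d w w'" unfolding x_def using fan_contraction aw w'M s by simp
    also have "\<dots> \<le> 1 * d w w'" using s by (intro mult_right_mono) auto
    finally have zx: "d ?z (x s) < \<epsilon> / 8" using w' by simp
    have px: "d (x s) ?p = h * L" and qx: "d (x s) ?q = h * L" and pq: "d ?p ?q = 2 * (h * L)"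
      using xd[of s "s - h"] xd[of s "s + h"] xd[of "s - h" "s + h"] h s by auto
    have zp: "d ?z ?p < \<epsilon> / 4" and zq: "d ?z ?q < \<epsilon> / 4"
      using triangle[OF M(1,4,2)] triangle[OF M(1,4,3)] zx px qx hL by linarith+
    have mid: "geod ?p ?q (1/2) = x s"
      using M px qx pq commute[of ?p "x s"] by (intro geod_eq) (auto simp: between_def)
    have "f s \<le> (f (s - h) + f (s + h)) / 2"
    proof (rule ccontr)
      assume "\<not> ?thesis"
      then have gap: "0 < f s - (f (s - h) + f (s + h)) / 2" by simp
      define \<eta> where "\<eta> = min (\<epsilon> / 4) (f s - (f (s - h) + f (s + h)) / 2)"
      have \<eta>: "0 < \<eta>" "\<eta> \<le> \<epsilon> / 4" "\<eta> \<le> f s - (f (s - h) + f (s + h)) / 2"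
        using gap \<epsilon> unfolding \<eta>_def by (simp_all only: min_less_iff_conj min.cobounded1 min.cobounded2) simp
      obtain p' where p': "p' \<in> W" "d ?p p' < f (s - h) + \<eta>"
        using dist_to_set_less[OF ne, of ?p "f (s - h) + \<eta>"] \<eta> by (auto simp: f_def)
      obtain q' where q': "q' \<in> W" "d ?q q' < f (s + h) + \<eta>"
        using dist_to_set_less[OF ne, of ?q "f (s + h) + \<eta>"] \<eta> by (auto simp: f_def)
      have "f (s - h) \<le> d ?p ?z" "f (s + h) \<le> d ?q ?z" using dist_to_set_le[OF zW] by (auto simp: f_def)
      then have "d ?p p' < \<epsilon> / 2" "d ?q q' < \<epsilon> / 2"
        using p' q' \<eta> zp zq commute[of ?z ?p] commute[of ?z ?q] by linarith+
      moreover have M': "p' \<in> M" "q' \<in> M" using p' q' WM by auto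
      ultimately have "d ?z p' < \<epsilon>" "d ?z q' < \<epsilon>"
        using triangle[OF M(1,2) M'(1)] triangle[OF M(1,3) M'(2)] zp zq \<epsilon> by linarith+
      then have "geod p' q' (1/2) \<in> W" using conv[of s] s p' q' by (simp add: convex_near_def)
      then have "f s \<le> d (x s) (geod p' q' (1/2))" unfolding f_def by (rule dist_to_set_le)
      also have "\<dots> \<le> (d ?p p' + d ?q q') / 2"
        using midpoint_contraction[OF M(2,3) M'] unfolding mid .
      finally show False using p'(2) q'(2) \<eta>(3) by argo
    qed
    then show "\<exists>h>0. h \<le> s \<and> s + h \<le> 1 \<and> f s \<le> (f (s - h) + f (s + h)) / 2" using h by blast
  qed
  then have "dist_to_set W (x t) = 0" using dist_to_set_nonneg[OF ne, of "x t"] by (simp add: f_def)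
  then have "x t \<in> W" using closed[OF xM[OF t]] by simp
  then show ?thesis by (simp add: x_def)
qed

text \<open>The points of \<open>W\<close> that a geodesic inside \<open>W\<close> joins to \<open>a\<close> form an open subset of \<open>W\<close> by
  \<open>geodesic_into_locally_convex\<close>, and a closed one because geodesics from \<open>a\<close> depend continuously on
  their end.\<close>

theorem locally_convex_imp_convex:
  assumes conn: "connectedin mtopology W"
    and closed: "\<And>x. x \<in> M \<Longrightarrow> x \<notin> W \<Longrightarrow> \<exists>r>0. \<forall>w\<in>W. r \<le> d x w"
    and loc: "\<And>z. z \<in> W \<Longrightarrow> \<exists>\<epsilon>>0. convex_near W z \<epsilon>"
  shows "geodesically_convex M d W"
proof -
  have WM: "W \<subseteq> M" using connectedin_subset_topspace[OF conn] by simp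
  have "\<forall>t\<in>{0..1}. geod a b t \<in> W" if ab: "a \<in> W" "b \<in> W" for a b
  proof (rule connectedin_induct[OF conn ab(1) _ _ ab(2), of "\<lambda>w. \<forall>t\<in>{0..1}. geod a w t \<in> W"])
    have aM: "a \<in> M" using ab WM by blast
    have ne: "W \<noteq> {}" using ab by blast
    have "geod a a t = a" if "0 \<le> t" "t \<le> 1" for t
      using that aM by (intro geod_eq) (auto simp: between_def)
    then show "\<forall>t\<in>{0..1}. geod a a t \<in> W" using ab by simp
    have cl: "x \<in> W" if x: "x \<in> M" "dist_to_set W x = 0" for x
    proof (rule ccontr)
      assume "x \<notin> W"
      then obtain r where r: "r > 0" "\<forall>w\<in>W. r \<le> d x w" using closed x(1) by blast
      obtain w where "w \<in> W" "d x w < r" using dist_to_set_less[OF ne, of x r] x r by auto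
      then show False using r by fastforce
    qed
    fix w assume w: "w \<in> W"
    then have wM: "w \<in> M" using WM by blast
    show "\<exists>r>0. \<forall>w'\<in>W. d w w' < r \<longrightarrow> (\<forall>t\<in>{0..1}. geod a w' t \<in> W) = (\<forall>t\<in>{0..1}. geod a w t \<in> W)"
    proof (cases "\<forall>t\<in>{0..1}. geod a w t \<in> W")
      case True
      then have in_W: "geod a w t \<in> W" if "0 \<le> t" "t \<le> 1" for t using that by simp
      obtain \<epsilon> where \<epsilon>: "0 < \<epsilon>" "\<And>t. 0 \<le> t \<Longrightarrow> t \<le> 1 \<Longrightarrow> convex_near W (geod a w t) \<epsilon>"
        using convex_near_uniform[OF WM loc aM wM in_W] by blast
      have "geod a w' t \<in> W" if "w' \<in> W" "d w w' < \<epsilon> / 8" "t \<in> {0..1}" for w' t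
        using geodesic_into_locally_convex[OF WM cl aM wM ab(1) \<epsilon>(1) in_W \<epsilon>(2) that(1,2)] that(3) by simp
      then show ?thesis using True \<epsilon>(1) by (intro exI[of _ "\<epsilon> / 8"]) auto
    next
      case False
      then obtain t where t: "0 \<le> t" "t \<le> 1" "geod a w t \<notin> W" by auto
      then obtain r where r: "r > 0" "\<forall>u\<in>W. r \<le> d (geod a w t) u" using closed geod_in[OF aM wM] by blast
      have "geod a w' t \<notin> W" if w': "w' \<in> W" "d w w' < r" for w'
      proof
        assume "geod a w' t \<in> W"
        then have "r \<le> d (geod a w t) (geod a w' t)" using r by blast
        also have "\<dots> \<le> t * d w w'" using fan_contraction aM wM w' WM t by blast
        also have "\<dots> \<le> 1 * d w w'" using t by (intro mult_right_mono) auto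
        finally show False using w' by simp
      qed
      then have "(\<forall>t\<in>{0..1}. geod a w' t \<in> W) = (\<forall>t\<in>{0..1}. geod a w t \<in> W)" if "w' \<in> W" "d w w' < r" for w'
        using that False t(1,2) by fastforce
      then show ?thesis using r(1) by blast
    qed
  qed
  then show ?thesis using geodesically_convex_iff WM by blast
qed

end

section \<open>Euclidean cubes and their faces\<close>

definition lerp :: "real \<Rightarrow> point \<Rightarrow> point \<Rightarrow> point" where
  "lerp t x y = (\<lambda>i. (1 - t) * x i + t * y i)"

lemma euclid_dist_sq: "(euclid_dist n x y)\<^sup>2 = (\<Sum>i<n. (x i - y i)\<^sup>2)"
  by (simp add: euclid_dist_def L2_set_def sum_nonneg)

lemma euclid_dist_nonneg [simp]: "0 \<le> euclid_dist n x y"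
  by (simp add: euclid_dist_def)

lemma euclid_dist_commute: "euclid_dist n x y = euclid_dist n y x"
  by (simp add: euclid_dist_def L2_set_def power2_commute)

lemma euclid_dist_triangle: "euclid_dist n x z \<le> euclid_dist n x y + euclid_dist n y z"
  using L2_set_triangle_ineq[of "\<lambda>i. x i - y i" "\<lambda>i. y i - z i" "{..<n}"]
  by (simp add: euclid_dist_def)

lemma coord_le_euclid_dist: "i < n \<Longrightarrow> \<bar>x i - y i\<bar> \<le> euclid_dist n x y"
  using member_le_L2_set[of "{..<n}" i "\<lambda>i. \<bar>x i - y i\<bar>"]
  by (simp add: euclid_dist_def L2_set_def)

lemma euclid_dist_self [simp]: "euclid_dist n x x = 0"
  by (simp add: euclid_dist_def L2_set_def)

lemma unit_cube_eqI:
  assumes "x \<in> unit_cube n" "y \<in> unit_cube n" "\<And>i. i < n \<Longrightarrow> x i = y i"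
  shows "x = y"
proof
  fix i show "x i = y i" using assms by (cases "i < n") (auto simp: unit_cube_def)
qed

lemma unit_cube_coord: "x \<in> unit_cube n \<Longrightarrow> 0 \<le> x i \<and> x i \<le> 1"
  by (cases "i < n") (auto simp: unit_cube_def)

lemma euclid_dist_zero:
  assumes "x \<in> unit_cube n" "y \<in> unit_cube n"
  shows "euclid_dist n x y = 0 \<longleftrightarrow> x = y"
proof
  assume "euclid_dist n x y = 0"
  then have "x i = y i" if "i < n" for i using coord_le_euclid_dist[OF that, of x y] by simp
  then show "x = y" using unit_cube_eqI assms by blast
qed simp

lemma lerp_in_cube:
  assumes "x \<in> unit_cube n" "y \<in> unit_cube n" "0 \<le> t" "t \<le> 1"
  shows "lerp t x y \<in> unit_cube n"
proof -
  have "0 \<le> (1 - t) * x i + t * y i \<and> (1 - t) * x i + t * y i \<le> 1" if "i < n" for i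
    using assms unit_cube_coord[OF assms(1), of i] unit_cube_coord[OF assms(2), of i]
      convex_bound_le[of "x i" 1 "y i" "1 - t" t] by (auto simp: add_nonneg_nonneg)
  then show ?thesis using assms by (auto simp: unit_cube_def lerp_def)
qed

lemma euclid_dist_lerp: "euclid_dist n (lerp s x y) (lerp t x y) = \<bar>s - t\<bar> * euclid_dist n x y"
proof -
  have "(euclid_dist n (lerp s x y) (lerp t x y))\<^sup>2 = (\<bar>s - t\<bar> * euclid_dist n x y)\<^sup>2"
    unfolding power_mult_distrib euclid_dist_sq sum_distrib_left
    by (intro sum.cong) (auto simp: lerp_def power2_eq_square algebra_simps)
  then show ?thesis by simp
qed

lemma lerp_ends [simp]: "lerp 0 x y = x" "lerp 1 x y = y"
  by (auto simp: lerp_def)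

text \<open>Stewart's theorem, which is an identity in each coordinate.\<close>

lemma euclid_dist_stewart:
  "(euclid_dist n u (lerp t x y))\<^sup>2 =
     (1 - t) * (euclid_dist n u x)\<^sup>2 + t * (euclid_dist n u y)\<^sup>2 - t * (1 - t) * (euclid_dist n x y)\<^sup>2"
proof -
  have "(u i - lerp t x y i)\<^sup>2 = (1 - t) * (u i - x i)\<^sup>2 + t * (u i - y i)\<^sup>2 - t * (1 - t) * (x i - y i)\<^sup>2" for i
    by (simp add: lerp_def power2_eq_square algebra_simps)
  then show ?thesis
    by (simp add: euclid_dist_sq sum.distrib sum_subtractf sum_distrib_left)
qed

text \<open>By Stewart's theorem the distance from \<open>m\<close> to the interpolated point is zero.\<close>

lemma lerp_unique:
  assumes "x \<in> unit_cube n" "y \<in> unit_cube n" "m \<in> unit_cube n" "0 \<le> t" "t \<le> 1"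
    and "euclid_dist n x m = t * euclid_dist n x y" "euclid_dist n m y = (1 - t) * euclid_dist n x y"
  shows "m = lerp t x y"
proof -
  have "(euclid_dist n m (lerp t x y))\<^sup>2 = 0"
    unfolding euclid_dist_stewart assms(6,7) euclid_dist_commute[of n m x]
    by (simp add: power2_eq_square algebra_simps)
  then show ?thesis using euclid_dist_zero[OF assms(3) lerp_in_cube[OF assms(1,2,4,5)]] by simp
qed

lemma face_subset_cube: "is_face n F \<Longrightarrow> F \<subseteq> unit_cube n"
  by (auto simp: is_face_def)

lemma smallest_face_eq:
  assumes "x \<in> unit_cube n"
  shows "smallest_face n x = {y \<in> unit_cube n. \<forall>i<n. x i = 0 \<or> x i = 1 \<longrightarrow> y i = x i}" (is "_ = ?R")
proof -
  have "is_face n ?R" unfolding is_face_def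
    by (rule exI[of _ "{i. i < n \<and> (x i = 0 \<or> x i = 1)}"], rule exI[of _ x]) auto
  moreover have "x \<in> ?R" using assms by simp
  moreover have "?R \<subseteq> F" if "is_face n F" "x \<in> F" for F
  proof -
    obtain A e where A: "A \<subseteq> {..<n}" "\<forall>i\<in>A. e i = 0 \<or> e i = 1"
      and F: "F = {x \<in> unit_cube n. \<forall>i\<in>A. x i = e i}" using \<open>is_face n F\<close> by (auto simp: is_face_def)
    show ?thesis
    proof
      fix y assume y: "y \<in> ?R"
      have "y i = e i" if "i \<in> A" for i
      proof -
        have "i < n" "x i = e i" using that A F \<open>x \<in> F\<close> by auto
        moreover have "x i = 0 \<or> x i = 1" using \<open>x i = e i\<close> A that by auto
        ultimately show ?thesis using y by auto
      qed
      then show "y \<in> F" using y F by simp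
    qed
  qed
  ultimately show ?thesis unfolding smallest_face_def by blast
qed

lemma
  assumes "x \<in> unit_cube n"
  shows is_face_smallest_face: "is_face n (smallest_face n x)"
    and in_smallest_face: "x \<in> smallest_face n x"
    and smallest_face_subset_cube: "smallest_face n x \<subseteq> unit_cube n"
proof -
  show "is_face n (smallest_face n x)" unfolding smallest_face_eq[OF assms] is_face_def
    by (rule exI[of _ "{i. i < n \<and> (x i = 0 \<or> x i = 1)}"], rule exI[of _ x]) auto
  show "x \<in> smallest_face n x" by (simp add: smallest_face_def)
  show "smallest_face n x \<subseteq> unit_cube n" unfolding smallest_face_eq[OF assms] by auto
qed

lemma smallest_face_subset: "is_face n F \<Longrightarrow> x \<in> F \<Longrightarrow> smallest_face n x \<subseteq> F"
  by (auto simp: smallest_face_def)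

lemma smallest_face_mono:
  assumes "y \<in> unit_cube n" "x \<in> smallest_face n y"
  shows "smallest_face n x \<subseteq> smallest_face n y"
  using smallest_face_subset is_face_smallest_face assms by blast

lemma face_lerp:
  assumes "is_face n F" "x \<in> F" "y \<in> F" "0 \<le> t" "t \<le> 1"
  shows "lerp t x y \<in> F"
proof -
  obtain A e where F: "F = {x \<in> unit_cube n. \<forall>i\<in>A. x i = e i}" using assms(1) by (auto simp: is_face_def)
  have "lerp t x y \<in> unit_cube n" using assms F by (intro lerp_in_cube) auto
  moreover have "lerp t x y i = e i" if "i \<in> A" for i
    using that assms(2,3) F by (simp add: lerp_def algebra_simps)
  ultimately show ?thesis using F by simp
qed

lemma face_interior_iff:
  assumes "is_face n F" "x \<in> F"
  shows "x \<in> face_interior n F \<longleftrightarrow> smallest_face n x = F"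
proof -
  have x: "x \<in> unit_cube n" using assms face_subset_cube by blast
  show ?thesis
    using assms is_face_smallest_face[OF x] in_smallest_face[OF x] smallest_face_subset[of n F x]
      smallest_face_subset[of n _ x]
    unfolding face_interior_def by blast
qed

text \<open>The coordinates in which \<open>x\<close> and \<open>y\<close> differ lie strictly between \<open>0\<close> and \<open>1\<close> at \<open>x\<close>, so the
  segment from \<open>y\<close> to \<open>x\<close> can be prolonged a little beyond \<open>x\<close>.\<close>

lemma small_extension:
  fixes x y :: point
  assumes x: "x \<in> unit_cube n" and y: "y \<in> smallest_face n x"
  obtains \<eta> where "0 < \<eta>" "\<eta> \<le> 1" "lerp (- \<eta>) x y \<in> smallest_face n x"
proof -
  define I where "I = {i. i < n \<and> x i \<noteq> 0 \<and> x i \<noteq> 1}"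
  define \<eta> where "\<eta> = Min (insert 1 ((\<lambda>i. min (x i) (1 - x i)) ` I))"
  have fin: "finite (insert 1 ((\<lambda>i. min (x i) (1 - x i)) ` I))" by (simp add: I_def)
  have I: "0 < min (x i) (1 - x i)" if "i \<in> I" for i
  proof -
    have "x i \<noteq> 0" "x i \<noteq> 1" using that by (auto simp: I_def)
    then have "0 < x i" "x i < 1" using unit_cube_coord[OF x, of i] by linarith+
    then show ?thesis by simp
  qed
  have \<eta>: "0 < \<eta>" "\<eta> \<le> 1" using fin I by (auto simp: \<eta>_def)
  have "\<eta> \<le> min (x i) (1 - x i)" if "i \<in> I" for i
    unfolding \<eta>_def using that by (intro Min_le fin) simp
  then have \<eta>I: "\<eta> \<le> x i" "\<eta> \<le> 1 - x i" if "i \<in> I" for i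
    using that by fastforce+
  have yc: "y \<in> unit_cube n" and yx: "\<And>i. i < n \<Longrightarrow> x i = 0 \<or> x i = 1 \<Longrightarrow> y i = x i"
    using y unfolding smallest_face_eq[OF x] by auto
  have c: "0 \<le> lerp (- \<eta>) x y i \<and> lerp (- \<eta>) x y i \<le> 1" if "i < n" for i
  proof (cases "i \<in> I")
    case True
    have e: "lerp (- \<eta>) x y i = x i + \<eta> * (x i - y i)" by (simp add: lerp_def algebra_simps)
    have "\<bar>x i - y i\<bar> \<le> 1" using unit_cube_coord[OF x, of i] unit_cube_coord[OF yc, of i] by auto
    then have "\<bar>\<eta> * (x i - y i)\<bar> \<le> \<eta>" using \<eta>(1) by (simp add: abs_mult mult_left_le)
    then show ?thesis unfolding e using \<eta>I[OF True] by auto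
  next
    case False
    then have "y i = x i" using yx that by (auto simp: I_def)
    then show ?thesis using unit_cube_coord[OF x, of i] by (simp add: lerp_def algebra_simps)
  qed
  have "lerp (- \<eta>) x y i = 0" if "i \<ge> n" for i
    using x yc that by (simp add: unit_cube_def lerp_def)
  then have "lerp (- \<eta>) x y \<in> unit_cube n"
    unfolding unit_cube_def using c by simp
  moreover have "lerp (- \<eta>) x y i = x i" if "i < n" "x i = 0 \<or> x i = 1" for i
    using yx[OF that] by (simp add: lerp_def algebra_simps)
  ultimately have "lerp (- \<eta>) x y \<in> smallest_face n x" unfolding smallest_face_eq[OF x] by simp
  then show thesis using that \<eta> by blast
qed

text \<open>The smallest face of \<open>x\<close> consists of the points \<open>y\<close> for which the segment from \<open>y\<close> to \<open>x\<close> can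
  be prolonged beyond \<open>x\<close>. Equality in the triangle inequality expresses this by distances, which is
  why isometries of faces respect smallest faces although they are not assumed to be affine.\<close>

lemma smallest_face_metric:
  assumes F: "is_face n F" and x: "x \<in> F"
  shows "smallest_face n x = {y \<in> F. y = x \<or>
    (\<exists>z\<in>F. z \<noteq> x \<and> euclid_dist n y z = euclid_dist n y x + euclid_dist n x z)}" (is "_ = ?R")
proof (intro equalityI subsetI)
  have xc: "x \<in> unit_cube n" using F x face_subset_cube by blast
  fix y assume y: "y \<in> smallest_face n x"
  have yF: "y \<in> F" using smallest_face_subset[OF F x] y by blast
  then have yc: "y \<in> unit_cube n" using F face_subset_cube by blast
  show "y \<in> ?R"
  proof (cases "y = x")
    case False
    obtain \<eta> where \<eta>: "0 < \<eta>" "\<eta> \<le> 1" "lerp (- \<eta>) x y \<in> smallest_face n x"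
      using small_extension[OF xc y] .
    let ?z = "lerp (- \<eta>) x y"
    have zF: "?z \<in> F" using smallest_face_subset[OF F x] \<eta>(3) by blast
    have "euclid_dist n (lerp 0 x y) ?z = \<eta> * euclid_dist n x y"
         "euclid_dist n (lerp 1 x y) ?z = (1 + \<eta>) * euclid_dist n x y"
      unfolding euclid_dist_lerp using \<eta> by auto
    then have xz: "euclid_dist n x ?z = \<eta> * euclid_dist n x y"
      and yz: "euclid_dist n y ?z = (1 + \<eta>) * euclid_dist n x y" by auto
    have "euclid_dist n x y \<noteq> 0" using euclid_dist_zero[OF xc yc] False by simp
    then have "euclid_dist n x ?z \<noteq> 0" using xz \<eta> by simp
    then have "?z \<noteq> x" by (metis euclid_dist_self)
    moreover have "euclid_dist n y ?z = euclid_dist n y x + euclid_dist n x ?z"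
      unfolding xz yz euclid_dist_commute[of n y x] by (simp add: algebra_simps)
    ultimately show ?thesis using yF zF by blast
  qed (use yF in simp)
next
  have xc: "x \<in> unit_cube n" using F x face_subset_cube by blast
  fix y assume "y \<in> ?R"
  then have yF: "y \<in> F" and "y = x \<or> (\<exists>z\<in>F. z \<noteq> x \<and> euclid_dist n y z = euclid_dist n y x + euclid_dist n x z)"
    by auto
  then consider "y = x" | z where "z \<in> F" "z \<noteq> x" "euclid_dist n y z = euclid_dist n y x + euclid_dist n x z"
    by blast
  then show "y \<in> smallest_face n x"
  proof cases
    case 1 then show ?thesis using in_smallest_face[OF xc] by simp
  next
    case 2
    have yc: "y \<in> unit_cube n" and zc: "z \<in> unit_cube n" using 2 yF F face_subset_cube by blast+
    have xz: "0 < euclid_dist n x z" using euclid_dist_zero[OF xc zc] 2 by (simp add: order_less_le)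
    define D where "D = euclid_dist n y z"
    have D: "0 < D" using 2 xz euclid_dist_nonneg[of n y x] unfolding D_def by linarith
    define t where "t = euclid_dist n y x / D"
    have tD: "euclid_dist n y x = t * D" using D by (simp add: t_def)
    have t: "0 \<le> t" using D by (simp add: t_def)
    have "t * D < D" using 2 xz tD D_def by simp
    then have t1: "t < 1" using D by simp
    have "x = lerp t y z"
      using t t1 2 tD D_def by (intro lerp_unique[OF yc zc xc]) (auto simp: algebra_simps)
    then have e: "x i = (1 - t) * y i + t * z i" for i by (simp add: lerp_def)
    have "y i = x i" if "i < n" "x i = 0 \<or> x i = 1" for i
    proof -
      have yi: "0 \<le> y i" "y i \<le> 1" and zi: "0 \<le> z i" "z i \<le> 1" using unit_cube_coord yc zc by auto
      from that(2) show ?thesis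
      proof
        assume "x i = 0"
        then have "(1 - t) * y i = 0" using e[of i] yi zi t t1
          by (simp add: add_nonneg_eq_0_iff)
        then show ?thesis using t1 \<open>x i = 0\<close> by simp
      next
        assume "x i = 1"
        then have "(1 - t) * (1 - y i) + t * (1 - z i) = 0" using e[of i] by (simp add: algebra_simps)
        then have "(1 - t) * (1 - y i) = 0" using yi zi t t1
          by (subst (asm) add_nonneg_eq_0_iff) auto
        then show ?thesis using t1 \<open>x i = 1\<close> by simp
      qed
    qed
    then show ?thesis unfolding smallest_face_eq[OF xc] using yc by simp
  qed
qed

lemma smallest_face_isometry:
  assumes h: "face_isometry n F n' F' h" and F: "is_face n F" "is_face n' F'" and x: "x \<in> F"
  shows "smallest_face n' (h x) = h ` smallest_face n x"
proof -
  have bij: "inj_on h F" "h ` F = F'" using h by (auto simp: face_isometry_def bij_betw_def)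
  have iso: "\<And>x y. x \<in> F \<Longrightarrow> y \<in> F \<Longrightarrow> euclid_dist n' (h x) (h y) = euclid_dist n x y"
    using h by (auto simp: face_isometry_def)
  have "h x \<in> F'" using bij x by blast
  let ?P = "\<lambda>y. y = x \<or> (\<exists>z\<in>F. z \<noteq> x \<and> euclid_dist n y z = euclid_dist n y x + euclid_dist n x z)"
  let ?Q = "\<lambda>y. y = h x \<or> (\<exists>z\<in>F'. z \<noteq> h x \<and> euclid_dist n' y z = euclid_dist n' y (h x) + euclid_dist n' (h x) z)"
  have "?Q (h y) \<longleftrightarrow> ?P y" if "y \<in> F" for y
    unfolding bij(2)[symmetric] using that x by (simp add: iso inj_on_eq_iff[OF bij(1)] cong: bex_cong)
  then have "{y \<in> F'. ?Q y} = h ` {y \<in> F. ?P y}" unfolding bij(2)[symmetric] by blast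
  then show ?thesis
    unfolding smallest_face_metric[OF F(2) \<open>h x \<in> F'\<close>] smallest_face_metric[OF F(1) x] .
qed

lemma face_isometry_lerp:
  assumes h: "face_isometry n F n' F' h" and F: "is_face n F" "is_face n' F'"
    and xy: "x \<in> F" "y \<in> F" and t: "0 \<le> t" "t \<le> 1"
  shows "h (lerp t x y) = lerp t (h x) (h y)"
proof -
  have iso: "\<And>x y. x \<in> F \<Longrightarrow> y \<in> F \<Longrightarrow> euclid_dist n' (h x) (h y) = euclid_dist n x y"
    and img: "h ` F = F'" using h by (auto simp: face_isometry_def bij_betw_def)
  have l: "lerp t x y \<in> F" using face_lerp F xy t by blast
  have *: "h x \<in> unit_cube n'" "h y \<in> unit_cube n'" "h (lerp t x y) \<in> unit_cube n'"
    using xy l img face_subset_cube[OF F(2)] by blast+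
  show ?thesis
  proof (rule lerp_unique[OF * t])
    show "euclid_dist n' (h x) (h (lerp t x y)) = t * euclid_dist n' (h x) (h y)"
      using iso xy l euclid_dist_lerp[of n 0 x y t] t by simp
    show "euclid_dist n' (h (lerp t x y)) (h y) = (1 - t) * euclid_dist n' (h x) (h y)"
      using iso xy l euclid_dist_lerp[of n t x y 1] t by simp
  qed
qed

text \<open>The ball of radius \<open>\<delta>\<close> around \<open>y\<close> misses the boundary of the smallest face of \<open>y\<close>. The condition
  refers to this face only, so it is transported by isometries of faces between cubes of different
  dimensions.\<close>

definition face_room :: "nat \<Rightarrow> point \<Rightarrow> real \<Rightarrow> bool" where
  "face_room n y \<delta> \<longleftrightarrow> 0 < \<delta> \<and> \<delta> \<le> 1 \<and>
     (\<forall>u\<in>smallest_face n y. euclid_dist n y u < \<delta> \<longrightarrow> smallest_face n u = smallest_face n y)"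

lemma face_roomI:
  assumes y: "y \<in> unit_cube n" and \<delta>: "0 < \<delta>" "\<delta> \<le> 1"
    and room: "\<And>i. i < n \<Longrightarrow> y i \<noteq> 0 \<Longrightarrow> y i \<noteq> 1 \<Longrightarrow> \<delta> \<le> y i \<and> \<delta> \<le> 1 - y i"
  shows "face_room n y \<delta>"
  unfolding face_room_def
proof (intro conjI \<delta> ballI impI)
  fix u assume u: "u \<in> smallest_face n y" and d: "euclid_dist n y u < \<delta>"
  have uc: "u \<in> unit_cube n" and ui: "\<And>i. i < n \<Longrightarrow> y i = 0 \<or> y i = 1 \<Longrightarrow> u i = y i"
    using u unfolding smallest_face_eq[OF y] by auto
  have "(u i = 0 \<longleftrightarrow> y i = 0) \<and> (u i = 1 \<longleftrightarrow> y i = 1)" if "i < n" for i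
  proof (cases "y i = 0 \<or> y i = 1")
    case True then show ?thesis using ui[OF that] by auto
  next
    case False
    then have "\<delta> \<le> y i" "\<delta> \<le> 1 - y i" using room[OF that] by auto
    moreover have "\<bar>y i - u i\<bar> < \<delta>" using coord_le_euclid_dist[OF that, of y u] d by linarith
    ultimately show ?thesis using False by auto
  qed
  then show "smallest_face n u = smallest_face n y"
    unfolding smallest_face_eq[OF y] smallest_face_eq[OF uc] by auto
qed

lemma face_room_exists:
  assumes y: "y \<in> unit_cube n"
  obtains \<delta> where "face_room n y \<delta>"
proof -
  define I where "I = {i. i < n \<and> y i \<noteq> 0 \<and> y i \<noteq> 1}"
  define \<delta> where "\<delta> = Min (insert 1 ((\<lambda>i. min (y i) (1 - y i)) ` I))"
  have fin: "finite (insert 1 ((\<lambda>i. min (y i) (1 - y i)) ` I))" by (simp add: I_def)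
  have "0 < min (y i) (1 - y i)" if "i \<in> I" for i
  proof -
    have "y i \<noteq> 0" "y i \<noteq> 1" using that by (auto simp: I_def)
    then have "0 < y i" "y i < 1" using unit_cube_coord[OF y, of i] by linarith+
    then show ?thesis by simp
  qed
  then have \<delta>: "0 < \<delta>" "\<delta> \<le> 1" using fin by (auto simp: \<delta>_def)
  have "\<delta> \<le> min (y i) (1 - y i)" if "i \<in> I" for i
    unfolding \<delta>_def using that by (intro Min_le fin) simp
  then have "\<delta> \<le> y i" "\<delta> \<le> 1 - y i" if "i \<in> I" for i
    using that by fastforce+
  then have "face_room n y \<delta>" using \<delta> by (intro face_roomI[OF y]) (auto simp: I_def)
  then show thesis using that by blast
qed

text \<open>The projection \<open>u\<close> of \<open>y'\<close> to the smallest face of \<open>y\<close> is interior to that face, so the coordinates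
  along the face are strictly between \<open>0\<close> and \<open>1\<close> at \<open>y'\<close> too. In the other coordinates \<open>y\<close> and \<open>y'\<close>
  differ by less than \<open>\<delta> \<le> 1\<close>, so \<open>y'\<close> cannot lie on a facet opposite to \<open>y\<close>.\<close>

lemma smallest_face_near:
  assumes y: "y \<in> unit_cube n" "y' \<in> unit_cube n" and room: "face_room n y \<delta>"
    and d: "euclid_dist n y y' < \<delta>"
  shows "smallest_face n y \<subseteq> smallest_face n y'"
proof -
  define u where "u i = (if i < n \<and> (y i = 0 \<or> y i = 1) then y i else y' i)" for i
  have uc: "u \<in> unit_cube n" using y by (auto simp: u_def unit_cube_def)
  have us: "u \<in> smallest_face n y" unfolding smallest_face_eq[OF y(1)] using uc by (auto simp: u_def)
  have "(euclid_dist n y u)\<^sup>2 \<le> (euclid_dist n y y')\<^sup>2"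
    unfolding euclid_dist_sq by (intro sum_mono) (auto simp: u_def)
  then have "euclid_dist n y u \<le> euclid_dist n y y'" by (rule power2_le_imp_le) simp
  then have eq: "smallest_face n u = smallest_face n y" using room us d by (auto simp: face_room_def)
  have "y i = y' i" if "i < n" "y' i = 0 \<or> y' i = 1" for i
  proof (cases "y i = 0 \<or> y i = 1")
    case True
    have "\<bar>y i - y' i\<bar> < 1" using coord_le_euclid_dist[OF that(1), of y y'] d room by (auto simp: face_room_def)
    then show ?thesis using True that(2) by auto
  next
    case False
    then have "u i = y' i" by (simp add: u_def)
    moreover have "y \<in> smallest_face n u" using eq in_smallest_face[OF y(1)] by simp
    ultimately show ?thesis unfolding smallest_face_eq[OF uc] using that by auto
  qed
  then have "y \<in> smallest_face n y'" unfolding smallest_face_eq[OF y(2)] using y by auto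
  then show ?thesis using smallest_face_mono[OF y(2)] by blast
qed

lemma face_room_isometry:
  assumes h: "face_isometry n (smallest_face n y) n' (smallest_face n' (h y)) h"
    and y: "y \<in> unit_cube n" "h y \<in> unit_cube n'" and room: "face_room n y \<delta>"
  shows "face_room n' (h y) \<delta>"
  unfolding face_room_def
proof (intro conjI ballI impI)
  show "0 < \<delta>" "\<delta> \<le> 1" using room by (auto simp: face_room_def)
  fix u' assume u': "u' \<in> smallest_face n' (h y)" "euclid_dist n' (h y) u' < \<delta>"
  obtain u where u: "u \<in> smallest_face n y" "u' = h u"
    using h u'(1) unfolding face_isometry_def bij_betw_def by blast
  have F: "is_face n (smallest_face n y)" "is_face n' (smallest_face n' (h y))"
    using y is_face_smallest_face by auto
  have "euclid_dist n y u < \<delta>"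
    using h u u'(2) in_smallest_face[OF y(1)] by (simp add: face_isometry_def)
  then have "smallest_face n u = smallest_face n y" using room u by (auto simp: face_room_def)
  then show "smallest_face n' u' = smallest_face n' (h y)"
    using smallest_face_isometry[OF h F] u in_smallest_face[OF y(1)] by simp
qed

lemma smallest_face_interior:
  assumes "x \<in> unit_cube n" "\<And>i. i < n \<Longrightarrow> 0 < x i \<and> x i < 1"
  shows "smallest_face n x = unit_cube n"
  unfolding smallest_face_eq[OF assms(1)] using assms(2) by fastforce

section \<open>Vertices, edges and directions of a cube\<close>

definition edge_face :: "nat \<Rightarrow> point \<Rightarrow> nat \<Rightarrow> point set" where
  "edge_face n x i = {z \<in> unit_cube n. \<forall>j<n. j \<noteq> i \<longrightarrow> z j = x j}"

definition edge_dir :: "point \<Rightarrow> nat \<Rightarrow> point" where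
  "edge_dir x i = (\<lambda>j. if j = i then 1 - 2 * x i else 0)"

abbreviation opposite :: "point \<Rightarrow> nat \<Rightarrow> point" where
  "opposite x i \<equiv> x(i := 1 - x i)"

abbreviation ray :: "point \<Rightarrow> point \<Rightarrow> real \<Rightarrow> point" where
  "ray x u t \<equiv> (\<lambda>i. x i + t * u i)"

lemma vertex_iff: "is_face n {x} \<longleftrightarrow> x \<in> unit_cube n \<and> (\<forall>i<n. x i = 0 \<or> x i = 1)"
proof
  assume F: "is_face n {x}"
  then have x: "x \<in> unit_cube n" using face_subset_cube by blast
  have "x i = 0 \<or> x i = 1" if "i < n" for i
  proof (rule ccontr)
    assume *: "\<not> (x i = 0 \<or> x i = 1)"
    have "x(i := 0) \<in> smallest_face n x" unfolding smallest_face_eq[OF x]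
      using x * that by (auto simp: unit_cube_def)
    then have "x(i := 0) = x" using smallest_face_subset[OF F, of x] by auto
    then show False using * by (metis fun_upd_same)
  qed
  then show "x \<in> unit_cube n \<and> (\<forall>i<n. x i = 0 \<or> x i = 1)" using x by blast
next
  assume *: "x \<in> unit_cube n \<and> (\<forall>i<n. x i = 0 \<or> x i = 1)"
  then have x: "x \<in> unit_cube n" by blast
  have "smallest_face n x = {x}" unfolding smallest_face_eq[OF x]
    using * by (auto intro: unit_cube_eqI)
  then show "is_face n {x}" using is_face_smallest_face[OF x] by simp
qed

lemma vertex_smallest_face: "is_face n {x} \<Longrightarrow> smallest_face n x = {x}"
  using smallest_face_subset[of n "{x}" x] in_smallest_face[of x n] vertex_iff by blast

lemma opposite_vertex:
  assumes "is_face n {x}" "i < n"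
  shows "is_face n {opposite x i}"
  using assms unfolding vertex_iff by (auto simp: unit_cube_def)

lemma opposite_in_cube: "x \<in> unit_cube n \<Longrightarrow> i < n \<Longrightarrow> opposite x i \<in> unit_cube n"
  by (auto simp: unit_cube_def)

lemma euclid_dist_upd:
  assumes "i < n"
  shows "(euclid_dist n (x(i := a)) y)\<^sup>2 = (euclid_dist n x y)\<^sup>2 - (x i - y i)\<^sup>2 + (a - y i)\<^sup>2"
proof -
  have "(\<Sum>j\<in>{..<n} - {i}. ((x(i := a)) j - y j)\<^sup>2) = (\<Sum>j\<in>{..<n} - {i}. (x j - y j)\<^sup>2)"
    by (intro sum.cong) auto
  then show ?thesis
    unfolding euclid_dist_sq using assms by (simp add: sum.remove[of "{..<n}" i])
qed

lemma opposite_dist: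
  assumes "is_face n {x}" "i < n"
  shows "euclid_dist n x (opposite x i) = 1"
proof -
  have "(euclid_dist n (opposite x i) x)\<^sup>2 = 1"
    using euclid_dist_upd[OF assms(2), of x "1 - x i" x] assms unfolding vertex_iff by auto
  then have "euclid_dist n (opposite x i) x = 1" by (intro power2_eq_imp_eq[of _ 1]) simp_all
  then show ?thesis by (simp add: euclid_dist_commute)
qed

text \<open>The squared distance of two vertices counts the coordinates in which they differ.\<close>

lemma adjacent_vertices:
  assumes x: "is_face n {x}" and y: "is_face n {y}" and d: "euclid_dist n x y = 1"
  obtains i where "i < n" "y = opposite x i"
proof -
  let ?I = "{i \<in> {..<n}. x i \<noteq> y i}"
  have "(x i - y i)\<^sup>2 = (if x i \<noteq> y i then 1 else 0)" if "i \<in> {..<n}" for i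
  proof -
    have "x i = 0 \<or> x i = 1" "y i = 0 \<or> y i = 1" using that x y vertex_iff by blast+
    then show ?thesis by auto
  qed
  then have "(\<Sum>i<n. (x i - y i)\<^sup>2) = (\<Sum>i<n. if x i \<noteq> y i then 1 else 0)"
    by (rule sum.cong[OF refl])
  also have "\<dots> = real (card ?I)" by (simp add: sum.If_cases Int_def)
  finally have "card ?I = 1" using d euclid_dist_sq[of n x y] by simp
  then obtain i where i: "?I = {i}" by (auto simp: card_1_singleton_iff)
  then have "i < n" "x i \<noteq> y i" by auto
  have "x i = 0 \<or> x i = 1" "y i = 0 \<or> y i = 1" using x y \<open>i < n\<close> vertex_iff by blast+
  then have "y i = 1 - x i" using \<open>x i \<noteq> y i\<close> by auto
  have "y = opposite x i"
  proof (rule unit_cube_eqI[of _ n])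
    show "y \<in> unit_cube n" using y vertex_iff by blast
    show "opposite x i \<in> unit_cube n" using x vertex_iff opposite_in_cube \<open>i < n\<close> by blast
    fix j assume "j < n"
    then have "x j = y j" if "j \<noteq> i" using that i by blast
    then show "y j = opposite x i j" using \<open>y i = 1 - x i\<close> by simp
  qed
  then show thesis using that \<open>i < n\<close> by blast
qed

text \<open>Read from right to left: coordinates of a cube are determined by the distances to the two ends of
  an edge, so that they make sense in any metric space into which the cube embeds isometrically.\<close>

lemma coordinate_from_distances:
  assumes "is_face n {x}" "i < n" "y \<in> unit_cube n"
  shows "((euclid_dist n x y)\<^sup>2 + 1 - (euclid_dist n (opposite x i) y)\<^sup>2) / 2 = \<bar>y i - x i\<bar>"
proof -
  have "x i = 0 \<or> x i = 1" using assms vertex_iff by blast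
  then show ?thesis
    unfolding euclid_dist_upd[OF assms(2)] using unit_cube_coord[OF assms(3), of i]
    by (auto simp: power2_eq_square algebra_simps)
qed

lemma opposite_in_smallest_face:
  assumes x: "is_face n {x}" and y: "y \<in> unit_cube n" and i: "i < n" and xs: "x \<in> smallest_face n y"
  shows "opposite x i \<in> smallest_face n y \<longleftrightarrow> y i \<noteq> x i"
proof -
  have xc: "x \<in> unit_cube n" "x i = 0 \<or> x i = 1" using x i vertex_iff by auto
  have yi: "0 \<le> y i" "y i \<le> 1" using unit_cube_coord[OF y] by auto
  have *: "\<And>j. j < n \<Longrightarrow> y j = 0 \<or> y j = 1 \<Longrightarrow> x j = y j"
    using xs unfolding smallest_face_eq[OF y] by auto
  show ?thesis
  proof
    assume "opposite x i \<in> smallest_face n y"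
    then have "y i = 0 \<or> y i = 1 \<Longrightarrow> 1 - x i = y i" unfolding smallest_face_eq[OF y] using i by auto
    then show "y i \<noteq> x i" using xc by auto
  next
    assume ne: "y i \<noteq> x i"
    have "opposite x i j = y j" if "j < n" "y j = 0 \<or> y j = 1" for j
      using *[OF that] ne by auto
    then show "opposite x i \<in> smallest_face n y"
      unfolding smallest_face_eq[OF y] using opposite_in_cube[OF xc(1) i] by simp
  qed
qed

lemma edge_face_is_face:
  assumes "is_face n {x}" "i < n"
  shows "is_face n (edge_face n x i)"
  unfolding is_face_def edge_face_def using assms unfolding vertex_iff
  by (intro exI[of _ "{..<n} - {i}"] exI[of _ x]) auto

lemma
  assumes "is_face n {x}" "i < n"
  shows in_edge_face: "x \<in> edge_face n x i" and opposite_in_edge_face: "opposite x i \<in> edge_face n x i"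
    and edge_face_not_vertex: "edge_face n x i \<noteq> {x}"
proof -
  have x: "x \<in> unit_cube n" "x i = 0 \<or> x i = 1" using assms vertex_iff by auto
  show "x \<in> edge_face n x i" using x by (simp add: edge_face_def)
  show o: "opposite x i \<in> edge_face n x i" using opposite_in_cube x assms by (simp add: edge_face_def)
  have "opposite x i \<noteq> x" using x(2) by (metis diff_zero fun_upd_same one_neq_zero diff_self)
  then show "edge_face n x i \<noteq> {x}" using o by auto
qed

lemma edge_face_eq_lerp:
  assumes x: "is_face n {x}" and i: "i < n"
  shows "edge_face n x i = (\<lambda>t. lerp t x (opposite x i)) ` {0..1}"
proof -
  have xc: "x \<in> unit_cube n" and xi: "x i = 0 \<or> x i = 1" using x i vertex_iff by auto
  have "lerp t x (opposite x i) \<in> edge_face n x i" if "t \<in> {0..1}" for t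
    using face_lerp[OF edge_face_is_face[OF x i] in_edge_face[OF x i] opposite_in_edge_face[OF x i]] that by simp
  moreover have "z \<in> (\<lambda>t. lerp t x (opposite x i)) ` {0..1}" if z: "z \<in> edge_face n x i" for z
  proof
    have zc: "z \<in> unit_cube n" and zj: "\<And>j. j < n \<Longrightarrow> j \<noteq> i \<Longrightarrow> z j = x j" using z by (auto simp: edge_face_def)
    have zi: "0 \<le> z i" "z i \<le> 1" using unit_cube_coord[OF zc] by auto
    show "\<bar>z i - x i\<bar> \<in> {0..1}" using zi xi by auto
    show "z = lerp \<bar>z i - x i\<bar> x (opposite x i)"
    proof (rule unit_cube_eqI[OF zc])
      show "lerp \<bar>z i - x i\<bar> x (opposite x i) \<in> unit_cube n"
        using lerp_in_cube[OF xc opposite_in_cube[OF xc i]] zi xi by auto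
      fix j assume "j < n"
      show "z j = lerp \<bar>z i - x i\<bar> x (opposite x i) j"
      proof (cases "j = i")
        case True
        then show ?thesis using xi zi by (auto simp: lerp_def)
      next
        case False
        then show ?thesis using zj[OF \<open>j < n\<close>] by (simp add: lerp_def algebra_simps)
      qed
    qed
  qed
  ultimately show ?thesis by blast
qed

lemma edge_in_face:
  assumes F: "is_face n F" and x: "x \<in> F" and y: "y \<in> F" "y i \<noteq> x i" and i: "i < n"
  shows "edge_face n x i \<subseteq> F"
proof -
  obtain A e where A: "F = {x \<in> unit_cube n. \<forall>i\<in>A. x i = e i}" "A \<subseteq> {..<n}"
    using F by (auto simp: is_face_def)
  have "i \<notin> A" using A x y by auto
  then have "z j = e j" if "z \<in> edge_face n x i" "j \<in> A" for z j
  proof -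
    have "j < n" "j \<noteq> i" using that A \<open>i \<notin> A\<close> by auto
    then have "z j = x j" using that by (simp add: edge_face_def)
    then show ?thesis using A x that by simp
  qed
  then show ?thesis using A unfolding edge_face_def by auto
qed

lemma face_has_edge:
  assumes F: "is_face n F" and x: "x \<in> F" "F \<noteq> {x}"
  obtains i where "i < n" "edge_face n x i \<subseteq> F"
proof -
  obtain y where y: "y \<in> F" "y \<noteq> x" using x by blast
  then obtain i where "i < n" "y i \<noteq> x i"
    using unit_cube_eqI[of y n x] x face_subset_cube[OF F] by blast
  then show thesis using that edge_in_face[OF F x(1) y(1)] by blast
qed

lemma directions_mono: "F \<subseteq> G \<Longrightarrow> directions n F x \<subseteq> directions n G x"
  by (auto simp: directions_def)

lemma directions_edge_face:
  assumes x: "is_face n {x}" and i: "i < n"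
  shows "directions n (edge_face n x i) x = {edge_dir x i}"
proof
  have xi: "x i = 0 \<or> x i = 1" and xc: "x \<in> unit_cube n" using x i vertex_iff by auto
  show "{edge_dir x i} \<subseteq> directions n (edge_face n x i) x"
  proof -
    have "(\<Sum>j<n. (edge_dir x i j)\<^sup>2) = (\<Sum>j<n. if j = i then 1 else 0)"
      using xi by (intro sum.cong) (auto simp: edge_dir_def)
    then have "L2_set (edge_dir x i) {..<n} = 1" using i by (simp add: L2_set_def)
    moreover have "ray x (edge_dir x i) 1 = opposite x i" by (auto simp: edge_dir_def)
    then have "ray x (edge_dir x i) 1 \<in> edge_face n x i" using opposite_in_edge_face[OF x i] by simp
    ultimately show ?thesis using i by (auto simp: directions_def edge_dir_def intro!: exI[of _ 1])
  qed
  show "directions n (edge_face n x i) x \<subseteq> {edge_dir x i}"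
  proof
    fix u assume "u \<in> directions n (edge_face n x i) x"
    then obtain t where u: "\<forall>j\<ge>n. u j = 0" "L2_set u {..<n} = 1" and t: "t > 0" "ray x u t \<in> edge_face n x i"
      by (auto simp: directions_def)
    have uj: "u j = 0" if "j \<noteq> i" for j
      using that u(1) t by (cases "j < n") (auto simp: edge_face_def)
    have "(\<Sum>j<n. (u j)\<^sup>2) = (\<Sum>j<n. if j = i then (u i)\<^sup>2 else 0)" using uj by (intro sum.cong) auto
    also have "\<dots> = (u i)\<^sup>2" using i by simp
    finally have "\<bar>u i\<bar> = 1" using u(2) by (simp add: L2_set_def)
    moreover have "0 \<le> x i + t * u i" "x i + t * u i \<le> 1"
      using t(2) unit_cube_coord[of "ray x u t" n i] by (auto simp: edge_face_def)
    ultimately have "u i = 1 - 2 * x i" using xi t(1) by (auto simp: abs_if split: if_splits)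
    then have "u = edge_dir x i" using uj by (auto simp: edge_dir_def)
    then show "u \<in> {edge_dir x i}" by simp
  qed
qed

lemma ray_lerp:
  assumes "0 < s"
  shows "ray x u t = lerp (t / s) x (ray x u s)"
proof
  fix i
  have "lerp (t / s) x (ray x u s) i = x i + t / s * s * u i"
    by (simp add: lerp_def algebra_simps)
  then show "x i + t * u i = lerp (t / s) x (ray x u s) i" using assms by simp
qed

text \<open>Strictly between its ends a segment starting at a vertex avoids \<open>0\<close> and \<open>1\<close> in every coordinate in
  which it moves.\<close>

lemma ray_smallest_face:
  assumes x: "is_face n {x}" and s: "ray x u s \<in> unit_cube n" and t: "0 < t" "t < s"
  shows "ray x u t \<in> unit_cube n"
    and "smallest_face n (ray x u t) = {z \<in> unit_cube n. \<forall>i<n. u i = 0 \<longrightarrow> z i = x i}"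
proof -
  have xc: "x \<in> unit_cube n" using x vertex_iff by blast
  have "0 < s" using t by simp
  show rc: "ray x u t \<in> unit_cube n"
    using lerp_in_cube[OF xc s, of "t / s"] t unfolding ray_lerp[OF \<open>0 < s\<close>, where t = t and x = x and u = u, symmetric] by simp
  have "(x i + t * u i = 0 \<or> x i + t * u i = 1) = (u i = 0)" if i: "i < n" for i
  proof -
    have xi: "x i = 0 \<or> x i = 1" using x i vertex_iff by blast
    have si: "0 \<le> x i + s * u i" "x i + s * u i \<le> 1" using unit_cube_coord[OF s, of i] by auto
    have "0 < x i + t * u i \<and> x i + t * u i < 1" if "u i \<noteq> 0"
    proof (cases "u i > 0")
      case True
      then have "0 < t * u i" "t * u i < s * u i" using t by auto
      then show ?thesis using xi si by auto
    next
      case False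
      then have "u i < 0" using that by simp
      then have "t * u i < 0" "s * u i < t * u i" using t by (auto simp: mult_pos_neg)
      then show ?thesis using xi si by auto
    qed
    then show ?thesis using xi by (cases "u i = 0") (simp, linarith)
  qed
  then show "smallest_face n (ray x u t) = {z \<in> unit_cube n. \<forall>i<n. u i = 0 \<longrightarrow> z i = x i}"
    unfolding smallest_face_eq[OF rc] by auto
qed

section \<open>Cubes embed isometrically\<close>

locale CAT0_cubes =
  fixes X :: "('l, 'a) cubing"
  assumes CAT0_X: "CAT0_cubed_complex X"
begin

abbreviation "cube l \<equiv> unit_cube (cdim X l)"
abbreviation "E l \<equiv> euclid_dist (cdim X l)"
abbreviation "sf l \<equiv> smallest_face (cdim X l)"
abbreviation "face l \<equiv> is_face (cdim X l)"

sublocale CAT0 "space_of X" "cdist X"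
proof -
  have *: "CAT0_space (space_of X) (cdist X)" using CAT0_X by (simp add: CAT0_cubed_complex_def)
  then have "Metric_space (space_of X) (cdist X)" by (simp add: CAT0_space_def geodesic_space_def)
  with * show "CAT0 (space_of X) (cdist X)" by (simp add: CAT0_def CAT0_axioms_def)
qed

lemma quot_in_space: "l \<in> cubes X \<Longrightarrow> x \<in> cube l \<Longrightarrow> quot X l x \<in> space_of X"
  by (auto simp: space_of_def)

lemma space_cases:
  assumes "a \<in> space_of X"
  obtains l x where "l \<in> cubes X" "x \<in> cube l" "a = quot X l x"
  using assms by (auto simp: space_of_def)

lemma gluing_image: "gluing X l F l' F' h \<Longrightarrow> h ` F = F'"
  by (auto simp: gluing_def face_isometry_def bij_betw_def)

lemma gluing_isometry: "gluing X l F l' F' h \<Longrightarrow> face_isometry (cdim X l) F (cdim X l') F' h"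
  by (simp add: gluing_def)

lemma gluing_dist:
  "gluing X l F l' F' h \<Longrightarrow> x \<in> F \<Longrightarrow> y \<in> F \<Longrightarrow> E l' (h x) (h y) = E l x y"
  by (simp add: gluing_def face_isometry_def)

lemma gluing_quot: "gluing X l F l' F' h \<Longrightarrow> x \<in> F \<Longrightarrow> quot X l' (h x) = quot X l x"
  by (simp add: gluing_def)

lemma quot_inj_interior:
  assumes "l \<in> cubes X" "x \<in> cube l" "y \<in> cube l" "sf l x = sf l y" "quot X l x = quot X l y"
  shows "x = y"
proof -
  have F: "face l (sf l x)" using assms is_face_smallest_face by blast
  have "x \<in> sf l x" "y \<in> sf l x" using in_smallest_face assms by metis+
  then have "x \<in> face_interior (cdim X l) (sf l x)" "y \<in> face_interior (cdim X l) (sf l x)"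
    using face_interior_iff[OF F] assms by auto
  moreover have "inj_on (quot X l) (face_interior (cdim X l) (sf l x))"
    using CAT0_X F assms(1) by (simp add: CAT0_cubed_complex_def cubed_complex_def)
  ultimately show ?thesis using assms(5) by (auto dest: inj_onD)
qed

text \<open>A gluing of the smallest faces takes \<open>x\<close> to an interior point of the smallest face of \<open>x'\<close>, and
  the quotient map is injective there.\<close>

lemma carrier_gluing:
  assumes l: "l \<in> cubes X" "l' \<in> cubes X" and x: "x \<in> cube l" "x' \<in> cube l'"
    and eq: "quot X l x = quot X l' x'"
  obtains h where "gluing X l (sf l x) l' (sf l' x') h" "h x = x'"
proof -
  obtain h where h: "gluing X l (sf l x) l' (sf l' x') h"
    using CAT0_X l x eq unfolding CAT0_cubed_complex_def cubed_complex_def by blast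
  have F: "face l (sf l x)" "face l' (sf l' x')" using x is_face_smallest_face by auto
  have xs: "x \<in> sf l x" using in_smallest_face[OF x(1)] .
  have hx: "h x \<in> sf l' x'" using gluing_image[OF h] xs by blast
  have hc: "h x \<in> cube l'" using hx smallest_face_subset_cube[OF x(2)] by blast
  have "sf l' (h x) = sf l' x'"
    using smallest_face_isometry[OF gluing_isometry[OF h] F xs] gluing_image[OF h] by simp
  moreover have "quot X l' (h x) = quot X l' x'" using gluing_quot[OF h xs] eq by simp
  ultimately have "h x = x'" using quot_inj_interior[OF l(2) hc x(2)] by simp
  then show thesis using that h by blast
qed

text \<open>The point \<open>y'\<close> of the cube \<open>l'\<close> lies in the open star of the cell carrying \<open>y\<close>, witnessed by a copy
  of that cell among the faces of \<open>l'\<close> that carry \<open>y'\<close>; the copy of \<open>y\<close> in \<open>l'\<close> has distance at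
  most \<open>r\<close> from \<open>y'\<close>.\<close>

definition in_star :: "'l \<Rightarrow> point \<Rightarrow> 'l \<Rightarrow> point \<Rightarrow> real \<Rightarrow> bool" where
  "in_star l y l' y' r \<longleftrightarrow> (\<exists>h. h y \<in> cube l' \<and> gluing X l (sf l y) l' (sf l' (h y)) h \<and>
     sf l' (h y) \<subseteq> sf l' y' \<and> E l' (h y) y' \<le> r)"

lemma in_star_refl: "y \<in> cube l \<Longrightarrow> in_star l y l y 0"
  unfolding in_star_def by (intro exI[of _ id]) (auto simp: gluing_def face_isometry_def)

text \<open>Compose the given copy of the cell with the gluing of the smallest faces of \<open>y1\<close> and \<open>y2\<close>.\<close>

lemma in_star_change_cube:
  assumes l: "l1 \<in> cubes X" "l2 \<in> cubes X" and y: "y \<in> cube l" "y1 \<in> cube l1" "y2 \<in> cube l2"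
    and eq: "quot X l1 y1 = quot X l2 y2" and star: "in_star l y l1 y1 r"
  shows "in_star l y l2 y2 r"
proof -
  obtain h where h: "h y \<in> cube l1" "gluing X l (sf l y) l1 (sf l1 (h y)) h"
    "sf l1 (h y) \<subseteq> sf l1 y1" "E l1 (h y) y1 \<le> r" using star by (auto simp: in_star_def)
  obtain g where g: "gluing X l1 (sf l1 y1) l2 (sf l2 y2) g" "g y1 = y2"
    using carrier_gluing[OF l y(2,3) eq] .
  have F: "face l1 (sf l1 y1)" "face l2 (sf l2 y2)" using y is_face_smallest_face by auto
  have hy: "h y \<in> sf l1 y1" using h(3) in_smallest_face[OF h(1)] by blast
  have sf: "sf l2 (g (h y)) = g ` sf l1 (h y)"
    using smallest_face_isometry[OF gluing_isometry[OF g(1)] F hy] .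
  have ghy: "g (h y) \<in> sf l2 y2" using hy gluing_image[OF g(1)] by blast
  have hF: "h x \<in> sf l1 (h y)" if "x \<in> sf l y" for x using that gluing_image[OF h(2)] by blast
  then have hF': "h x \<in> sf l1 y1" if "x \<in> sf l y" for x using that h(3) by blast
  have "bij_betw g (sf l1 (h y)) (g ` sf l1 (h y))"
    using g(1) h(3) by (auto simp: gluing_def face_isometry_def bij_betw_def intro: inj_on_subset)
  then have "bij_betw (g \<circ> h) (sf l y) (sf l2 ((g \<circ> h) y))"
    using h(2) sf by (auto simp: gluing_def face_isometry_def intro: bij_betw_trans)
  then have "gluing X l (sf l y) l2 (sf l2 ((g \<circ> h) y)) (g \<circ> h)"
    unfolding gluing_def face_isometry_def
    using gluing_dist[OF g(1)] gluing_dist[OF h(2)] gluing_quot[OF g(1)] gluing_quot[OF h(2)] hF' by simp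
  moreover have "(g \<circ> h) y \<in> cube l2" using ghy smallest_face_subset_cube[OF y(3)] by auto
  moreover have "sf l2 ((g \<circ> h) y) \<subseteq> sf l2 y2" using smallest_face_mono[OF y(3) ghy] by simp
  moreover have "E l2 ((g \<circ> h) y) y2 \<le> r"
    using gluing_dist[OF g(1) hy in_smallest_face[OF y(2)]] g(2) h(4) by simp
  ultimately show ?thesis unfolding in_star_def by blast
qed

lemma in_star_move:
  assumes y: "y \<in> cube l" "y1 \<in> cube l1" "y2 \<in> cube l1" and room: "face_room (cdim X l) y \<delta>"
    and star: "in_star l y l1 y1 r" and \<delta>: "r + E l1 y1 y2 < \<delta>"
  shows "in_star l y l1 y2 (r + E l1 y1 y2)"
proof -
  obtain h where h: "h y \<in> cube l1" "gluing X l (sf l y) l1 (sf l1 (h y)) h"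
    "sf l1 (h y) \<subseteq> sf l1 y1" "E l1 (h y) y1 \<le> r" using star by (auto simp: in_star_def)
  have d: "E l1 (h y) y2 \<le> r + E l1 y1 y2"
    using euclid_dist_triangle[of "cdim X l1" "h y" y2 y1] h(4) by linarith
  have "face_room (cdim X l1) (h y) \<delta>"
    using face_room_isometry[OF gluing_isometry[OF h(2)] y(1) h(1) room] .
  then have "sf l1 (h y) \<subseteq> sf l1 y2" using smallest_face_near[OF h(1) y(3)] d \<delta> by auto
  then show ?thesis using h(1,2) d by (auto simp: in_star_def)
qed

lemma path_len_simps [simp]:
  "path_len X [] = 0" "path_len X ((l, x, y) # s) = E l x y + path_len X s"
  by (auto simp: path_len_def)

lemma path_len_nonneg: "0 \<le> path_len X s"
  by (induction s) auto

text \<open>A path too short to reach the boundary of the cell carrying \<open>y\<close> stays in the open star of this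
  cell, and its length bounds the Euclidean distance measured in the final cube. The copy of the cell
  is carried along the path, so nothing has to be said about how the cubes of the star fit together.\<close>

lemma path_in_star:
  assumes "segment_path X (quot X l1 y1) s b" "l1 \<in> cubes X" "y1 \<in> cube l1" "in_star l y l1 y1 r"
    and "r + path_len X s < \<delta>"
    and y: "y \<in> cube l" and room: "face_room (cdim X l) y \<delta>"
    and l': "l' \<in> cubes X" "y' \<in> cube l'" "quot X l' y' = b"
  shows "in_star l y l' y' (r + path_len X s)"
  using assms(1-5)
proof (induction s arbitrary: l1 y1 r)
  case Nil
  then show ?case using in_star_change_cube[of l1 l' y l y1 y' r] y l' by simp
next
  case (Cons e s)
  obtain l2 x2 y2 where e: "e = (l2, x2, y2)" by (cases e) auto
  have *: "l2 \<in> cubes X" "x2 \<in> cube l2" "y2 \<in> cube l2" "quot X l2 x2 = quot X l1 y1"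
    "segment_path X (quot X l2 y2) s b" using Cons.prems(1) e by auto
  have len: "r + E l2 x2 y2 + path_len X s < \<delta>" using Cons.prems(5) e by simp
  have "in_star l y l2 x2 r"
    using in_star_change_cube[of l1 l2 y l y1 x2 r] Cons.prems * y by simp
  then have "in_star l y l2 y2 (r + E l2 x2 y2)"
    using in_star_move[of y l x2 l2 y2 \<delta> r] * y room len path_len_nonneg[of s] by simp
  from Cons.IH[OF *(5) *(1) *(3) this len] show ?case using e by (simp add: add.assoc)
qed

lemma ext_cdist_eq:
  assumes "a \<in> space_of X" "b \<in> space_of X"
  shows "ext_cdist X a b = ennreal (cdist X a b)"
proof -
  have "ext_cdist X a b < top" using CAT0_X assms by (simp add: CAT0_cubed_complex_def)
  then show ?thesis by (simp add: cdist_def)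
qed

lemma cdist_le:
  assumes "l \<in> cubes X" "x \<in> cube l" "y \<in> cube l"
  shows "cdist X (quot X l x) (quot X l y) \<le> E l x y"
proof -
  have "segment_path X (quot X l x) [(l, x, y)] (quot X l y)" using assms by simp
  then have "ext_cdist X (quot X l x) (quot X l y) \<le> ennreal (path_len X [(l, x, y)])"
    unfolding ext_cdist_def by (intro INF_lower) simp
  then show ?thesis using ext_cdist_eq assms quot_in_space by simp
qed

lemma short_path:
  assumes "a \<in> space_of X" "b \<in> space_of X" "cdist X a b < r"
  obtains s where "segment_path X a s b" "path_len X s < r"
proof -
  have "ext_cdist X a b < ennreal r"
    using assms by (simp add: ext_cdist_eq ennreal_less_iff)
  then obtain s where "segment_path X a s b" "ennreal (path_len X s) < ennreal r"
    unfolding ext_cdist_def INF_less_iff by auto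
  then show thesis using that path_len_nonneg by (simp add: ennreal_less_iff)
qed

lemma near_in_star:
  assumes l: "l \<in> cubes X" "l' \<in> cubes X" and y: "y \<in> cube l" "y' \<in> cube l'"
    and room: "face_room (cdim X l) y \<delta>" and d: "cdist X (quot X l y) (quot X l' y') < r" "r \<le> \<delta>"
  shows "in_star l y l' y' r"
proof -
  obtain s where s: "segment_path X (quot X l y) s (quot X l' y')" "path_len X s < r"
    using short_path d(1) l y quot_in_space by metis
  have "in_star l y l' y' (0 + path_len X s)"
    by (rule path_in_star[OF s(1) l(1) y(1) in_star_refl[OF y(1)] _ y(1) room l(2) y(2) refl])
      (use s d in simp)
  then show ?thesis using s(2) by (fastforce simp: in_star_def)
qed

text \<open>A shorter path would end at \<open>y\<close> with a copy \<open>h x\<close> of \<open>x\<close> in the same cube, closer to \<open>y\<close> than \<open>x\<close>.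
  As \<open>h x\<close> is again interior and has the same image, it equals \<open>x\<close>.\<close>

lemma cdist_interior_near:
  assumes l: "l \<in> cubes X" and x: "x \<in> cube l" and y: "y \<in> cube l"
    and int: "sf l x = cube l" "sf l y = cube l"
    and room: "face_room (cdim X l) x \<delta>" "face_room (cdim X l) y \<delta>" and d: "E l x y < \<delta>"
  shows "cdist X (quot X l x) (quot X l y) = E l x y"
proof (rule ccontr)
  assume "cdist X (quot X l x) (quot X l y) \<noteq> E l x y"
  then have less: "cdist X (quot X l x) (quot X l y) < E l x y" using cdist_le[OF l x y] by simp
  then obtain r where r: "cdist X (quot X l x) (quot X l y) < r" "r < E l x y" using dense by blast
  have "in_star l x l y r" using near_in_star[OF l l x y room(1) r(1)] r d by simp
  then obtain h where h: "h x \<in> cube l" "gluing X l (sf l x) l (sf l (h x)) h" "E l (h x) y \<le> r"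
    by (auto simp: in_star_def)
  have "E l y (h x) < \<delta>" using h(3) r d by (simp add: euclid_dist_commute)
  then have "sf l (h x) = sf l x" using room(2) h(1) int by (simp add: face_room_def)
  moreover have "quot X l (h x) = quot X l x" using gluing_quot[OF h(2)] in_smallest_face[OF x] by simp
  ultimately have "h x = x" using quot_inj_interior[OF l h(1) x] by simp
  then show False using h(3) r by simp
qed

text \<open>The segment from \<open>x\<close> to \<open>y\<close> keeps a positive distance \<open>\<delta>\<close> from the boundary of the cube, so it is
  geodesic on pieces shorter than \<open>\<delta>\<close>.\<close>

lemma cdist_interior:
  assumes l: "l \<in> cubes X" and x: "x \<in> cube l" and y: "y \<in> cube l"
    and int: "\<And>i. i < cdim X l \<Longrightarrow> 0 < x i \<and> x i < 1" "\<And>i. i < cdim X l \<Longrightarrow> 0 < y i \<and> y i < 1"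
  shows "cdist X (quot X l x) (quot X l y) = E l x y"
proof (cases "x = y")
  case True then show ?thesis using l x quot_in_space by simp
next
  case False
  let ?n = "cdim X l"
  let ?S = "insert 1 ((\<lambda>i. min (min (x i) (1 - x i)) (min (y i) (1 - y i))) ` {..<?n})"
  define \<delta> where "\<delta> = Min ?S"
  have "\<delta> \<in> ?S" unfolding \<delta>_def by (rule Min_in) auto
  then have \<delta>: "0 < \<delta>" using int by auto
  have "\<delta> \<le> 1" by (simp add: \<delta>_def)
  have \<delta>i: "\<delta> \<le> min (min (x i) (1 - x i)) (min (y i) (1 - y i))" if "i < ?n" for i
    unfolding \<delta>_def using that by (intro Min_le) auto
  define D where "D = E l x y"
  have D: "0 < D" using euclid_dist_zero[OF x y] False euclid_dist_nonneg[of ?n x y]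
    unfolding D_def by linarith
  define c where "c s = lerp (s / D) x y" for s
  have room: "c s \<in> cube l" "sf l (c s) = cube l" "face_room ?n (c s) \<delta>" if s: "0 \<le> s" "s \<le> D" for s
  proof -
    define t where "t = s / D"
    have t: "0 \<le> t" "t \<le> 1" using s D by (auto simp: t_def)
    have cs: "c s = lerp t x y" by (simp add: c_def t_def)
    show cc: "c s \<in> cube l" unfolding cs using lerp_in_cube[OF x y t] .
    have "\<delta> \<le> c s i" "c s i \<le> 1 - \<delta>" if "i < ?n" for i
    proof -
      have i: "\<delta> \<le> x i" "\<delta> \<le> y i" "x i \<le> 1 - \<delta>" "y i \<le> 1 - \<delta>" using \<delta>i[OF that] by auto
      have "(1 - t) * \<delta> + t * \<delta> \<le> c s i" unfolding cs lerp_def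
        using i t by (intro add_mono mult_left_mono) auto
      then show "\<delta> \<le> c s i" by (simp add: algebra_simps)
      show "c s i \<le> 1 - \<delta>" unfolding cs lerp_def
        using convex_bound_le[OF i(3,4), of "1 - t" t] t by simp
    qed
    then have *: "\<delta> \<le> c s i" "\<delta> \<le> 1 - c s i" if "i < ?n" for i using that by fastforce+
    show "sf l (c s) = cube l"
    proof (rule smallest_face_interior[OF cc])
      fix i assume "i < ?n" then show "0 < c s i \<and> c s i < 1" using *[of i] \<delta> by linarith
    qed
    show "face_room ?n (c s) \<delta>" using * \<delta> \<open>\<delta> \<le> 1\<close> by (intro face_roomI[OF cc]) auto
  qed
  have E: "E l (c s) (c t) = t - s" if "s \<le> t" for s t
  proof -
    have "E l (c s) (c t) = \<bar>s / D - t / D\<bar> * D" unfolding c_def euclid_dist_lerp D_def ..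
    also have "\<bar>s / D - t / D\<bar> = (t - s) / D" using that D
      by (simp add: diff_divide_distrib[symmetric])
    finally show ?thesis using D by simp
  qed
  have "cdist X (quot X l (c 0)) (quot X l (c D)) = D"
  proof (rule local_geodesic_is_geodesic[OF _ \<delta>])
    fix s t assume st: "0 \<le> s" "s \<le> t" "t \<le> D" "t - s < \<delta>"
    then have s: "s \<le> D" and t: "0 \<le> t" by linarith+
    show "cdist X (quot X l (c s)) (quot X l (c t)) = t - s"
      using cdist_interior_near[OF l room(1)[OF st(1) s] room(1)[OF t st(3)]
          room(2)[OF st(1) s] room(2)[OF t st(3)] room(3)[OF st(1) s] room(3)[OF t st(3)]] E st by simp
  qed (use D room(1) quot_in_space l in auto)
  moreover have "c 0 = x" "c D = y" using D by (auto simp: c_def)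
  ultimately show ?thesis by (simp add: D_def)
qed

text \<open>For boundary points, move both points slightly towards the centre \<open>m\<close> of the cube.\<close>

theorem cube_isometric:
  assumes l: "l \<in> cubes X" and x: "x \<in> cube l" and y: "y \<in> cube l"
  shows "cdist X (quot X l x) (quot X l y) = E l x y"
proof (rule ccontr)
  assume "cdist X (quot X l x) (quot X l y) \<noteq> E l x y"
  then have less: "cdist X (quot X l x) (quot X l y) < E l x y" using cdist_le[OF l x y] by simp
  let ?n = "cdim X l"
  define m :: point where "m = (\<lambda>i. if i < ?n then 1/2 else 0)"
  have m: "m \<in> cube l" by (auto simp: m_def unit_cube_def)
  \<comment> \<open>Moving by the fraction \<open>t\<close> changes either distance by at most \<open>t * (E l x m + E l y m)\<close>, which is
    chosen to be less than half of the supposed gap; the other summands of \<open>K\<close> ensure \<open>t \<le> 1\<close>.\<close>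
  define K where "K = 1 + E l x m + E l y m + E l x y"
  define t where "t = (E l x y - cdist X (quot X l x) (quot X l y)) / (4 * K)"
  have K: "1 \<le> K" by (simp add: K_def)
  have "E l x y - cdist X (quot X l x) (quot X l y) \<le> 1 * (4 * K)"
    using K nonneg[of "quot X l x" "quot X l y"] euclid_dist_nonneg[of ?n x m] euclid_dist_nonneg[of ?n y m]
    unfolding K_def by (smt (verit))
  then have t: "0 < t" "t \<le> 1" using less K by (auto simp: t_def divide_le_eq)
  have tK: "4 * (t * K) = E l x y - cdist X (quot X l x) (quot X l y)" using K by (simp add: t_def)
  have int: "0 < lerp t z m i \<and> lerp t z m i < 1" if "z \<in> cube l" "i < ?n" for z i
  proof -
    have z: "0 \<le> z i" "z i \<le> 1" using unit_cube_coord[OF that(1), of i] by auto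
    have "lerp t z m i = z i + t * (1/2 - z i)" using that by (simp add: lerp_def m_def algebra_simps)
    moreover have "0 \<le> (1 - t) * z i" "(1 - t) * z i \<le> 1 - t" using z t
      by (auto intro: mult_left_le)
    ultimately show ?thesis using t by (auto simp: algebra_simps)
  qed
  define x' where "x' = lerp t x m"
  define y' where "y' = lerp t y m"
  have c: "x' \<in> cube l" "y' \<in> cube l" unfolding x'_def y'_def using lerp_in_cube x y m t by auto
  have eq: "cdist X (quot X l x') (quot X l y') = E l x' y'"
    using cdist_interior[OF l c] int[OF x] int[OF y] unfolding x'_def y'_def by blast
  have xx: "E l x x' = t * E l x m" and yy: "E l y y' = t * E l y m"
    using euclid_dist_lerp[of ?n 0 x m t] euclid_dist_lerp[of ?n 0 y m t] t by (auto simp: x'_def y'_def)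
  have "E l x y \<le> E l x x' + E l x' y' + E l y' y"
    using euclid_dist_triangle[of ?n x y x'] euclid_dist_triangle[of ?n x' y y'] by linarith
  moreover have "cdist X (quot X l x') (quot X l y') \<le>
      cdist X (quot X l x') (quot X l x) + cdist X (quot X l x) (quot X l y) + cdist X (quot X l y) (quot X l y')"
    using triangle[of "quot X l x'" "quot X l x" "quot X l y'"] triangle[of "quot X l x" "quot X l y" "quot X l y'"]
      quot_in_space[OF l] c x y by auto
  moreover have "cdist X (quot X l x') (quot X l x) \<le> E l x x'" "cdist X (quot X l y) (quot X l y') \<le> E l y y'"
    using cdist_le[OF l c(1) x] cdist_le[OF l y c(2)] by (auto simp: euclid_dist_commute)
  ultimately have "E l x y - cdist X (quot X l x) (quot X l y) \<le> 2 * (t * E l x m) + 2 * (t * E l y m)"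
    unfolding eq xx euclid_dist_commute[of ?n y' y] yy by linarith
  also have "\<dots> = 2 * (t * (E l x m + E l y m))" by (simp add: algebra_simps)
  also have "\<dots> < 4 * (t * K)"
  proof -
    have "t * (E l x m + E l y m) < t * K" using t(1) by (intro mult_strict_left_mono) (auto simp: K_def add_pos_nonneg)
    moreover have "0 \<le> t * K" using t K by simp
    ultimately show ?thesis by linarith
  qed
  finally show False using tK by simp
qed

lemma quot_inj:
  assumes "l \<in> cubes X" "x \<in> cube l" "y \<in> cube l" "quot X l x = quot X l y"
  shows "x = y"
  using cube_isometric[OF assms(1-3)] euclid_dist_zero[OF assms(2,3)] quot_in_space[OF assms(1,3)]
  by (simp add: assms(4))

section \<open>Carriers\<close>

text \<open>Every closed cell that contains \<open>a\<close> contains the image of the smallest face of a representative of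
  \<open>a\<close>, so the intersection is itself a closed cell (\<open>carrier_eq\<close>).\<close>

definition carrier :: "'a \<Rightarrow> 'a set" where
  "carrier a = \<Inter>{c \<in> closed_cells X. a \<in> c}"

lemma quot_smallest_face_subset:
  assumes "l \<in> cubes X" "l' \<in> cubes X" "x \<in> cube l" "face l' F" "x' \<in> F" "quot X l x = quot X l' x'"
  shows "quot X l ` sf l x \<subseteq> quot X l' ` F"
proof -
  have x': "x' \<in> cube l'" using face_subset_cube assms by blast
  obtain h where h: "gluing X l (sf l x) l' (sf l' x') h"
    using carrier_gluing[OF assms(1,2,3) x' assms(6)] by blast
  have "quot X l ` sf l x = quot X l' ` sf l' x'"
    using gluing_quot[OF h] unfolding gluing_image[OF h, symmetric] image_image by (auto intro!: image_cong)
  then show ?thesis using smallest_face_subset[OF assms(4,5)] by blast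
qed

lemma carrier_eq:
  assumes l: "l \<in> cubes X" and x: "x \<in> cube l"
  shows "carrier (quot X l x) = quot X l ` sf l x"
proof
  show "carrier (quot X l x) \<subseteq> quot X l ` sf l x"
    unfolding carrier_def closed_cells_def using l is_face_smallest_face[OF x] in_smallest_face[OF x] by blast
  show "quot X l ` sf l x \<subseteq> carrier (quot X l x)"
    unfolding carrier_def
  proof (rule Inter_greatest)
    fix c assume "c \<in> {c \<in> closed_cells X. quot X l x \<in> c}"
    then obtain l' F x' where "c = quot X l' ` F" "l' \<in> cubes X" "face l' F" "x' \<in> F" "quot X l x = quot X l' x'"
      by (auto simp: closed_cells_def)
    then show "quot X l ` sf l x \<subseteq> c" using quot_smallest_face_subset[OF l _ x] by blast
  qed
qed

text \<open>By \<open>path_in_star\<close> every point close to \<open>a\<close> lies in the open star of the carrier of \<open>a\<close>.\<close>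

lemma carrier_near:
  assumes a: "a \<in> space_of X"
  obtains \<delta> where "0 < \<delta>" "\<And>b. b \<in> space_of X \<Longrightarrow> cdist X a b < \<delta> \<Longrightarrow> carrier a \<subseteq> carrier b"
proof -
  obtain l x where x: "l \<in> cubes X" "x \<in> cube l" "a = quot X l x" using space_cases[OF a] .
  obtain \<delta> where \<delta>: "face_room (cdim X l) x \<delta>" using face_room_exists[OF x(2)] .
  have "carrier a \<subseteq> carrier b" if b: "b \<in> space_of X" "cdist X a b < \<delta>" for b
  proof -
    obtain l' y where y: "l' \<in> cubes X" "y \<in> cube l'" "b = quot X l' y" using space_cases[OF b(1)] .
    have "in_star l x l' y \<delta>" using near_in_star[OF x(1) y(1) x(2) y(2) \<delta>] b x y by simp
    then obtain h where h: "gluing X l (sf l x) l' (sf l' (h x)) h" "sf l' (h x) \<subseteq> sf l' y"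
      by (auto simp: in_star_def)
    have "quot X l ` sf l x \<subseteq> quot X l' ` sf l' (h x)"
      using gluing_quot[OF h(1)] unfolding gluing_image[OF h(1), symmetric] image_image by auto
    also have "\<dots> \<subseteq> quot X l' ` sf l' y" using h(2) by (rule image_mono)
    finally show ?thesis unfolding x(3) y(3) carrier_eq[OF x(1,2)] carrier_eq[OF y(1,2)] .
  qed
  moreover have "0 < \<delta>" using \<delta> by (simp add: face_room_def)
  ultimately show thesis using that by blast
qed

lemma subcomplex_carrier:
  assumes "subcomplex X W" "a \<in> W"
  shows "carrier a \<subseteq> W" "a \<in> space_of X"
proof -
  obtain C where C: "C \<subseteq> closed_cells X" "W = \<Union>C" using assms by (auto simp: subcomplex_def)
  then obtain c where c: "c \<in> C" "a \<in> c" using assms by blast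
  then show "carrier a \<subseteq> W" using C unfolding carrier_def by blast
  obtain l F where "c = quot X l ` F" "l \<in> cubes X" "face l F" using c C by (auto simp: closed_cells_def)
  then show "a \<in> space_of X" using c face_subset_cube quot_in_space by blast
qed

lemma in_carrier: "l \<in> cubes X \<Longrightarrow> x \<in> cube l \<Longrightarrow> quot X l x \<in> carrier (quot X l x)"
  using carrier_eq in_smallest_face by blast

lemma cube_of_face: "l \<in> cubes X \<Longrightarrow> face l {x} \<Longrightarrow> x \<in> cube l"
  using vertex_iff by blast

lemma carrier_self:
  assumes "a \<in> space_of X"
  shows "a \<in> carrier a"
proof -
  obtain l x where "l \<in> cubes X" "x \<in> cube l" "a = quot X l x" using space_cases[OF assms] .
  then show ?thesis using in_carrier by simp
qed

lemma subcomplex_closed: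
  assumes W: "subcomplex X W" and x: "x \<in> space_of X" "x \<notin> W"
  shows "\<exists>r>0. \<forall>w\<in>W. r \<le> cdist X x w"
proof -
  obtain \<delta> where \<delta>: "\<delta> > 0" "\<And>b. b \<in> space_of X \<Longrightarrow> cdist X x b < \<delta> \<Longrightarrow> carrier x \<subseteq> carrier b"
    using carrier_near[OF x(1)] by blast
  have "\<delta> \<le> cdist X x w" if w: "w \<in> W" for w
  proof (rule ccontr)
    assume "\<not> \<delta> \<le> cdist X x w"
    then have "carrier x \<subseteq> carrier w" using \<delta>(2)[of w] subcomplex_carrier[OF W w] by simp
    then show False using carrier_self[OF x(1)] subcomplex_carrier(1)[OF W w] x(2) by blast
  qed
  then show ?thesis using \<delta>(1) by blast
qed

lemma carrier_rep:
  assumes "l \<in> cubes X" "y \<in> cube l" "v \<in> carrier (quot X l y)"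
  obtains x where "x \<in> sf l y" "x \<in> cube l" "quot X l x = v"
  using assms carrier_eq[OF assms(1,2)] smallest_face_subset_cube[OF assms(2)] by auto

lemma vertex_rep:
  assumes v: "v \<in> vertices X" and l: "l \<in> cubes X" and x: "x \<in> cube l" "quot X l x = v"
  shows "face l {x}"
proof -
  obtain l0 x0 where x0: "l0 \<in> cubes X" "face l0 {x0}" "quot X l0 x0 = v" using v by (auto simp: vertices_def)
  have x0c: "x0 \<in> cube l0" using x0 cube_of_face by blast
  obtain h where h: "gluing X l0 (sf l0 x0) l (sf l x) h" "h x0 = x"
    using carrier_gluing[OF x0(1) l x0c x(1)] x0 x by metis
  have "sf l x = {x}" using gluing_image[OF h(1)] h(2) vertex_smallest_face[OF x0(2)] by simp
  then show ?thesis using is_face_smallest_face[OF x(1)] by simp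
qed

lemma geod_in_cube:
  assumes l: "l \<in> cubes X" and xy: "x \<in> cube l" "y \<in> cube l" and t: "0 \<le> t" "t \<le> 1"
  shows "geod (quot X l x) (quot X l y) t = quot X l (lerp t x y)"
proof (rule geod_eq)
  have m: "lerp t x y \<in> cube l" using lerp_in_cube xy t by blast
  have "E l x (lerp t x y) = t * E l x y" "E l (lerp t x y) y = (1 - t) * E l x y"
    using euclid_dist_lerp[of "cdim X l" 0 x y t] euclid_dist_lerp[of "cdim X l" t x y 1] t by auto
  then show "between t (quot X l x) (quot X l y) (quot X l (lerp t x y))"
    unfolding between_def using cube_isometric[OF l] m xy quot_in_space[OF l m] by simp
qed (use assms quot_in_space in auto)

section \<open>Link coordinates along geodesics\<close>

text \<open>For adjacent vertices \<open>v\<close> and \<open>u\<close> and a point \<open>w\<close> of the open star of \<open>v\<close>, the coordinate of \<open>w\<close>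
  along the edge from \<open>v\<close> to \<open>u\<close> in any cube containing them (\<open>height_coord\<close>), written without
  reference to a cube. Where \<open>u\<close> is not in the carrier the formula may be negative, and the coordinate
  is zero instead.\<close>

definition height :: "'a \<Rightarrow> 'a \<Rightarrow> 'a \<Rightarrow> real" where
  "height v u w = (if u \<in> carrier w then ((cdist X v w)\<^sup>2 + 1 - (cdist X u w)\<^sup>2) / 2 else 0)"

lemma distances_coord:
  assumes l: "l \<in> cubes X" and x: "face l {x}" and i: "i < cdim X l" and y: "y \<in> cube l"
  shows "((cdist X (quot X l x) (quot X l y))\<^sup>2 + 1 - (cdist X (quot X l (opposite x i)) (quot X l y))\<^sup>2) / 2
    = \<bar>y i - x i\<bar>"
proof -
  have "x \<in> cube l" "opposite x i \<in> cube l" using x vertex_iff opposite_in_cube[OF _ i] by auto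
  then show ?thesis using coordinate_from_distances[OF x i y] cube_isometric[OF l _ y] by simp
qed

lemma opposite_in_carrier:
  assumes l: "l \<in> cubes X" and x: "face l {x}" and i: "i < cdim X l" and y: "y \<in> cube l" and xs: "x \<in> sf l y"
  shows "quot X l (opposite x i) \<in> carrier (quot X l y) \<longleftrightarrow> y i \<noteq> x i"
proof -
  have o: "opposite x i \<in> cube l" using x vertex_iff opposite_in_cube[OF _ i] by auto
  have "quot X l (opposite x i) \<in> quot X l ` sf l y \<longleftrightarrow> opposite x i \<in> sf l y"
    using quot_inj[OF l o] smallest_face_subset_cube[OF y] by blast
  then show ?thesis using carrier_eq[OF l y] opposite_in_smallest_face[OF x y i xs] by simp
qed

lemma height_coord:
  assumes "l \<in> cubes X" "face l {x}" "i < cdim X l" "y \<in> cube l" "x \<in> sf l y"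
  shows "height (quot X l x) (quot X l (opposite x i)) (quot X l y) = \<bar>y i - x i\<bar>"
  unfolding height_def using opposite_in_carrier[OF assms] distances_coord[OF assms(1-4)] by simp

text \<open>In each cube whose cell carries \<open>v\<close> and \<open>u\<close> the pair spans an edge, because their distance in the
  cube is their distance in \<open>X\<close>, which is \<open>1\<close>.\<close>

lemma adjacent_rep:
  assumes v: "v \<in> vertices X" "u \<in> vertices X" "cdist X v u = 1"
    and l: "l \<in> cubes X" and y: "y \<in> cube l" and vu: "v \<in> carrier (quot X l y)" "u \<in> carrier (quot X l y)"
  obtains x i where "face l {x}" "x \<in> sf l y" "quot X l x = v" "i < cdim X l" "quot X l (opposite x i) = u"
proof -
  obtain x where x: "x \<in> sf l y" "x \<in> cube l" "quot X l x = v" using carrier_rep[OF l y vu(1)] .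
  obtain x' where x': "x' \<in> sf l y" "x' \<in> cube l" "quot X l x' = u" using carrier_rep[OF l y vu(2)] .
  have f: "face l {x}" "face l {x'}" using vertex_rep v l x x' by blast+
  have "E l x x' = 1" using cube_isometric[OF l x(2) x'(2)] x x' v by simp
  then obtain i where "i < cdim X l" "x' = opposite x i" using adjacent_vertices[OF f] by blast
  then show thesis using that[OF f(1) x(1) x(3)] x'(3) by simp
qed

context
  fixes v u
  assumes v: "v \<in> vertices X" and u: "u \<in> vertices X" and vu: "cdist X v u = 1"
begin

text \<open>Both points lie in a cube that carries \<open>w'\<close>; if it contains \<open>u\<close>, both heights are coordinates there.\<close>

lemma height_lipschitz_near:
  assumes w: "w \<in> space_of X" "w' \<in> space_of X" and c: "carrier w \<subseteq> carrier w'" and vw: "v \<in> carrier w"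
  shows "\<bar>height v u w' - height v u w\<bar> \<le> cdist X w w'"
proof (cases "u \<in> carrier w'")
  case False
  then have "u \<notin> carrier w" using c by blast
  then show ?thesis using False by (simp add: height_def)
next
  case True
  obtain l y' where y': "l \<in> cubes X" "y' \<in> cube l" "w' = quot X l y'" using space_cases[OF w(2)] .
  have "v \<in> carrier w'" using c vw by blast
  then obtain x i where x: "face l {x}" "x \<in> sf l y'" "quot X l x = v" "i < cdim X l" "quot X l (opposite x i) = u"
    using adjacent_rep[OF v u vu y'(1,2)] True y'(3) by metis
  have "w \<in> carrier w'" using carrier_self[OF w(1)] c by blast
  then obtain y where y: "y \<in> sf l y'" "y \<in> cube l" "quot X l y = w"
    using carrier_rep[OF y'(1,2)] y'(3) by metis
  obtain x2 where x2: "x2 \<in> sf l y" "x2 \<in> cube l" "quot X l x2 = v"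
    using carrier_rep[OF y'(1) y(2)] vw y(3) by metis
  have xc: "x \<in> cube l" using cube_of_face y'(1) x(1) by blast
  have "x2 = x" using quot_inj[OF y'(1) x2(2) xc] x x2 by simp
  then have xs: "x \<in> sf l y" using x2 by simp
  have "height v u w = \<bar>y i - x i\<bar>" "height v u w' = \<bar>y' i - x i\<bar>"
    using height_coord[OF y'(1) x(1) x(4) y(2) xs] height_coord[OF y'(1) x(1) x(4) y'(2) x(2)] x y y' by auto
  then have "\<bar>height v u w' - height v u w\<bar> \<le> \<bar>y i - y' i\<bar>" by linarith
  also have "\<dots> \<le> E l y y'" using coord_le_euclid_dist[OF x(4)] .
  finally show ?thesis using cube_isometric[OF y'(1) y(2) y'(2)] y y' by simp
qed

text \<open>The foot of \<open>w\<close> on the face of height zero. The last two properties determine it in every cube that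
  contains \<open>w\<close>, \<open>v\<close> and \<open>u\<close>.\<close>

lemma foot_exists:
  assumes w: "w \<in> space_of X" and vw: "v \<in> carrier w" and uw: "u \<in> carrier w"
  obtains f where "f \<in> carrier w" "f \<in> space_of X" "cdist X w f = height v u w"
    "(cdist X v f)\<^sup>2 + 1 = (cdist X u f)\<^sup>2"
proof -
  obtain l y where y: "l \<in> cubes X" "y \<in> cube l" "w = quot X l y" using space_cases[OF w] .
  obtain x i where x: "face l {x}" "x \<in> sf l y" "quot X l x = v" "i < cdim X l" "quot X l (opposite x i) = u"
    using adjacent_rep[OF v u vu y(1,2)] vw uw y(3) by metis
  have xi: "x i = 0 \<or> x i = 1" using x vertex_iff by blast
  let ?f = "y(i := x i)"
  have yi: "y i \<noteq> x i" using opposite_in_carrier[OF y(1) x(1) x(4) y(2) x(2)] x(5) y(3) uw by simp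
  have fc: "?f \<in> cube l" using y(2) x(4) xi by (auto simp: unit_cube_def)
  have "\<not> (y i = 0 \<or> y i = 1)" using yi x(2,4) unfolding smallest_face_eq[OF y(2)] by auto
  then have fs: "?f \<in> sf l y" unfolding smallest_face_eq[OF y(2)] using fc by auto
  have "(E l ?f y)\<^sup>2 = \<bar>y i - x i\<bar>\<^sup>2"
    using euclid_dist_upd[OF x(4), of y "x i" y] by (simp add: power2_commute)
  then have "E l ?f y = \<bar>y i - x i\<bar>" by (rule power2_eq_imp_eq) simp_all
  then have "E l y ?f = height v u w"
    using height_coord[OF y(1) x(1) x(4) y(2) x(2)] x y euclid_dist_commute by simp
  then have 1: "cdist X w (quot X l ?f) = height v u w" using cube_isometric[OF y(1) y(2) fc] y(3) by simp
  have 2: "(cdist X v (quot X l ?f))\<^sup>2 + 1 = (cdist X u (quot X l ?f))\<^sup>2"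
    using distances_coord[OF y(1) x(1) x(4) fc] x by simp
  have 3: "quot X l ?f \<in> carrier w" using carrier_eq[OF y(1,2)] fs y(3) by simp
  show thesis using that[OF 3 _ 1 2] quot_in_space[OF y(1) fc] by simp
qed

text \<open>In a cube containing \<open>w\<close> and \<open>w'\<close> the segment from \<open>w\<close> to its foot \<open>f\<close> is parallel to the edge from
  \<open>v\<close> to \<open>u\<close>, so the law of cosines involves only the heights. That \<open>f\<close> has this position in the
  cube follows from its distances: its coordinate along the edge is zero, and its distance from \<open>w\<close>
  is already used up by this coordinate.\<close>

lemma foot_distance:
  assumes w: "w \<in> space_of X" "w' \<in> space_of X" and c: "carrier w \<subseteq> carrier w'"
    and vw: "v \<in> carrier w" and uw: "u \<in> carrier w"
    and f: "f \<in> carrier w" "cdist X w f = height v u w" "(cdist X v f)\<^sup>2 + 1 = (cdist X u f)\<^sup>2"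
  shows "(cdist X w' f)\<^sup>2 = (cdist X w' w)\<^sup>2 + 2 * height v u w * height v u w' - (height v u w)\<^sup>2"
proof -
  obtain l y' where y': "l \<in> cubes X" "y' \<in> cube l" "w' = quot X l y'" using space_cases[OF w(2)] .
  have "v \<in> carrier w'" "u \<in> carrier w'" using c vw uw by auto
  then obtain x i where x: "face l {x}" "x \<in> sf l y'" "quot X l x = v" "i < cdim X l" "quot X l (opposite x i) = u"
    using adjacent_rep[OF v u vu y'(1,2)] y'(3) by metis
  have xi: "x i = 0 \<or> x i = 1" using x vertex_iff by blast
  have "w \<in> carrier w'" using carrier_self[OF w(1)] c by blast
  then obtain y where y: "y \<in> sf l y'" "y \<in> cube l" "quot X l y = w"
    using carrier_rep[OF y'(1,2)] y'(3) by metis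
  have "f \<in> carrier w'" using f c by blast
  then obtain z where z: "z \<in> sf l y'" "z \<in> cube l" "quot X l z = f"
    using carrier_rep[OF y'(1,2)] y'(3) by metis
  obtain x2 where x2: "x2 \<in> sf l y" "x2 \<in> cube l" "quot X l x2 = v"
    using carrier_rep[OF y'(1) y(2)] vw y(3) by metis
  have xc: "x \<in> cube l" using cube_of_face y'(1) x(1) by blast
  have "x2 = x" using quot_inj[OF y'(1) x2(2) xc] x x2 by simp
  then have xs: "x \<in> sf l y" using x2 by simp
  have hw: "height v u w = \<bar>y i - x i\<bar>" and hw': "height v u w' = \<bar>y' i - x i\<bar>"
    using height_coord[OF y'(1) x(1) x(4) y(2) xs] height_coord[OF y'(1) x(1) x(4) y'(2) x(2)] x y y' by auto
  have zi: "z i = x i" using distances_coord[OF y'(1) x(1) x(4) z(2)] x z f(3) by simp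
  have yz: "E l y z = \<bar>y i - x i\<bar>" using cube_isometric[OF y'(1) y(2) z(2)] f(2) hw y z by simp
  have "(\<Sum>j\<in>{..<cdim X l} - {i}. (y j - z j)\<^sup>2) = 0"
    using euclid_dist_sq[of "cdim X l" y z] sum.remove[of "{..<cdim X l}" i "\<lambda>j. (y j - z j)\<^sup>2"] x(4) zi yz by simp
  then have "\<forall>j\<in>{..<cdim X l} - {i}. (y j - z j)\<^sup>2 = 0" by (subst (asm) sum_nonneg_eq_0_iff) auto
  then have yj: "z j = y j" if "j < cdim X l" "j \<noteq> i" for j using that by simp
  have "z = y(i := x i)"
  proof (rule unit_cube_eqI[OF z(2)])
    show "y(i := x i) \<in> cube l" using y(2) x(4) xi by (auto simp: unit_cube_def)
    fix j assume "j < cdim X l" then show "z j = (y(i := x i)) j" using yj zi by simp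
  qed
  then have "(E l z y')\<^sup>2 = (E l y y')\<^sup>2 - (y i - y' i)\<^sup>2 + (x i - y' i)\<^sup>2"
    using euclid_dist_upd[OF x(4), of y "x i" y'] by simp
  also have "\<dots> = (E l y y')\<^sup>2 + 2 * \<bar>y i - x i\<bar> * \<bar>y' i - x i\<bar> - \<bar>y i - x i\<bar>\<^sup>2"
  proof -
    have "\<bar>y i - x i\<bar> * \<bar>y' i - x i\<bar> = (y i - x i) * (y' i - x i)"
      using xi unit_cube_coord[OF y(2), of i] unit_cube_coord[OF y'(2), of i] by (auto simp: algebra_simps)
    then show ?thesis by (simp add: power2_eq_square algebra_simps)
  qed
  finally have "(E l y' z)\<^sup>2 = (E l y' y)\<^sup>2 + 2 * height v u w * height v u w' - (height v u w)\<^sup>2"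
    unfolding hw hw' by (simp add: euclid_dist_commute)
  moreover have "cdist X w' f = E l y' z" "cdist X w' w = E l y' y"
    using cube_isometric[OF y'(1) y'(2) z(2)] cube_isometric[OF y'(1) y'(2) y(2)]
    unfolding y(3) z(3) y'(3)[symmetric] .
  ultimately show ?thesis by simp
qed

text \<open>The height is continuous along the geodesic and zero at its ends. Where it is positive, let \<open>f s\<close> be
  its value at parameter \<open>s\<close>. Stewart's inequality for the foot of the point at \<open>s\<close>, with the
  distances from \<open>foot_distance\<close>, reads \<open>f s * (2 * f s) \<le> f s * (f (s - h) + f (s + h))\<close>. So the
  height is midpoint convex there and \<open>midpoint_convex_vanishes\<close> applies.\<close>

lemma height_vanishes_on_geodesic:
  assumes ab: "a \<in> space_of X" "b \<in> space_of X"
    and star: "\<And>t. 0 \<le> t \<Longrightarrow> t \<le> 1 \<Longrightarrow> v \<in> carrier (geod a b t)"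
    and ends: "u \<notin> carrier a" "u \<notin> carrier b" and t: "0 \<le> t" "t \<le> 1"
  shows "u \<notin> carrier (geod a b t)"
proof
  assume ut: "u \<in> carrier (geod a b t)"
  define D where "D = cdist X a b"
  have D: "0 \<le> D" by (simp add: D_def)
  have pM: "geod a b s \<in> space_of X" if "0 \<le> s" "s \<le> 1" for s using geod_in ab that by blast
  have pd: "cdist X (geod a b s) (geod a b r) = \<bar>s - r\<bar> * D" if "0 \<le> s" "s \<le> 1" "0 \<le> r" "r \<le> 1" for s r
    using geod_dist[OF ab, of s r] geod_dist[OF ab, of r s] that commute[of "geod a b s" "geod a b r"]
    unfolding D_def by (cases "s \<le> r") auto
  have near: "\<exists>\<delta>>0. \<forall>r. 0 \<le> r \<and> r \<le> 1 \<and> \<bar>s - r\<bar> < \<delta> \<longrightarrow> carrier (geod a b s) \<subseteq> carrier (geod a b r)"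
    if s: "0 \<le> s" "s \<le> 1" for s
  proof -
    obtain \<delta> where \<delta>: "\<delta> > 0" "\<And>b'. b' \<in> space_of X \<Longrightarrow> cdist X (geod a b s) b' < \<delta> \<Longrightarrow> carrier (geod a b s) \<subseteq> carrier b'"
      using carrier_near[OF pM[OF s]] by blast
    have "carrier (geod a b s) \<subseteq> carrier (geod a b r)" if r: "0 \<le> r" "r \<le> 1" "\<bar>s - r\<bar> < \<delta> / (1 + D)" for r
    proof (rule \<delta>(2)[OF pM[OF r(1,2)]])
      have "\<bar>s - r\<bar> * D \<le> \<bar>s - r\<bar> * (1 + D)" by (intro mult_left_mono) auto
      also have "\<dots> < \<delta>" using r(3) D by (simp add: pos_less_divide_eq)
      finally show "cdist X (geod a b s) (geod a b r) < \<delta>" using pd s r by simp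
    qed
    then show ?thesis using \<delta>(1) D by (intro exI[of _ "\<delta> / (1 + D)"]) auto
  qed
  define f where "f s = height v u (geod a b s)" for s
  have lip: "\<exists>\<delta>>0. \<forall>r. 0 \<le> r \<and> r \<le> 1 \<and> \<bar>s - r\<bar> < \<delta> \<longrightarrow> \<bar>f r - f s\<bar> \<le> \<bar>s - r\<bar> * D" if s: "0 \<le> s" "s \<le> 1" for s
  proof -
    obtain \<delta> where \<delta>: "\<delta> > 0" "\<And>r. 0 \<le> r \<Longrightarrow> r \<le> 1 \<Longrightarrow> \<bar>s - r\<bar> < \<delta> \<Longrightarrow> carrier (geod a b s) \<subseteq> carrier (geod a b r)"
      using near[OF s] by blast
    have "\<bar>f r - f s\<bar> \<le> \<bar>s - r\<bar> * D" if r: "0 \<le> r" "r \<le> 1" "\<bar>s - r\<bar> < \<delta>" for r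
      using height_lipschitz_near[OF pM[OF s] pM[OF r(1,2)] \<delta>(2)[OF r] star[OF s]] pd[OF s r(1,2)]
      by (simp add: f_def)
    then show ?thesis using \<delta>(1) by blast
  qed
  have "f t \<le> 0"
  proof (rule midpoint_convex_vanishes[OF _ _ _ _ t])
    show "f 0 = 0" using geod_eq[of a b 0 a] ab ends by (simp add: f_def height_def)
    show "f 1 = 0" using geod_eq[of a b 1 b] ab ends by (simp add: f_def height_def)
    show "continuous_on {0..1} f"
      unfolding continuous_on_iff
    proof (intro ballI allI impI)
      fix s e :: real assume s: "s \<in> {0..1}" and e: "0 < e"
      obtain \<delta> where \<delta>: "\<delta> > 0" "\<And>r. 0 \<le> r \<Longrightarrow> r \<le> 1 \<Longrightarrow> \<bar>s - r\<bar> < \<delta> \<Longrightarrow> \<bar>f r - f s\<bar> \<le> \<bar>s - r\<bar> * D"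
        using lip[of s] s by auto
      have "dist (f r) (f s) < e" if r: "r \<in> {0..1}" "dist r s < min \<delta> (e / (1 + D))" for r
      proof -
        have rs: "\<bar>s - r\<bar> < \<delta>" "\<bar>s - r\<bar> < e / (1 + D)" using r(2) by (auto simp: dist_real_def)
        have "dist (f r) (f s) \<le> \<bar>s - r\<bar> * D" using \<delta>(2)[of r] r(1) rs(1) by (simp add: dist_real_def)
        also have "\<dots> \<le> \<bar>s - r\<bar> * (1 + D)" by (intro mult_left_mono) auto
        also have "\<dots> < e" using rs(2) D by (simp add: pos_less_divide_eq)
        finally show ?thesis .
      qed
      then show "\<exists>\<delta>>0. \<forall>r\<in>{0..1}. dist r s < \<delta> \<longrightarrow> dist (f r) (f s) < e"
        using e D \<delta>(1) by (intro exI[of _ "min \<delta> (e / (1 + D))"]) auto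
    qed
    fix s :: real assume s: "0 < s" "s < 1" and fs: "0 < f s"
    then have s': "0 \<le> s" "s \<le> 1" by auto
    have us: "u \<in> carrier (geod a b s)" using fs by (auto simp: f_def height_def split: if_splits)
    obtain \<delta> where \<delta>: "\<delta> > 0" "\<And>r. 0 \<le> r \<Longrightarrow> r \<le> 1 \<Longrightarrow> \<bar>s - r\<bar> < \<delta> \<Longrightarrow> carrier (geod a b s) \<subseteq> carrier (geod a b r)"
      using near[OF s'] by blast
    define h where "h = min (min s (1 - s)) (\<delta> / 2)"
    have h: "0 < h" "h \<le> s" "s + h \<le> 1" "h < \<delta>" using s \<delta>(1) by (auto simp: h_def min_def)
    have h1: "0 \<le> s - h" "s - h \<le> 1" and h2: "0 \<le> s + h" "s + h \<le> 1" using h s by auto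
    let ?w = "geod a b s" and ?p = "geod a b (s - h)" and ?q = "geod a b (s + h)"
    have M: "?w \<in> space_of X" "?p \<in> space_of X" "?q \<in> space_of X" using pM s' h1 h2 by auto
    obtain ft where ft: "ft \<in> carrier ?w" "ft \<in> space_of X" "cdist X ?w ft = height v u ?w"
        "(cdist X v ft)\<^sup>2 + 1 = (cdist X u ft)\<^sup>2"
      using foot_exists[OF M(1) star[OF s'] us] .
    have cp: "carrier ?w \<subseteq> carrier ?p" and cq: "carrier ?w \<subseteq> carrier ?q"
      using \<delta>(2)[OF h1] \<delta>(2)[OF h2] h by auto
    have pw: "cdist X ?p ?w = h * D" and wq: "cdist X ?w ?q = h * D" and pq: "cdist X ?p ?q = 2 * (h * D)"
      using pd[OF h1 s'] pd[OF s' h2] pd[OF h1 h2] h(1) by auto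
    have qw: "cdist X ?q ?w = h * D" using wq commute by simp
    have "between (1/2) ?p ?q ?w" unfolding between_def pw wq pq using M by simp
    from stewart[OF M(2,3) ft(2) _ _ this]
    have "(cdist X ?w ft)\<^sup>2 \<le> (cdist X ?p ft)\<^sup>2 / 2 + (cdist X ?q ft)\<^sup>2 / 2 - (h * D)\<^sup>2"
      unfolding pq by (simp add: power2_eq_square)
    then have "(f s)\<^sup>2 \<le> ((h * D)\<^sup>2 + 2 * f s * f (s - h) - (f s)\<^sup>2) / 2
        + ((h * D)\<^sup>2 + 2 * f s * f (s + h) - (f s)\<^sup>2) / 2 - (h * D)\<^sup>2"
      unfolding foot_distance[OF M(1,2) cp star[OF s'] us ft(1,3,4)]
        foot_distance[OF M(1,3) cq star[OF s'] us ft(1,3,4)] ft(3) pw qw f_def .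
    then have "f s * (2 * f s) \<le> f s * (f (s - h) + f (s + h))"
      by (simp add: power2_eq_square field_simps)
    then have "2 * f s \<le> f (s - h) + f (s + h)" using fs by simp
    then show "\<exists>h>0. h \<le> s \<and> s + h \<le> 1 \<and> f s \<le> (f (s - h) + f (s + h)) / 2"
      using h by (intro exI[of _ h]) auto
  qed
  obtain l y where y: "l \<in> cubes X" "y \<in> cube l" "geod a b t = quot X l y" using space_cases[OF pM[OF t]] .
  obtain x i where x: "face l {x}" "x \<in> sf l y" "quot X l x = v" "i < cdim X l" "quot X l (opposite x i) = u"
    using adjacent_rep[OF v u vu y(1,2)] star[OF t] ut y(3) by metis
  have "f t = \<bar>y i - x i\<bar>" using height_coord[OF y(1) x(1,4) y(2) x(2)] x y by (simp add: f_def)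
  moreover have "y i \<noteq> x i" using opposite_in_carrier[OF y(1) x(1,4) y(2) x(2)] x y ut by simp
  ultimately show False using \<open>f t \<le> 0\<close> by simp
qed

end

section \<open>Links\<close>

text \<open>An invariant of points of the link: equal link points have rays with the same image near the vertex.
  It is an equivalence relation, so it passes from single gluings to the generated equivalence.\<close>

definition same_germ :: "'l \<times> point \<times> point \<Rightarrow> 'l \<times> point \<times> point \<Rightarrow> bool" where
  "same_germ = (\<lambda>(l, x, u) (l', x', u').
     \<exists>s>0. \<forall>t. 0 \<le> t \<and> t \<le> s \<longrightarrow> quot X l (ray x u t) = quot X l' (ray x' u' t))"

lemma same_germ_sym: "same_germ q q' \<Longrightarrow> same_germ q' q"
  by (auto simp: same_germ_def)

lemma same_germ_trans:
  assumes "same_germ q q'" "same_germ q' q''"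
  shows "same_germ q q''"
proof -
  obtain l x u l' x' u' l'' x'' u'' where q: "q = (l, x, u)" "q' = (l', x', u')" "q'' = (l'', x'', u'')"
    by (metis prod_cases3)
  obtain s where s: "s > 0" "\<And>t. 0 \<le> t \<and> t \<le> s \<Longrightarrow> quot X l (ray x u t) = quot X l' (ray x' u' t)"
    using assms(1) by (auto simp: same_germ_def q)
  obtain s' where s': "s' > 0" "\<And>t. 0 \<le> t \<and> t \<le> s' \<Longrightarrow> quot X l' (ray x' u' t) = quot X l'' (ray x'' u'' t)"
    using assms(2) by (auto simp: same_germ_def q)
  have "quot X l (ray x u t) = quot X l'' (ray x'' u'' t)" if "0 \<le> t \<and> t \<le> min s s'" for t
    using s(2)[of t] s'(2)[of t] that by simp
  then show ?thesis using s(1) s'(1) by (auto simp: same_germ_def q intro!: exI[of _ "min s s'"])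
qed

lemma glued_same_germ:
  assumes "glued_directions X q q'"
  shows "same_germ q q'"
proof -
  obtain l x u l' x' u' where q: "q = (l, x, u)" "q' = (l', x', u')" by (metis prod_cases3)
  obtain F F' h s where F: "face l F" "face l' F'" and h: "gluing X l F l' F' h"
    and x: "x \<in> F" "h x = x'" and s: "s > 0" "ray x u s \<in> F" "h (ray x u s) = ray x' u' s"
    using assms unfolding glued_directions_def q by auto
  have "quot X l (ray x u t) = quot X l' (ray x' u' t)" if t: "0 \<le> t" "t \<le> s" for t
  proof -
    have ts: "0 \<le> t / s" "t / s \<le> 1" using t s(1) by auto
    have e: "ray x u t = lerp (t / s) x (ray x u s)" "ray x' u' t = lerp (t / s) x' (ray x' u' s)"
      by (rule ray_lerp[OF s(1)])+
    have "ray x u t \<in> F" unfolding e(1) by (rule face_lerp[OF F(1) x(1) s(2) ts])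
    moreover have "h (ray x u t) = ray x' u' t"
      using face_isometry_lerp[OF gluing_isometry[OF h] F x(1) s(2) ts] unfolding e x(2) s(3) .
    ultimately show ?thesis using gluing_quot[OF h] by metis
  qed
  then show ?thesis using s(1) unfolding same_germ_def q by auto
qed

lemma same_germ_refl: "same_germ q q"
  by (cases q) (auto simp: same_germ_def intro!: exI[of _ 1])

lemma link_point_same_germ:
  assumes "link_point X q = link_point X q'"
  shows "same_germ q q'"
proof -
  have "q' \<in> link_point X q'" by (simp add: link_point_def)
  then have "q' \<in> link_point X q" unfolding assms .
  then have "equivclp (glued_directions X) q q'" by (simp add: link_point_def)
  then show ?thesis
  proof (induction rule: equivclp_induct)
    case base
    show ?case by (rule same_germ_refl)
  next
    case (step y z)
    then show ?case using glued_same_germ same_germ_sym same_germ_trans by blast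
  qed
qed

text \<open>A time \<open>t\<close> at which both rays are inside their faces and agree, and a later time \<open>s\<close> up to which
  they stay in the faces, as \<open>ray_smallest_face\<close> requires.\<close>

lemma same_germ_ray:
  assumes germ: "same_germ (l, x, u) (l', x', u')"
    and F: "face l F" "x \<in> F" "u \<in> directions (cdim X l) F x"
    and F': "face l' F'" "x' \<in> F'" "u' \<in> directions (cdim X l') F' x'"
  obtains s t where "0 < t" "t < s" "ray x u s \<in> F" "ray x' u' s \<in> F'" "ray x u t \<in> F" "ray x' u' t \<in> F'"
    "quot X l (ray x u t) = quot X l' (ray x' u' t)"
proof -
  obtain s0 where s0: "s0 > 0" "\<And>t. 0 \<le> t \<and> t \<le> s0 \<Longrightarrow> quot X l (ray x u t) = quot X l' (ray x' u' t)"
    using germ by (auto simp: same_germ_def)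
  obtain s1 where s1: "s1 > 0" "ray x u s1 \<in> F" using F(3) by (auto simp: directions_def)
  obtain s2 where s2: "s2 > 0" "ray x' u' s2 \<in> F'" using F'(3) by (auto simp: directions_def)
  have in_F: "ray x u t \<in> F" if "0 \<le> t" "t \<le> s1" for t
    using face_lerp[OF F(1,2) s1(2), of "t / s1"] that s1(1) ray_lerp[OF s1(1), where x = x and u = u and t = t] by simp
  have in_F': "ray x' u' t \<in> F'" if "0 \<le> t" "t \<le> s2" for t
    using face_lerp[OF F'(1,2) s2(2), of "t / s2"] that s2(1) ray_lerp[OF s2(1), where x = x' and u = u' and t = t] by simp
  define s where "s = min s0 (min s1 s2)"
  have s: "0 < s" "s \<le> s0" "s \<le> s1" "s \<le> s2" using s0(1) s1(1) s2(1) by (auto simp: s_def)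
  show thesis
    using that[of "s / 2" s] in_F[of s] in_F'[of s] in_F[of "s / 2"] in_F'[of "s / 2"] s0(2)[of "s / 2"] s by simp
qed

text \<open>The germ of the edge agrees with the germ of a segment in \<open>W\<close>, so an interior point of the edge is
  in \<open>W\<close>, and with it its carrier, the whole edge.\<close>

lemma edge_image_in_subcomplex:
  assumes W: "subcomplex X W" and l: "l \<in> cubes X" and x: "face l {x}" and i: "i < cdim X l"
    and q: "{link_point X (l, x, edge_dir x i)} \<in> Lk X v W"
  shows "quot X l ` edge_face (cdim X l) x i \<subseteq> W"
proof -
  obtain l' x' F' where l': "l' \<in> cubes X" "face l' {x'}" "face l' F'" "x' \<in> F'" "F' \<noteq> {x'}" "quot X l' ` F' \<subseteq> W"
    and e: "{link_point X (l, x, edge_dir x i)} = link_point X ` {(l', x', u) |u. u \<in> directions (cdim X l') F' x'}"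
    using q by (auto simp: Lk_def)
  obtain i' where i': "i' < cdim X l'" "edge_face (cdim X l') x' i' \<subseteq> F'"
    using face_has_edge[OF l'(3,4,5)] .
  let ?u = "edge_dir x' i'"
  have u: "?u \<in> directions (cdim X l') F' x'"
    using directions_mono[OF i'(2)] directions_edge_face[OF l'(2) i'(1)] by blast
  have "link_point X (l', x', ?u) \<in> {link_point X (l, x, edge_dir x i)}" unfolding e using u by blast
  then have "same_germ (l, x, edge_dir x i) (l', x', ?u)" using link_point_same_germ by simp
  moreover have u0: "edge_dir x i \<in> directions (cdim X l) (edge_face (cdim X l) x i) x"
    using directions_edge_face[OF x i] by blast
  ultimately obtain s t where t: "0 < t" "t < s" "ray x (edge_dir x i) s \<in> edge_face (cdim X l) x i"
      "ray x' ?u t \<in> F'" "quot X l (ray x (edge_dir x i) t) = quot X l' (ray x' ?u t)"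
    using same_germ_ray[OF _ edge_face_is_face[OF x i] in_edge_face[OF x i] u0 l'(3,4) u] by blast
  let ?y = "ray x (edge_dir x i) t"
  have sc: "ray x (edge_dir x i) s \<in> cube l" using t(3) by (simp add: edge_face_def)
  have yc: "?y \<in> cube l" and sf: "sf l ?y = {z \<in> cube l. \<forall>j<cdim X l. edge_dir x i j = 0 \<longrightarrow> z j = x j}"
    using ray_smallest_face[OF x sc t(1,2)] by auto
  have "1 - 2 * x i \<noteq> 0" using x i vertex_iff[of "cdim X l" x] by force
  then have "sf l ?y = edge_face (cdim X l) x i" unfolding sf edge_face_def by (auto simp: edge_dir_def)
  moreover have "quot X l ?y \<in> W" using t(4,5) l'(6) by auto
  ultimately show ?thesis using subcomplex_carrier(1)[OF W] carrier_eq[OF l yc] by metis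
qed

lemma edge_simplex:
  assumes l: "l \<in> cubes X" and x: "face l {x}" "quot X l x = v" and i: "i < cdim X l"
    and W: "quot X l ` edge_face (cdim X l) x i \<subseteq> W"
  shows "{link_point X (l, x, edge_dir x i)} \<in> Lk X v W"
proof -
  have "{link_point X (l, x, edge_dir x i)} =
      link_point X ` {(l, x, u) |u. u \<in> directions (cdim X l) (edge_face (cdim X l) x i) x}"
    using directions_edge_face[OF x(1) i] by auto
  then show ?thesis
    unfolding Lk_def using l x W edge_face_is_face[OF x(1) i] in_edge_face[OF x(1) i] edge_face_not_vertex[OF x(1) i]
    by blast
qed

lemma face_image_in_space: "l \<in> cubes X \<Longrightarrow> face l F \<Longrightarrow> quot X l ` F \<subseteq> space_of X"
  using face_subset_cube quot_in_space by blast

text \<open>A vertex of the link is a point whose germ runs along an edge. The carrier of the points on the ray is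
  thus contained in an edge, which has diameter \<open>1\<close>. If the direction \<open>u\<close> had two nonzero
  coordinates, this carrier would contain two vertices at distance \<open>sqrt 2\<close>.\<close>

lemma vertex_of_simplex_is_edge:
  assumes l: "l \<in> cubes X" and x: "face l {x}" and F: "face l F" "x \<in> F"
    and u: "u \<in> directions (cdim X l) F x"
    and q: "{link_point X (l, x, u)} \<in> Lk X v (space_of X)"
  obtains i where "i < cdim X l" "u = edge_dir x i" "edge_face (cdim X l) x i \<subseteq> F"
proof -
  let ?n = "cdim X l"
  obtain l' x' F' where l': "l' \<in> cubes X" "face l' {x'}" "face l' F'" "x' \<in> F'" "F' \<noteq> {x'}"
    and e: "{link_point X (l, x, u)} = link_point X ` {(l', x', u) |u. u \<in> directions (cdim X l') F' x'}"
    using q by (auto simp: Lk_def)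
  obtain i' where i': "i' < cdim X l'" "edge_face (cdim X l') x' i' \<subseteq> F'"
    using face_has_edge[OF l'(3,4,5)] .
  let ?E = "edge_face (cdim X l') x' i'" and ?u = "edge_dir x' i'"
  have u': "?u \<in> directions (cdim X l') ?E x'" using directions_edge_face[OF l'(2) i'(1)] by blast
  then have "?u \<in> directions (cdim X l') F' x'" using directions_mono[OF i'(2)] by blast
  then have "link_point X (l', x', ?u) \<in> {link_point X (l, x, u)}" unfolding e by blast
  then have "same_germ (l, x, u) (l', x', ?u)" using link_point_same_germ by simp
  then obtain s t where t: "0 < t" "t < s" "ray x u s \<in> F" "ray x' ?u s \<in> ?E" "ray x u t \<in> F" "ray x' ?u t \<in> ?E"
      "quot X l (ray x u t) = quot X l' (ray x' ?u t)"
    using same_germ_ray[OF _ F u edge_face_is_face[OF l'(2) i'(1)] in_edge_face[OF l'(2) i'(1)] u'] by blast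
  have sc: "ray x u s \<in> cube l" using t(3) F face_subset_cube by blast
  have yc: "ray x u t \<in> cube l" and sf: "sf l (ray x u t) = {z \<in> cube l. \<forall>j<?n. u j = 0 \<longrightarrow> z j = x j}"
    using ray_smallest_face[OF x sc t(1,2)] by auto
  have xc: "x \<in> cube l" using cube_of_face l x by blast
  have img: "quot X l ` sf l (ray x u t) \<subseteq> quot X l' ` ?E"
    using quot_smallest_face_subset[OF l l'(1) yc edge_face_is_face[OF l'(2) i'(1)] t(6,7)] .
  have short: "cdist X a b \<le> 1" if ab: "a \<in> quot X l' ` ?E" "b \<in> quot X l' ` ?E" for a b
  proof -
    obtain y z where yz: "y \<in> ?E" "z \<in> ?E" "a = quot X l' y" "b = quot X l' z" using ab by blast
    obtain r r' where r: "y = lerp r x' (opposite x' i')" "z = lerp r' x' (opposite x' i')" "r \<in> {0..1}" "r' \<in> {0..1}"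
      using yz edge_face_eq_lerp[OF l'(2) i'(1)] by auto
    have "E l' y z \<le> 1" unfolding r(1,2) euclid_dist_lerp opposite_dist[OF l'(2) i'(1)] using r(3,4) by auto
    then show ?thesis using cube_isometric[OF l'(1), of y z] yz by (simp add: edge_face_def)
  qed
  have one: "i = j" if ij: "i < ?n" "j < ?n" "u i \<noteq> 0" "u j \<noteq> 0" for i j
  proof (rule ccontr)
    assume ne: "i \<noteq> j"
    have oc: "opposite x i \<in> cube l" "opposite x j \<in> cube l" using opposite_in_cube xc ij by auto
    then have "opposite x i \<in> sf l (ray x u t)" "opposite x j \<in> sf l (ray x u t)"
      unfolding sf using ij by auto
    then have "cdist X (quot X l (opposite x i)) (quot X l (opposite x j)) \<le> 1" using img short by blast
    then have "E l (opposite x i) (opposite x j) \<le> 1" using cube_isometric[OF l oc] by simp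
    then have "(E l (opposite x i) (opposite x j))\<^sup>2 \<le> 1" by (simp add: power_le_one)
    moreover have "(E l x (opposite x j))\<^sup>2 = 1" using opposite_dist[OF x ij(2)] by simp
    moreover have "(1 - x i - x i)\<^sup>2 = 1" using x ij(1) vertex_iff[of ?n x] by fastforce
    ultimately show False using euclid_dist_upd[OF ij(1), of x "1 - x i" "opposite x j"] ne by simp
  qed
  have norm: "L2_set u {..<?n} = 1" and ray0: "\<And>i. i \<ge> ?n \<Longrightarrow> u i = 0" using u by (auto simp: directions_def)
  obtain i where i: "i < ?n" "u i \<noteq> 0"
  proof (rule ccontr)
    assume "\<not> thesis"
    then have "u j = 0" if "j < ?n" for j using that \<open>\<And>i. i < ?n \<Longrightarrow> u i \<noteq> 0 \<Longrightarrow> thesis\<close> by blast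
    then have "L2_set u {..<?n} = 0" by (simp add: L2_set_def)
    then show False using norm by simp
  qed
  have uj: "u j = 0" if "j \<noteq> i" for j using one[OF i(1), of j] i(2) that ray0[of j] by (cases "j < ?n") auto
  have "ray x u s \<in> edge_face ?n x i" unfolding edge_face_def using sc uj by simp
  then have "u \<in> directions ?n (edge_face ?n x i) x"
    using norm ray0 t(1,2) unfolding directions_def by (auto intro!: exI[of _ s])
  then have "u = edge_dir x i" using directions_edge_face[OF x i(1)] by simp
  moreover have "edge_face ?n x i \<subseteq> F"
    using edge_in_face[OF F t(3) _ i(1)] i(2) t(1,2) by simp
  ultimately show thesis using that i(1) by blast
qed

text \<open>The simplex of the carrier of \<open>y\<close> at \<open>v\<close> has all its vertices in the link of \<open>W\<close>, so fullness puts
  it there. As a set of link points it is then the simplex of some cell in \<open>W\<close>, possibly of another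
  cube. The ray from \<open>x\<close> towards \<open>y\<close> gives an interior point of the simplex; its germ agrees with that of a
  ray in this cell, so points on it and their carriers are in \<open>W\<close>.\<close>

lemma full_link_criterion:
  assumes W: "subcomplex X W" and full: "full_subcomplex (Lk X v W) (Lk X v (space_of X))" and v: "v \<in> W"
    and l: "l \<in> cubes X" and y: "y \<in> cube l" and x: "face l {x}" "x \<in> sf l y" "quot X l x = v"
    and edges: "\<And>i. i < cdim X l \<Longrightarrow> y i \<noteq> x i \<Longrightarrow> quot X l ` edge_face (cdim X l) x i \<subseteq> W"
  shows "quot X l y \<in> W"
proof (cases "y = x")
  case True then show ?thesis using x v by simp
next
  case False
  let ?n = "cdim X l"
  have F: "face l (sf l y)" using is_face_smallest_face[OF y] .
  have ys: "y \<in> sf l y" using in_smallest_face[OF y] .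
  have xc: "x \<in> cube l" using cube_of_face[OF l x(1)] .
  let ?\<sigma> = "link_point X ` {(l, x, u) |u. u \<in> directions ?n (sf l y) x}"
  have "?\<sigma> \<in> Lk X v (space_of X)"
    unfolding Lk_def using l x F ys False face_image_in_space[OF l F] by blast
  moreover have "{q} \<in> Lk X v W" if q: "q \<in> ?\<sigma>" "{q} \<in> Lk X v (space_of X)" for q
  proof -
    obtain u where u: "u \<in> directions ?n (sf l y) x" "q = link_point X (l, x, u)" using q(1) by blast
    obtain i where i: "i < ?n" "u = edge_dir x i" "edge_face ?n x i \<subseteq> sf l y"
      using vertex_of_simplex_is_edge[OF l x(1) F x(2) u(1)] q(2) u(2) by blast
    have "opposite x i \<in> sf l y" using i(3) opposite_in_edge_face[OF x(1) i(1)] by blast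
    then have "y i \<noteq> x i" using opposite_in_smallest_face[OF x(1) y i(1) x(2)] by simp
    then show ?thesis using edge_simplex[OF l x(1,3) i(1) edges[OF i(1)]] u(2) i(2) by simp
  qed
  ultimately have "?\<sigma> \<in> Lk X v W" using full unfolding full_subcomplex_def by blast
  then obtain l' x' F' where l': "l' \<in> cubes X" "face l' {x'}" "face l' F'" "x' \<in> F'" "quot X l' ` F' \<subseteq> W"
    and e: "?\<sigma> = link_point X ` {(l', x', u) |u. u \<in> directions (cdim X l') F' x'}"
    by (auto simp: Lk_def)
  define r where "r = E l y x"
  have r: "r > 0" using False euclid_dist_zero[OF y xc] euclid_dist_nonneg[of ?n y x] unfolding r_def by linarith
  define u where "u = (\<lambda>i. (y i - x i) / r)"
  have ry: "ray x u r = y" using r by (auto simp: u_def)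
  have "L2_set u {..<?n} = 1"
  proof -
    have "(\<Sum>i<?n. (u i)\<^sup>2) = (\<Sum>i<?n. (y i - x i)\<^sup>2) / r\<^sup>2"
      by (simp add: u_def power_divide sum_divide_distrib)
    also have "\<dots> = 1" using r unfolding euclid_dist_sq[of ?n y x, symmetric] r_def by simp
    finally show ?thesis by (simp add: L2_set_def)
  qed
  then have u: "u \<in> directions ?n (sf l y) x"
    unfolding directions_def using r ry ys xc y by (auto simp: u_def unit_cube_def intro!: exI[of _ r])
  then have "link_point X (l, x, u) \<in> link_point X ` {(l', x', u) |u. u \<in> directions (cdim X l') F' x'}"
    unfolding e[symmetric] by blast
  then obtain u' where u': "u' \<in> directions (cdim X l') F' x'" "link_point X (l, x, u) = link_point X (l', x', u')"
    by blast
  obtain s t where t: "0 < t" "t < s" "ray x u s \<in> sf l y" "ray x' u' t \<in> F'"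
      "quot X l (ray x u t) = quot X l' (ray x' u' t)"
    using same_germ_ray[OF link_point_same_germ[OF u'(2)] F x(2) u l'(3,4) u'(1)] by blast
  have sc: "ray x u s \<in> cube l" using t(3) smallest_face_subset_cube[OF y] by blast
  have tc: "ray x u t \<in> cube l" and sf: "sf l (ray x u t) = {z \<in> cube l. \<forall>j<?n. u j = 0 \<longrightarrow> z j = x j}"
    using ray_smallest_face[OF x(1) sc t(1,2)] by auto
  have "y \<in> sf l (ray x u t)" unfolding sf using y r by (auto simp: u_def)
  moreover have "quot X l (ray x u t) \<in> W" using t(4,5) l'(5) by auto
  ultimately show ?thesis using subcomplex_carrier(1)[OF W] carrier_eq[OF l tc] by blast
qed

section \<open>Full links imply convexity\<close>

text \<open>Round each coordinate that is not \<open>1\<close> down to \<open>0\<close>.\<close>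

lemma carrier_has_vertex:
  assumes "z \<in> space_of X"
  obtains v where "v \<in> vertices X" "v \<in> carrier z"
proof -
  obtain l y where y: "l \<in> cubes X" "y \<in> cube l" "z = quot X l y" using space_cases[OF assms] .
  define x :: point where "x i = (if y i = 1 then 1 else 0)" for i
  have f: "face l {x}" unfolding vertex_iff using y(2) by (auto simp: x_def unit_cube_def)
  have "x \<in> sf l y" unfolding smallest_face_eq[OF y(2)] using cube_of_face[OF y(1) f] by (auto simp: x_def)
  then have "quot X l x \<in> carrier z" using carrier_eq[OF y(1,2)] y(3) by blast
  moreover have "quot X l x \<in> vertices X" using y(1) f by (auto simp: vertices_def)
  ultimately show thesis using that by blast
qed

text \<open>An edge is the geodesic between its ends. So edges of different cubes with the same ends have the
  same image.\<close>

lemma edge_image: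
  assumes l: "l \<in> cubes X" and x: "face l {x}" and i: "i < cdim X l"
  shows "quot X l ` edge_face (cdim X l) x i = geod (quot X l x) (quot X l (opposite x i)) ` {0..1}"
proof -
  have c: "x \<in> cube l" "opposite x i \<in> cube l" using cube_of_face[OF l x] opposite_in_cube[OF _ i] by auto
  show ?thesis
    unfolding edge_face_eq_lerp[OF x i] image_image using geod_in_cube[OF l c] by (intro image_cong) auto
qed

text \<open>Near \<open>z\<close> all geodesics run in the open star of a vertex \<open>v\<close> of the carrier of \<open>z\<close>. The midpoint of a
  geodesic with ends in \<open>W\<close> is in \<open>W\<close> by \<open>full_link_criterion\<close>, provided that the edges at \<open>v\<close> along
  which it has a positive coordinate are in \<open>W\<close>. For an edge not in \<open>W\<close> the height vanishes at the
  ends of the geodesic, hence at the midpoint.\<close>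

lemma full_links_imp_locally_convex:
  assumes W: "subcomplex X W" and z: "z \<in> W"
    and full: "\<And>v. v \<in> vertices X \<inter> W \<Longrightarrow> full_subcomplex (Lk X v W) (Lk X v (space_of X))"
  shows "\<exists>\<epsilon>>0. convex_near W z \<epsilon>"
proof -
  have zM: "z \<in> space_of X" using subcomplex_carrier(2)[OF W z] .
  obtain v where v: "v \<in> vertices X" "v \<in> carrier z" using carrier_has_vertex[OF zM] .
  have vW: "v \<in> W" using v subcomplex_carrier(1)[OF W z] by blast
  obtain \<delta> where \<delta>: "\<delta> > 0" "\<And>b. b \<in> space_of X \<Longrightarrow> cdist X z b < \<delta> \<Longrightarrow> carrier z \<subseteq> carrier b"
    using carrier_near[OF zM] by blast
  have "geod p q (1/2) \<in> W" if pq: "p \<in> W" "q \<in> W" "cdist X z p < \<delta> / 3" "cdist X z q < \<delta> / 3" for p q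
  proof -
    have M: "p \<in> space_of X" "q \<in> space_of X" using subcomplex_carrier(2)[OF W] pq by auto
    have star: "v \<in> carrier (geod p q t)" if t: "0 \<le> t" "t \<le> 1" for t
    proof -
      have b: "between t p q (geod p q t)" using geod_between[OF M t] .
      have "cdist X p (geod p q t) = t * cdist X p q" using b by (simp add: between_def)
      also have "\<dots> \<le> 1 * cdist X p q" using t by (intro mult_right_mono) auto
      also have "\<dots> < 2 * \<delta> / 3" using triangle[OF M(1) zM M(2)] commute[of p z] pq by simp
      finally have "cdist X z (geod p q t) < \<delta>"
        using triangle[OF zM M(1) between_in[OF b]] pq by simp
      then show ?thesis using \<delta>(2)[OF between_in[OF b]] v by blast
    qed
    have mM: "geod p q (1/2) \<in> space_of X" using geod_in[OF M] by simp
    obtain l y where y: "l \<in> cubes X" "y \<in> cube l" "geod p q (1/2) = quot X l y" using space_cases[OF mM] .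
    obtain x where x: "x \<in> sf l y" "x \<in> cube l" "quot X l x = v"
      using carrier_rep[OF y(1,2)] star[of "1/2"] y(3) by auto
    have f: "face l {x}" using vertex_rep[OF v(1) y(1) x(2,3)] .
    have "quot X l ` edge_face (cdim X l) x i \<subseteq> W" if i: "i < cdim X l" "y i \<noteq> x i" for i
    proof (rule ccontr)
      assume bad: "\<not> quot X l ` edge_face (cdim X l) x i \<subseteq> W"
      let ?u = "quot X l (opposite x i)"
      have oc: "opposite x i \<in> cube l" using opposite_in_cube x i by blast
      have u: "?u \<in> vertices X" using opposite_vertex[OF f i(1)] y(1) by (auto simp: vertices_def)
      have vu: "cdist X v ?u = 1" using cube_isometric[OF y(1) x(2) oc] opposite_dist[OF f i(1)] x(3) by simp
      have ends: "?u \<notin> carrier a" if a: "a \<in> W" "v \<in> carrier a" for a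
      proof
        assume ua: "?u \<in> carrier a"
        obtain l1 y1 where y1: "l1 \<in> cubes X" "y1 \<in> cube l1" "a = quot X l1 y1"
          using space_cases[OF subcomplex_carrier(2)[OF W a(1)]] .
        obtain x1 i1 where x1: "face l1 {x1}" "x1 \<in> sf l1 y1" "quot X l1 x1 = v" "i1 < cdim X l1"
            "quot X l1 (opposite x1 i1) = ?u"
          using adjacent_rep[OF v(1) u vu y1(1,2)] a(2) ua y1(3) by metis
        have "y1 i1 \<noteq> x1 i1" using opposite_in_carrier[OF y1(1) x1(1,4) y1(2) x1(2)] ua x1(5) y1(3) by simp
        then have "edge_face (cdim X l1) x1 i1 \<subseteq> sf l1 y1"
          using edge_in_face[OF is_face_smallest_face[OF y1(2)] x1(2) in_smallest_face[OF y1(2)] _ x1(4)] by blast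
        then have "quot X l1 ` edge_face (cdim X l1) x1 i1 \<subseteq> W"
          using subcomplex_carrier(1)[OF W a(1)] carrier_eq[OF y1(1,2)] y1(3) by blast
        moreover have "quot X l1 ` edge_face (cdim X l1) x1 i1 = quot X l ` edge_face (cdim X l) x i"
          using edge_image[OF y1(1) x1(1,4)] edge_image[OF y(1) f i(1)] x1(3,5) x(3) by simp
        ultimately show False using bad by simp
      qed
      have p0: "geod p q 0 = p" "geod p q 1 = q" using geod_eq[OF M] M by auto
      have "?u \<notin> carrier p" "?u \<notin> carrier q" using ends pq star[of 0] star[of 1] p0 by auto
      then have "?u \<notin> carrier (geod p q (1/2))"
        using height_vanishes_on_geodesic[OF v(1) u vu M star] by simp
      then show False using opposite_in_carrier[OF y(1) f i(1) y(2) x(1)] i(2) y(3) by simp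
    qed
    then show ?thesis using full_link_criterion[OF W _ vW y(1,2) f x(1,3)] full v vW y(3) by simp
  qed
  then show ?thesis unfolding convex_near_def using \<delta>(1) by (intro exI[of _ "\<delta> / 3"]) auto
qed

theorem full_links_imp_convex:
  assumes W: "subcomplex X W" and conn: "connectedin (ctopology X) W"
    and full: "\<And>v. v \<in> vertices X \<inter> W \<Longrightarrow> full_subcomplex (Lk X v W) (Lk X v (space_of X))"
  shows "geodesically_convex (space_of X) (cdist X) W"
  using locally_convex_imp_convex conn subcomplex_closed[OF W] full_links_imp_locally_convex[OF W _ full]
  unfolding ctopology_def by blast

section \<open>Convexity implies full links\<close>

text \<open>Induction on the set \<open>S\<close> of edges that span the face. The midpoint of an interior point \<open>a\<close> of the
  face spanned by \<open>S\<close> and an interior point \<open>b\<close> of one further edge is interior to the face spanned by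
  all of them, and its carrier is this face.\<close>

lemma convex_contains_face:
  assumes W: "subcomplex X W" and conv: "geodesically_convex (space_of X) (cdist X) W"
    and l: "l \<in> cubes X" and x: "face l {x}" "quot X l x \<in> W"
    and S: "finite S" "S \<subseteq> {..<cdim X l}"
    and edges: "\<And>i. i \<in> S \<Longrightarrow> quot X l ` edge_face (cdim X l) x i \<subseteq> W"
  shows "quot X l ` {z \<in> cube l. \<forall>j<cdim X l. j \<notin> S \<longrightarrow> z j = x j} \<subseteq> W"
  using S edges
proof (induction S)
  case empty
  have "z = x" if "z \<in> cube l" "\<forall>j<cdim X l. z j = x j" for z
    using unit_cube_eqI[OF that(1) cube_of_face[OF l x(1)]] that(2) by blast
  then show ?case using x by auto
next
  case (insert k S)
  let ?n = "cdim X l"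
  have xc: "x \<in> cube l" using cube_of_face[OF l x(1)] .
  have x01: "x i = 0 \<or> x i = 1" if "i < ?n" for i using x(1) vertex_iff that by blast
  have k: "k < ?n" using insert.prems by simp
  define a :: point where "a i = (if i \<in> S then 1/2 else x i)" for i
  define b :: point where "b = x(k := 1/2)"
  have ac: "a \<in> cube l" using xc insert.prems by (auto simp: a_def unit_cube_def)
  have bc: "b \<in> cube l" using xc k by (auto simp: b_def unit_cube_def)
  have "quot X l a \<in> W" using insert ac by (auto simp: a_def)
  moreover have "b \<in> edge_face ?n x k" using bc by (simp add: b_def edge_face_def)
  then have "quot X l b \<in> W" using insert.prems by blast
  ultimately have "geod (quot X l a) (quot X l b) (1/2) \<in> W" using conv unfolding geodesically_convex_iff by simp
  then have mW: "quot X l (lerp (1/2) a b) \<in> W" using geod_in_cube[OF l ac bc] by simp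
  have mc: "lerp (1/2) a b \<in> cube l" using lerp_in_cube[OF ac bc] by simp
  have m: "lerp (1/2) a b j = 0 \<or> lerp (1/2) a b j = 1 \<longleftrightarrow> j \<notin> insert k S" "j \<notin> insert k S \<Longrightarrow> lerp (1/2) a b j = x j"
    if "j < ?n" for j
    using x01[OF that] insert.hyps by (auto simp: lerp_def a_def b_def)
  have "{z \<in> cube l. \<forall>j<?n. j \<notin> insert k S \<longrightarrow> z j = x j} \<subseteq> sf l (lerp (1/2) a b)"
    unfolding smallest_face_eq[OF mc] using m by auto
  then show ?case using subcomplex_carrier(1)[OF W mW] carrier_eq[OF l mc] by blast
qed

text \<open>The vertices of a simplex of the link come from the edges at \<open>x\<close> of a face, and these span the face.\<close>

theorem convex_imp_full_link:
  assumes W: "subcomplex X W" and conv: "geodesically_convex (space_of X) (cdist X) W"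
    and v: "v \<in> W"
  shows "full_subcomplex (Lk X v W) (Lk X v (space_of X))"
  unfolding full_subcomplex_def
proof (intro conjI ballI impI)
  have "W \<subseteq> space_of X" using conv by (simp add: geodesically_convex_def)
  then show "Lk X v W \<subseteq> Lk X v (space_of X)" unfolding Lk_def by blast
  fix \<sigma> assume "\<sigma> \<in> Lk X v (space_of X)" and vert: "\<forall>q\<in>\<sigma>. {q} \<in> Lk X v (space_of X) \<longrightarrow> {q} \<in> Lk X v W"
  then obtain l x F where l: "l \<in> cubes X" and x: "face l {x}" "quot X l x = v" and F: "face l F" "x \<in> F" "F \<noteq> {x}"
    and \<sigma>: "\<sigma> = link_point X ` {(l, x, u) |u. u \<in> directions (cdim X l) F x}"
    unfolding Lk_def by blast
  let ?n = "cdim X l"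
  let ?S = "{i \<in> {..<?n}. edge_face ?n x i \<subseteq> F}"
  have "quot X l ` edge_face ?n x i \<subseteq> W" if i: "i \<in> ?S" for i
  proof -
    have i': "i < ?n" "edge_face ?n x i \<subseteq> F" using i by auto
    have "edge_dir x i \<in> directions ?n F x"
      using directions_mono[OF i'(2)] directions_edge_face[OF x(1) i'(1)] by blast
    then have "link_point X (l, x, edge_dir x i) \<in> \<sigma>" unfolding \<sigma> by blast
    moreover have "{link_point X (l, x, edge_dir x i)} \<in> Lk X v (space_of X)"
      using edge_simplex[OF l x i'(1)] face_image_in_space[OF l edge_face_is_face[OF x(1) i'(1)]] by blast
    ultimately show ?thesis using edge_image_in_subcomplex[OF W l x(1) i'(1)] vert by blast
  qed
  then have "quot X l ` {z \<in> cube l. \<forall>j<?n. j \<notin> ?S \<longrightarrow> z j = x j} \<subseteq> W"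
    using convex_contains_face[OF W conv l x(1), of ?S] x v by auto
  moreover have "F \<subseteq> {z \<in> cube l. \<forall>j<?n. j \<notin> ?S \<longrightarrow> z j = x j}"
    using edge_in_face[OF F(1,2)] face_subset_cube[OF F(1)] by blast
  ultimately have "quot X l ` F \<subseteq> W" by blast
  then show "\<sigma> \<in> Lk X v W" unfolding Lk_def \<sigma> using l x F by blast
qed

end

theorem theorem1p1:
  fixes X :: "('l, 'a) cubing" and W :: "'a set"
  assumes "CAT0_cubed_complex X"
    and "finite_dimensional X"
    and "subcomplex X W"
    and "connectedin (ctopology X) W"
  shows "geodesically_convex (space_of X) (cdist X) W \<longleftrightarrow>
    (\<forall>v \<in> vertices X \<inter> W. full_subcomplex (Lk X v W) (Lk X v (space_of X)))"
proof -
  interpret CAT0_cubes X by (rule CAT0_cubes.intro[OF assms(1)])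
  show ?thesis using convex_imp_full_link full_links_imp_convex assms(3,4) by blast
qed

end
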